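(* Let $\ell \ge r \ge 4$ and $t \ge 4$ be fixed integers. Then for all sufficiently large $n$, \[ \mathrm{ar}(n,H_{F}^{r}) = t_{r}(n,\ell) + 2 \quad\text{for all}\quad F\in \{K_{\ell}^{\alpha}[t],\ K_{\ell}^{\beta}[t],\ K_{\ell}^{\gamma}[t]\}. \]
   Context: An $r$-graph is a collection of $r$-subsets of a finite vertex set. $K_n^r$ is the complete $r$-graph on $[n]$. Given $\chi\colon K_n^r\to\mathbb{N}$, a subgraph is rainbow if no two of its edges receive the same color. $\mathrm{ar}(n,F)$ is the minimum $m$ such that every surjective map $\chi\colon K_n^r\to[m]$ contains a rainbow copy of the $r$-graph $F$. For a graph $F$, the expansion $H_F^r$ is the $r$-graph obtained from $F$ by adding to each edge a set of $r-2$ new vertices, different edges receiving disjoint new sets. $K_\ell[t]$ is the complete $\ell$-partite graph with all parts of size $t$. $K_\ell^\alpha[t]$ is obtained from $K_\ell[t]$ by adding a path with two edges inside one part; $K_\ell^\beta[t]$ by adding two disjoint edges inside one part; $K_\ell^\gamma[t]$ by adding two edges inside two different parts (one edge in each). Let $V_1\sqcup\cdots\sqcup V_\ell=[n]$ with $|V_\ell|+1\ge|V_1|\ge\cdots\ge|V_\ell|$; $T_r(n,\ell)$ is the $r$-graph of all $r$-subsets of $[n]$ containing at most one vertex from each $V_i$, and $t_r(n,\ell)$ is its number of edges. *)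

theory Defs
  imports Complex_Main "HOL-Library.Disjoint_Sets"
begin

text \<open>Graphs and \<open>r\<close>-graphs are represented by their edge sets. None of the graphs considered
  here has isolated vertices, so the vertex set of \<open>F\<close> is \<open>\<Union>F\<close>.\<close>

definition complete_rgraph :: "nat \<Rightarrow> nat \<Rightarrow> nat set set" where
  "complete_rgraph r n = {e. e \<subseteq> {1..n} \<and> card e = r}"

definition is_copy :: "'b set set \<Rightarrow> 'a set set \<Rightarrow> bool" where
  "is_copy G F \<longleftrightarrow> (\<exists>\<phi>. bij_betw \<phi> (\<Union>F) (\<Union>G) \<and> G = (\<lambda>e. \<phi> ` e) ` F)"

definition rainbow :: "('a set \<Rightarrow> nat) \<Rightarrow> 'a set set \<Rightarrow> bool" where
  "rainbow \<chi> G \<longleftrightarrow> (\<forall>e\<in>G. \<forall>e'\<in>G. e \<noteq> e' \<longrightarrow> \<chi> e \<noteq> \<chi> e')"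

text \<open>The number of colours is required to be positive: for \<open>m = 0\<close> there is no map from a
  nonempty complete \<open>r\<close>-graph to the empty set, so the condition would hold vacuously.\<close>

definition ar :: "nat \<Rightarrow> nat \<Rightarrow> 'a set set \<Rightarrow> nat" where
  "ar r n F = (LEAST m. 1 \<le> m \<and>
     (\<forall>\<chi> :: nat set \<Rightarrow> nat. \<chi> ` complete_rgraph r n = {1..m} \<longrightarrow>
        (\<exists>G \<subseteq> complete_rgraph r n. is_copy G F \<and> rainbow \<chi> G)))"

text \<open>The new vertices attached to the edge \<open>e\<close> are \<open>Inr (e, i)\<close> for \<open>i < r - 2\<close>.\<close>

definition expansion :: "nat \<Rightarrow> 'a set set \<Rightarrow> ('a + 'a set \<times> nat) set set" where
  "expansion r F = (\<lambda>e. Inl ` e \<union> (\<lambda>i. Inr (e, i)) ` {..<r - 2}) ` F"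

text \<open>The vertex \<open>(i, a)\<close> is the \<open>a\<close>-th vertex of the \<open>i\<close>-th part.\<close>

definition complete_multipartite :: "nat \<Rightarrow> nat \<Rightarrow> (nat \<times> nat) set set" where
  "complete_multipartite l t =
     {{(i, a), (j, b)} | i j a b. i \<in> {1..l} \<and> j \<in> {1..l} \<and> i \<noteq> j \<and> a \<in> {1..t} \<and> b \<in> {1..t}}"

definition K_alpha :: "nat \<Rightarrow> nat \<Rightarrow> (nat \<times> nat) set set" where
  "K_alpha l t = complete_multipartite l t \<union> {{(1, 1), (1, 2)}, {(1, 2), (1, 3)}}"

definition K_beta :: "nat \<Rightarrow> nat \<Rightarrow> (nat \<times> nat) set set" where
  "K_beta l t = complete_multipartite l t \<union> {{(1, 1), (1, 2)}, {(1, 3), (1, 4)}}"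

definition K_gamma :: "nat \<Rightarrow> nat \<Rightarrow> (nat \<times> nat) set set" where
  "K_gamma l t = complete_multipartite l t \<union> {{(1, 1), (1, 2)}, {(2, 1), (2, 2)}}"

definition balanced_partition :: "nat \<Rightarrow> nat \<Rightarrow> (nat \<Rightarrow> nat set) \<Rightarrow> bool" where
  "balanced_partition n l V \<longleftrightarrow>
     (\<Union>i\<in>{1..l}. V i) = {1..n} \<and> disjoint_family_on V {1..l} \<and>
     (\<forall>i\<in>{1..<l}. card (V (i + 1)) \<le> card (V i)) \<and> card (V 1) \<le> card (V l) + 1"

definition partite_rgraph :: "nat \<Rightarrow> nat \<Rightarrow> nat \<Rightarrow> (nat \<Rightarrow> nat set) \<Rightarrow> nat set set" where
  "partite_rgraph r n l V =
     {e. e \<subseteq> {1..n} \<and> card e = r \<and> (\<forall>i\<in>{1..l}. card (e \<inter> V i) \<le> 1)}"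

text \<open>The partition used for \<open>T\<^sub>r(n, l)\<close> is that into residue classes modulo \<open>l\<close>. It is balanced
  (\<open>balanced_residue_part\<close>), and every balanced partition yields the same number of edges
  (\<open>turan_number_eq\<close>).\<close>

definition residue_part :: "nat \<Rightarrow> nat \<Rightarrow> nat \<Rightarrow> nat set" where
  "residue_part n l i = {x \<in> {1..n}. x mod l = i mod l}"

definition turan_rgraph :: "nat \<Rightarrow> nat \<Rightarrow> nat \<Rightarrow> nat set set" where
  "turan_rgraph r n l = partite_rgraph r n l (residue_part n l)"

definition turan_number :: "nat \<Rightarrow> nat \<Rightarrow> nat \<Rightarrow> nat" where
  "turan_number r n l = card (turan_rgraph r n l)"

lemma balanced_residue_part:
  assumes "l \<ge> 1"
  shows "balanced_partition n l (residue_part n l)"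
proof -
  have fin: "finite (residue_part n l i)" for i
    by (simp add: residue_part_def)
  have "x \<in> (\<Union>i\<in>{1..l}. residue_part n l i)" if "x \<in> {1..n}" for x
  proof (cases "x mod l = 0")
    case True
    then have "x \<in> residue_part n l l" using that by (simp add: residue_part_def)
    then show ?thesis using assms by force
  next
    case False
    have "x mod l < l" using assms by simp
    then have "x mod l \<in> {1..l}" using False by simp
    moreover have "x \<in> residue_part n l (x mod l)" using that by (simp add: residue_part_def)
    ultimately show ?thesis by blast
  qed
  moreover have "(\<Union>i\<in>{1..l}. residue_part n l i) \<subseteq> {1..n}"
    by (auto simp: residue_part_def)
  ultimately have cover: "(\<Union>i\<in>{1..l}. residue_part n l i) = {1..n}" by blast
  have "i = j" if "i \<in> {1..l}" "j \<in> {1..l}" "i mod l = j mod l" for i j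
    using that by (cases "i = l"; cases "j = l") auto
  then have disj: "disjoint_family_on (residue_part n l) {1..l}"
    unfolding disjoint_family_on_def residue_part_def by fastforce
  have step: "x - 1 \<in> residue_part n l i"
    if "x \<in> residue_part n l (i + 1)" "x \<noteq> 1" for x i
  proof -
    have x: "x \<ge> 2" "x \<le> n" "x mod l = (i + 1) mod l"
      using that by (auto simp: residue_part_def)
    then obtain y where y: "x = Suc y" by (cases x) auto
    then have "int (Suc y) mod int l = int (Suc i) mod int l"
      using x(3) by (metis Suc_eq_plus1 zmod_int)
    then have "(int (Suc y) - 1) mod int l = (int (Suc i) - 1) mod int l"
      by (rule mod_diff_cong) simp
    then have "y mod l = i mod l"
      by (simp add: zmod_int[symmetric])
    then show ?thesis using x y by (simp add: residue_part_def)
  qed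
  have mono: "card (residue_part n l (i + 1)) \<le> card (residue_part n l i)" if "i \<in> {1..<l}" for i
  proof (rule card_inj_on_le[where f = "\<lambda>x. x - 1"])
    show "inj_on (\<lambda>x. x - 1) (residue_part n l (i + 1))"
      by (auto simp: inj_on_def residue_part_def)
    have "1 \<notin> residue_part n l (i + 1)"
      using that by (cases "i + 1 = l") (auto simp: residue_part_def)
    then show "(\<lambda>x. x - 1) ` residue_part n l (i + 1) \<subseteq> residue_part n l i"
      using step by blast
  qed (rule fin)
  have "residue_part n l 1 = residue_part n l (l + 1)"
    unfolding residue_part_def mod_add_self1 ..
  then have sub: "(\<lambda>x. x - 1) ` (residue_part n l 1 - {1}) \<subseteq> residue_part n l l"
    using step[of _ l] by blast
  have "inj_on (\<lambda>x. x - 1) (residue_part n l 1 - {1})"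
    by (auto simp: inj_on_def residue_part_def)
  then have "card (residue_part n l 1 - {1}) \<le> card (residue_part n l l)"
    using sub fin by (rule card_inj_on_le)
  moreover have "card (residue_part n l 1) - 1 \<le> card (residue_part n l 1 - {1})"
    using diff_card_le_card_Diff[of "{1 :: nat}" "residue_part n l 1"] by simp
  ultimately have "card (residue_part n l 1) \<le> card (residue_part n l l) + 1" by linarith
  with cover disj mono show ?thesis by (simp add: balanced_partition_def)
qed

lemma balanced_partition_card_antimono:
  assumes "balanced_partition n l V" "1 \<le> i" "i \<le> j" "j \<le> l"
  shows "card (V j) \<le> card (V i)"
  using assms(3,4)
proof (induction j rule: dec_induct)
  case (step k)
  then have "k \<in> {1..<l}" using assms(2) by simp
  then have "card (V (k + 1)) \<le> card (V k)"
    using assms(1) unfolding balanced_partition_def by blast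
  then show ?case using step by simp
qed simp

lemma balanced_partition_card_sum:
  assumes "balanced_partition n l V"
  shows "(\<Sum>i\<in>{1..l}. card (V i)) = n"
proof -
  have "finite (V i)" if "i \<in> {1..l}" for i
    using assms that unfolding balanced_partition_def
    by (metis UN_upper finite_atLeastAtMost finite_subset)
  then have "card (\<Union>i\<in>{1..l}. V i) = (\<Sum>i\<in>{1..l}. card (V i))"
    using assms unfolding balanced_partition_def disjoint_family_on_def
    by (intro card_UN_disjoint) auto
  then show ?thesis using assms by (simp add: balanced_partition_def)
qed

lemma balanced_partition_card_le:
  assumes V: "balanced_partition n l V" and W: "balanced_partition n l W" and i: "i \<in> {1..l}"
  shows "card (V i) \<le> card (W i)"
proof (rule ccontr)
  assume neg: "\<not> card (V i) \<le> card (W i)"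
  have "card (W j) \<le> card (V j)" if j: "j \<in> {1..l}" for j
  proof (cases "j \<le> i")
    case True
    have "card (W j) \<le> card (W 1)" "card (W l) \<le> card (W i)" "card (V i) \<le> card (V j)"
      using balanced_partition_card_antimono[OF W] balanced_partition_card_antimono[OF V] i j True
      by auto
    moreover have "card (W 1) \<le> card (W l) + 1" using W by (simp add: balanced_partition_def)
    ultimately show ?thesis using neg by linarith
  next
    case False
    have "card (W j) \<le> card (W i)" "card (V l) \<le> card (V j)" "card (V i) \<le> card (V 1)"
      using balanced_partition_card_antimono[OF W] balanced_partition_card_antimono[OF V] i j False
      by auto
    moreover have "card (V 1) \<le> card (V l) + 1" using V by (simp add: balanced_partition_def)
    ultimately show ?thesis using neg by linarith
  qed
  then have "(\<Sum>i\<in>{1..l}. card (W i)) < (\<Sum>i\<in>{1..l}. card (V i))"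
    using neg i by (intro sum_strict_mono_ex1) (auto intro!: bexI[of _ i])
  then show False using balanced_partition_card_sum[OF V] balanced_partition_card_sum[OF W] by simp
qed

lemma card_partite_rgraph_le:
  assumes V: "balanced_partition n l V" and W: "balanced_partition n l W"
  shows "card (partite_rgraph r n l V) \<le> card (partite_rgraph r n l W)"
proof -
  have fin: "finite (V i)" "finite (W i)" if "i \<in> {1..l}" for i
    using V W that unfolding balanced_partition_def
    by (metis UN_upper finite_atLeastAtMost finite_subset)+
  have "\<exists>f. bij_betw f (V i) (W i)" if "i \<in> {1..l}" for i
    using finite_same_card_bij[OF fin(1)[OF that] fin(2)[OF that]] that
      balanced_partition_card_le[OF V W that] balanced_partition_card_le[OF W V that] by auto
  then obtain f where f: "\<And>i. i \<in> {1..l} \<Longrightarrow> bij_betw (f i) (V i) (W i)" by metis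
  have "\<forall>x\<in>{1..n}. \<exists>i\<in>{1..l}. x \<in> V i" using V unfolding balanced_partition_def by blast
  then obtain p where p: "\<And>x. x \<in> {1..n} \<Longrightarrow> p x \<in> {1..l} \<and> x \<in> V (p x)" by metis
  define g where "g x = f (p x) x" for x
  have uniq: "i = j" if "x \<in> W i" "x \<in> W j" "i \<in> {1..l}" "j \<in> {1..l}" for x i j
    using W that unfolding balanced_partition_def disjoint_family_on_def by blast
  have gW: "g x \<in> W (p x)" if "x \<in> {1..n}" for x
    using f p[OF that] unfolding g_def bij_betw_def by blast
  have gn: "g x \<in> {1..n}" if "x \<in> {1..n}" for x
    using gW[OF that] p[OF that] W unfolding balanced_partition_def by blast
  have inj: "inj_on g {1..n}"
  proof (rule inj_onI)
    fix x y assume xy: "x \<in> {1..n}" "y \<in> {1..n}" "g x = g y"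
    then have eq: "p x = p y" using gW uniq p by metis
    then have "f (p x) x = f (p x) y" using xy(3) by (simp add: g_def)
    then show "x = y"
      using f[of "p x"] p[OF xy(1)] p[OF xy(2)] eq unfolding bij_betw_def inj_on_def by metis
  qed
  show ?thesis
  proof (rule card_inj_on_le[where f = "\<lambda>e. g ` e"])
    show "inj_on ((`) g) (partite_rgraph r n l V)"
      by (rule inj_on_subset[OF inj_on_image_Pow[OF inj]]) (auto simp: partite_rgraph_def)
    show "finite (partite_rgraph r n l W)"
      by (rule finite_subset[of _ "Pow {1..n}"]) (auto simp: partite_rgraph_def)
    show "(`) g ` partite_rgraph r n l V \<subseteq> partite_rgraph r n l W"
    proof (rule image_subsetI)
      fix e assume e: "e \<in> partite_rgraph r n l V"
      then have sub: "e \<subseteq> {1..n}" by (simp add: partite_rgraph_def)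
      have "card (g ` e \<inter> W i) \<le> 1" if i: "i \<in> {1..l}" for i
      proof -
        have "g ` e \<inter> W i \<subseteq> g ` (e \<inter> V i)"
        proof
          fix y assume "y \<in> g ` e \<inter> W i"
          then obtain x where x: "x \<in> e" "y = g x" "g x \<in> W i" by blast
          then have "x \<in> {1..n}" using sub by blast
          then show "y \<in> g ` (e \<inter> V i)" using x p gW uniq i by blast
        qed
        moreover have "finite (e \<inter> V i)" using fin(1)[OF i] by simp
        ultimately have "card (g ` e \<inter> W i) \<le> card (e \<inter> V i)"
          using card_image_le card_mono finite_imageI order_trans by metis
        then show ?thesis using e i unfolding partite_rgraph_def by fastforce
      qed
      moreover have "card (g ` e) = r"
        using card_image[OF inj_on_subset[OF inj sub]] e by (simp add: partite_rgraph_def)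
      ultimately show "g ` e \<in> partite_rgraph r n l W"
        using gn sub by (auto simp: partite_rgraph_def)
    qed
  qed
qed

lemma turan_number_eq:
  assumes "l \<ge> 1" "balanced_partition n l V"
  shows "turan_number r n l = card (partite_rgraph r n l V)"
  unfolding turan_number_def turan_rgraph_def
  using balanced_residue_part[OF assms(1)] assms(2)
  by (intro order_antisym card_partite_rgraph_le)

end

theory Submission
  imports Defs "HOL-Combinatorics.Transposition"
begin

text \<open>Write \<open>F\<close> as \<open>K\<^sub>l[t]\<close> plus two edges \<open>p\<close>, \<open>q\<close>. For the lower bound, the Turan \<open>r\<close>-graph
    receives
  distinct colours and all other edges one further colour: in every \<open>l\<close>-colouring of the vertices
  of \<open>F\<close> at least two edges are monochromatic, so a rainbow copy is impossible.

  For the upper bound, let \<open>G\<close> contain one edge of each colour and join two vertices in the codegree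
  graph if they lie in many common edges of \<open>G\<close>. Edges of the codegree graph expand greedily to
  edges of \<open>G\<close> that avoid any bounded set of vertices and colours, so without a rainbow copy the
  codegree graph contains no \<open>K\<^sub>l[t]\<close> plus one edge. Deleting vertices that support few private
      colours
  we may assume that every vertex has degree in \<open>G\<close> at least that of the Turan \<open>r\<close>-graph. By
  the Moon--Moser inequality all but boundedly many vertices then have degree at least
  \<open>(1 - 1 / l - \<epsilon>) n\<close> in the codegree graph, which forces it to be close to a balanced complete
  \<open>l\<close>-partite graph; counting edges of \<open>G\<close> at the remaining vertices extends the partition to all
  vertices. Finally, all \<open>r\<close>-sets with two vertices in one part have the same colour, so there is at
  most one colour more than there are transversal \<open>r\<close>-sets.\<close>

section \<open>Elementary symmetric sums and Turan numbers\<close>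

text \<open>Edges chosen inside \<open>G\<close> never clash in colour; only the two extra edges of
  \<open>F\<close> matter, and they may be any two \<open>r\<close>-sets of different colours. So
  everything reduces to placing \<open>K\<^sub>l[t]\<close> in the codegree graph around two
  prescribed \<open>r\<close>-sets. The codegree threshold has order \<open>n ^ (r - 3)\<close>
  because that bounds the number of \<open>r\<close>-sets through two given vertices and a forbidden
  third one. The obstacle is exactness. Stability describes the codegree graph only up to a small
  proportion of the vertices, whereas the bound \<open>turan_number r n l + 1\<close> on the colours
  tolerates no misplaced vertex. An atypical vertex can be placed only because its degree in
  \<open>G\<close> is large, which the number of colours alone does not give: this is the purpose of
  the deletions, and the reason for working over an arbitrary vertex set \<open>W\<close>. Placing
  it also needs that edges with two vertices in one typical part share a colour, so colours are
  forced twice, before and after the parts are enlarged. The small constants come from continuity at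
  zero of explicit gap functions.\<close>

definition rsets :: "nat \<Rightarrow> 'a set \<Rightarrow> 'a set set" where
  "rsets r W = {e. e \<subseteq> W \<and> card e = r}"

definition esym :: "'i set \<Rightarrow> ('i \<Rightarrow> nat) \<Rightarrow> nat \<Rightarrow> nat" where
  "esym I x k = (\<Sum>S\<in>rsets k I. \<Prod>i\<in>S. x i)"

definition transversals :: "'i set \<Rightarrow> ('i \<Rightarrow> 'a set) \<Rightarrow> nat \<Rightarrow> 'a set set" where
  "transversals I V k = {e \<in> rsets k (\<Union>i\<in>I. V i). \<forall>i\<in>I. card (e \<inter> V i) \<le> 1}"

lemma finite_rsets [simp]: "finite W \<Longrightarrow> finite (rsets r W)"
  by (rule finite_subset[of _ "Pow W"]) (auto simp: rsets_def)

lemma card_rsets: "finite W \<Longrightarrow> card (rsets r W) = card W choose r"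
  by (simp add: rsets_def n_subsets)

lemma rsets_mono: "W \<subseteq> W' \<Longrightarrow> rsets r W \<subseteq> rsets r W'"
  by (auto simp: rsets_def)

lemma complete_rgraph_eq_rsets: "complete_rgraph r n = rsets r {1..n}"
  by (simp add: complete_rgraph_def rsets_def)

lemma rsets_0: "finite I \<Longrightarrow> rsets 0 I = {{}}"
  by (auto simp: rsets_def dest: finite_subset)

lemma rsets_Suc_insert:
  assumes "finite I" "i \<notin> I"
  shows "rsets (Suc k) (insert i I) = rsets (Suc k) I \<union> insert i ` rsets k I"
proof (rule set_eqI)
  fix e
  show "e \<in> rsets (Suc k) (insert i I) \<longleftrightarrow> e \<in> rsets (Suc k) I \<union> insert i ` rsets k I"
  proof (cases "i \<in> e")
    case True
    then obtain e' where e': "e = insert i e'" "i \<notin> e'" by (metis mk_disjoint_insert)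
    have "card (insert i e') = Suc k \<longleftrightarrow> card e' = k" if "e' \<subseteq> I"
      using that e' assms by (simp add: finite_subset)
    then have "e \<in> rsets (Suc k) (insert i I) \<longleftrightarrow> e' \<in> rsets k I"
      using e' assms(2) by (auto simp: rsets_def)
    moreover have "e \<in> insert i ` rsets k I \<longleftrightarrow> e' \<in> rsets k I"
      using e' assms(2) unfolding rsets_def image_iff
      by (metis (no_types, lifting) insert_ident mem_Collect_eq subset_iff)
    ultimately show ?thesis using True assms(2) by (auto simp: rsets_def)
  qed (auto simp: rsets_def)
qed

lemma esym_0 [simp]: "finite I \<Longrightarrow> esym I x 0 = 1"
  by (simp add: esym_def rsets_0)

lemma esym_empty_Suc [simp]: "esym {} x (Suc k) = 0"
  unfolding esym_def by (rule sum.neutral) (auto simp: rsets_def)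

lemma esym_insert:
  assumes "finite I" "i \<notin> I"
  shows "esym (insert i I) x (Suc k) = esym I x (Suc k) + x i * esym I x k"
proof -
  have inj: "inj_on (insert i) (rsets k I)"
    using assms(2) by (auto simp: inj_on_def rsets_def)
  have disj: "rsets (Suc k) I \<inter> insert i ` rsets k I = {}"
    using assms(2) by (auto simp: rsets_def)
  have "(\<Prod>j\<in>insert i S. x j) = x i * (\<Prod>j\<in>S. x j)" if "S \<in> rsets k I" for S
    using that assms by (subst prod.insert) (auto simp: rsets_def dest: finite_subset)
  then show ?thesis
    using assms(1) disj
    by (simp add: esym_def rsets_Suc_insert[OF assms] sum.union_disjoint sum.reindex[OF inj]
        sum_distrib_left)
qed

lemma esym_mono:
  assumes "\<And>i. i \<in> I \<Longrightarrow> x i \<le> y i"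
  shows "esym I x k \<le> esym I y k"
  unfolding esym_def by (intro sum_mono prod_mono) (auto simp: rsets_def intro: assms)

lemma esym_const:
  assumes "finite I" shows "esym I (\<lambda>_. a) k = (card I choose k) * a ^ k"
proof -
  have "esym I (\<lambda>_. a) k = (\<Sum>S\<in>rsets k I. a ^ k)"
    unfolding esym_def by (rule sum.cong) (auto simp: rsets_def)
  then show ?thesis by (simp add: card_rsets[OF assms])
qed

text \<open>The induction adds one part at a time and mirrors \<open>esym_insert\<close>: a
  transversal either misses the new part or is one of its vertices joined to a transversal of size
  one less.\<close>

lemma card_transversals:
  assumes "finite I" "disjoint_family_on V I" "\<And>i. i \<in> I \<Longrightarrow> finite (V i)"
  shows "card (transversals I V k) = esym I (\<lambda>i. card (V i)) k"
  using assms
proof (induction I arbitrary: k rule: finite_induct)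
  case empty
  show ?case
  proof (cases k)
    case 0
    then have "transversals {} V k = {{}}" by (auto simp: transversals_def rsets_def)
    then show ?thesis using 0 by simp
  next
    case (Suc k')
    then have "transversals {} V k = {}" by (auto simp: transversals_def rsets_def)
    then show ?thesis using Suc by simp
  qed
next
  case (insert i I)
  let ?X = "\<Union>j\<in>I. V j"
  have fin: "finite ?X" "finite (V i)" using insert by auto
  have dis: "V i \<inter> ?X = {}"
    using insert.prems(1) insert.hyps(2) by (force simp: disjoint_family_on_def)
  have IH: "card (transversals I V k) = esym I (\<lambda>i. card (V i)) k" for k
    using insert.IH insert.prems by (auto simp: disjoint_family_on_def)
  show ?case
  proof (cases k)
    case 0
    have "transversals (insert i I) V 0 = {{}}"
      using fin insert by (auto simp: transversals_def rsets_def dest!: finite_subset)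
    then show ?thesis using 0 insert.hyps by simp
  next
    case (Suc m)
    let ?f = "\<lambda>(v, e). insert v e"
    have "transversals (insert i I) V (Suc m) =
        transversals I V (Suc m) \<union> ?f ` (V i \<times> transversals I V m)" (is "?L = ?R")
    proof (rule set_eqI)
      fix e
      show "e \<in> ?L \<longleftrightarrow> e \<in> ?R"
      proof
        assume e: "e \<in> ?L"
        then have sub: "e \<subseteq> V i \<union> ?X" and c: "card e = Suc m" "card (e \<inter> V i) \<le> 1"
          "\<forall>j\<in>I. card (e \<inter> V j) \<le> 1"
          by (auto simp: transversals_def rsets_def)
        have fe: "finite e" using sub fin by (auto dest: finite_subset)
        show "e \<in> ?R"
        proof (cases "e \<inter> V i = {}")
          case True
          then show ?thesis using sub c by (auto simp: transversals_def rsets_def)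
        next
          case False
          then obtain v where v: "v \<in> e" "v \<in> V i" by blast
          have "card (e \<inter> V i) = 1"
            using c(2) False fe by (metis card_0_eq finite_Int le_antisym less_one not_le)
          then have ev: "e \<inter> V i = {v}" using v by (metis IntI card_1_singletonE singletonD)
          have "card ((e - {v}) \<inter> V j) \<le> 1" if "j \<in> I" for j
            using c(3) that fe card_mono[of "e \<inter> V j" "(e - {v}) \<inter> V j"]
            by (metis Diff_subset Int_mono finite_Int le_trans order_refl)
          then have "e - {v} \<in> transversals I V m"
            using sub ev c(1) v fe by (auto simp: transversals_def rsets_def)
          then have "(v, e - {v}) \<in> V i \<times> transversals I V m" using v by simp
          moreover have "?f (v, e - {v}) = e" using v by auto
          ultimately show ?thesis by (metis UnI2 image_eqI)
        qed
      next
        assume "e \<in> ?R"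
        then consider "e \<in> transversals I V (Suc m)"
          | v e' where "v \<in> V i" "e' \<in> transversals I V m" "e = insert v e'" by auto
        then show "e \<in> ?L"
        proof cases
          case 1
          then have "e \<inter> V i = {}" using dis by (auto simp: transversals_def rsets_def)
          then show ?thesis using 1 by (auto simp: transversals_def rsets_def)
        next
          case 2
          have sub: "e' \<subseteq> ?X" using 2 by (auto simp: transversals_def rsets_def)
          then have fe: "finite e'" using fin by (auto dest: finite_subset)
          have v: "v \<notin> e'" using sub dis 2 by blast
          have "e \<inter> V i = {v}" using 2 sub dis by blast
          moreover have "e \<inter> V j = e' \<inter> V j" if "j \<in> I" for j using 2 dis that by blast
          ultimately show ?thesis using 2 v fe by (auto simp: transversals_def rsets_def)
        qed
      qed
    qed
    moreover have "transversals I V (Suc m) \<inter> ?f ` (V i \<times> transversals I V m) = {}"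
      using dis by (auto simp: transversals_def rsets_def)
    moreover have "inj_on ?f (V i \<times> transversals I V m)"
    proof (rule inj_onI, clarsimp)
      fix v e w e'
      assume a: "v \<in> V i" "e \<in> transversals I V m" "w \<in> V i" "e' \<in> transversals I V m"
        "insert v e = insert w e'"
      then have "v \<notin> e'" "w \<notin> e" "v \<notin> e" "w \<notin> e'"
        using dis by (auto simp: transversals_def rsets_def)
      then show "v = w \<and> e = e'" using a(5) by (metis insertE insertI1 insert_ident)
    qed
    moreover have "finite (transversals I V k)" for k
      using fin by (simp add: transversals_def)
    ultimately show ?thesis
      using Suc fin insert.hyps
      by (simp add: card_Un_disjoint card_image card_cartesian_product IH esym_insert)
  qed
qed

text \<open>With \<open>J\<close> the remaining indices, the sum is
  \<open>e_k(J) + (x_i + x_j) e_{k-1}(J) + x_i x_j e_{k-2}(J)\<close>. The shift keeps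
  \<open>x_i + x_j\<close> and, since \<open>x j < x i\<close>, does not decrease the
  product.\<close>

lemma esym_shift_le:
  assumes "finite I" "i \<in> I" "j \<in> I" "i \<noteq> j" "x j < x i"
  shows "esym I x k \<le> esym I (x(i := x i - 1, j := x j + 1)) k"
proof -
  define J where "J = I - {i, j}"
  let ?y = "x(i := x i - 1, j := x j + 1)"
  have I: "I = insert i (insert j J)" and J: "finite J" "i \<notin> insert j J" "j \<notin> J"
    using assms by (auto simp: J_def)
  have same: "esym J ?y k = esym J x k" for k
    unfolding esym_def
    by (intro sum.cong prod.cong) (auto simp: rsets_def J_def)
  have le: "x i * x j \<le> (x i - 1) * (x j + 1)"
    using assms(5) by (cases "x i") auto
  show ?thesis
  proof (cases k)
    case 0
    then show ?thesis using assms by simp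
  next
    case (Suc m)
    show ?thesis
    proof (cases m)
      case 0
      then show ?thesis using Suc J assms same[of "Suc 0"] unfolding I
        by (simp add: esym_insert same del: One_nat_def)
    next
      case (Suc m')
      have a: "x i - 1 + (x j + 1) = x i + x j" using assms(5) by simp
      have b: "esym I z (Suc (Suc m')) =
         esym J z (Suc (Suc m')) + (z i + z j) * esym J z (Suc m') + (z i * z j) * esym J z m'" for
             z
        using J unfolding I by (simp add: esym_insert algebra_simps)
      have yi: "?y i = x i - 1" "?y j = x j + 1" using assms(4) by simp_all
      have "?y i + ?y j = x i + x j" "x i * x j \<le> ?y i * ?y j"
        unfolding yi using a le by (simp_all del: One_nat_def)
      then have "(?y i + ?y j) * esym J x (Suc m') + ?y i * ?y j * esym J x m' \<ge>
          (x i + x j) * esym J x (Suc m') + x i * x j * esym J x m'"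
        by (metis add_left_mono mult_le_mono1)
      then show ?thesis
        using b[of x] b[of ?y] unfolding \<open>k = Suc m\<close> Suc same by linarith
    qed
  qed
qed

text \<open>Units are shifted from an index above \<open>y\<close> to one below it; the total excess
  over \<open>y\<close> is the induction measure. Balancedness of \<open>y\<close> gives
  \<open>x j < y j \<le> y i + 1 \<le> x i\<close>, so every shift goes from a larger to a smaller
  entry.\<close>

lemma esym_le_balanced:
  assumes "finite I" "sum x I = sum y I" "\<And>i j. i \<in> I \<Longrightarrow> j \<in> I \<Longrightarrow> y i \<le> y j + 1"
  shows "esym I x k \<le> esym I y k"
  using assms(2)
proof (induction "\<Sum>i\<in>I. x i - y i" arbitrary: x rule: less_induct)
  case less
  show ?case
  proof (cases "\<forall>i\<in>I. x i \<le> y i")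
    case True
    then show ?thesis by (intro esym_mono) auto
  next
    case False
    then obtain i where i: "i \<in> I" "y i < x i" by force
    have "\<exists>j\<in>I. x j < y j"
    proof (rule ccontr)
      assume "\<not> (\<exists>j\<in>I. x j < y j)"
      then have "sum y I < sum x I"
        using i assms(1) by (intro sum_strict_mono_ex1) (auto simp: not_less)
      then show False using less.prems by simp
    qed
    then obtain j where j: "j \<in> I" "x j < y j" by blast
    have ij: "i \<noteq> j" "x j < x i" using i j assms(3)[of j i] by auto
    define x' where "x' = x(i := x i - 1, j := x j + 1)"
    define J where "J = I - {i, j}"
    have I: "I = insert i (insert j J)" and J: "finite J" "i \<notin> insert j J" "j \<notin> J"
      using assms(1) i j by (auto simp: J_def)
    have rest: "x' a = x a" if "a \<in> J" for a using that by (auto simp: x'_def J_def)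
    have "sum x' J = sum x J" "(\<Sum>a\<in>J. x' a - y a) = (\<Sum>a\<in>J. x a - y a)"
      using rest by simp_all
    then have "sum x' I = sum x I" "(\<Sum>a\<in>I. x' a - y a) < (\<Sum>a\<in>I. x a - y a)"
      unfolding I using J i j ij by (auto simp: x'_def)
    then have "esym I x' k \<le> esym I y k" using less by auto
    moreover have "esym I x k \<le> esym I x' k"
      unfolding x'_def using esym_shift_le[OF assms(1) i(1) j(1) ij] .
    ultimately show ?thesis by simp
  qed
qed

section \<open>Turan numbers: maximality and increments\<close>

lemma balanced_partition_finite:
  assumes "balanced_partition n l V" "i \<in> {1..l}"
  shows "finite (V i)"
  using assms unfolding balanced_partition_def
  by (metis UN_upper finite_atLeastAtMost finite_subset)

lemma turan_number_esym:
  assumes "l \<ge> 1"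
  shows "turan_number r n l = esym {1..l} (\<lambda>i. card (residue_part n l i)) r"
proof -
  note b = balanced_residue_part[OF assms, of n]
  have "turan_rgraph r n l = transversals {1..l} (residue_part n l) r"
    using b unfolding turan_rgraph_def partite_rgraph_def transversals_def rsets_def
      balanced_partition_def by auto
  moreover have "disjoint_family_on (residue_part n l) {1..l}"
    using b by (simp add: balanced_partition_def)
  ultimately show ?thesis
    using card_transversals[OF finite_atLeastAtMost _ balanced_partition_finite[OF b]]
    by (simp add: turan_number_def)
qed

lemma balanced_partition_card_diff:
  assumes "balanced_partition n l V" "i \<in> {1..l}" "j \<in> {1..l}"
  shows "card (V i) \<le> card (V j) + 1"
proof -
  have "card (V i) \<le> card (V 1)" "card (V l) \<le> card (V j)"
    using assms balanced_partition_card_antimono[OF assms(1)] by auto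
  then show ?thesis using assms(1) by (simp add: balanced_partition_def)
qed

text \<open>The parts found in the upper bound are only roughly balanced; this turns their
  transversals into the Turan number without loss.\<close>

lemma card_transversals_le_turan_number:
  assumes "l \<ge> 1" "disjoint_family_on V {1..l}" "\<And>i. i \<in> {1..l} \<Longrightarrow> finite (V i)"
  shows "card (transversals {1..l} V r) \<le> turan_number r (card (\<Union>i\<in>{1..l}. V i)) l"
proof -
  let ?n = "card (\<Union>i\<in>{1..l}. V i)"
  note b = balanced_residue_part[OF assms(1), of ?n]
  have "card (\<Union>i\<in>{1..l}. V i) = (\<Sum>i\<in>{1..l}. card (V i))"
    using assms(2,3) unfolding disjoint_family_on_def by (intro card_UN_disjoint) auto
  then have "esym {1..l} (\<lambda>i. card (V i)) r \<le> esym {1..l} (\<lambda>i. card (residue_part ?n l i)) r"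
    using balanced_partition_card_diff[OF b] balanced_partition_card_sum[OF b]
    by (intro esym_le_balanced) auto
  moreover have "card (transversals {1..l} V r) = esym {1..l} (\<lambda>i. card (V i)) r"
    using assms by (intro card_transversals) auto
  ultimately show ?thesis by (simp add: turan_number_esym[OF assms(1)])
qed

text \<open>The new vertex joins one part \<open>i0\<close>; the edges through it are the
  transversal \<open>k\<close>-sets of the other \<open>l - 1\<close> parts, each of size at least
  \<open>n div l\<close>. This increment is the degree threshold below which a vertex is deleted
  later.\<close>

lemma turan_number_Suc:
  assumes "l \<ge> 1"
  shows "turan_number (Suc k) n l + (l - 1 choose k) * (n div l) ^ k \<le>
      turan_number (Suc k) (Suc n) l"
proof -
  note b = balanced_residue_part[OF assms, of n]
  let ?x = "\<lambda>i. card (residue_part n l i)"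
  obtain i0 where i0: "i0 \<in> {1..l}" "Suc n \<in> residue_part (Suc n) l i0"
    using balanced_residue_part[OF assms, of "Suc n"] unfolding balanced_partition_def
    by (metis UN_E atLeastAtMost_iff le_add1 order_refl plus_1_eq_Suc)
  define J where "J = {1..l} - {i0}"
  have I: "{1..l} = insert i0 J" and J: "finite J" "i0 \<notin> J" "card J = l - 1"
    using i0 by (auto simp: J_def)
  let ?y = "\<lambda>i. card (residue_part (Suc n) l i)"
  have fin: "finite (residue_part n l i)" for i n by (simp add: residue_part_def)
  have "residue_part n l i \<subseteq> residue_part (Suc n) l i" for i by (auto simp: residue_part_def)
  then have mono: "?x i \<le> ?y i" for i using fin by (simp add: card_mono)
  have "residue_part (Suc n) l i0 = insert (Suc n) (residue_part n l i0)"
    using i0 by (auto simp: residue_part_def)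
  moreover have "Suc n \<notin> residue_part n l i0" by (simp add: residue_part_def)
  ultimately have y0: "?y i0 = Suc (?x i0)" using fin by simp
  have div: "n div l \<le> ?x i" if "i \<in> {1..l}" for i
  proof (rule ccontr)
    assume neg: "\<not> n div l \<le> ?x i"
    have "?x j \<le> n div l" if "j \<in> {1..l}" for j
      using balanced_partition_card_diff[OF b that \<open>i \<in> {1..l}\<close>] neg by simp
    then have "(\<Sum>j\<in>{1..l}. ?x j) < (\<Sum>j\<in>{1..l}. n div l)"
      using that neg by (intro sum_strict_mono_ex1) (auto intro!: bexI[of _ i])
    also have "\<dots> \<le> n" by simp
    finally show False using balanced_partition_card_sum[OF b] by simp
  qed
  have "(l - 1 choose k) * (n div l) ^ k = esym J (\<lambda>_. n div l) k"
    using J by (simp add: esym_const)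
  also have "\<dots> \<le> esym J ?x k" by (rule esym_mono) (use div J_def in auto)
  also have "\<dots> \<le> esym J ?y k" by (rule esym_mono) (use mono in auto)
  finally have 1: "(l - 1 choose k) * (n div l) ^ k \<le> esym J ?y k" .
  have "esym {1..l} ?x (Suc k) = esym J ?x (Suc k) + ?x i0 * esym J ?x k"
    unfolding I using J by (simp add: esym_insert)
  also have "\<dots> \<le> esym J ?y (Suc k) + ?x i0 * esym J ?y k"
    using mono by (intro add_mono mult_left_mono esym_mono) auto
  finally have "esym {1..l} ?x (Suc k) \<le> \<dots>" .
  moreover have "esym {1..l} ?y (Suc k) = esym J ?y (Suc k) + ?x i0 * esym J ?y k + esym J ?y k"
    unfolding I using J by (simp add: esym_insert y0)
  ultimately show ?thesis using 1 by (simp add: turan_number_esym[OF assms])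
qed

section \<open>Clique supersaturation and blow-ups\<close>

definition cliques :: "('a \<Rightarrow> 'a \<Rightarrow> bool) \<Rightarrow> 'a set \<Rightarrow> nat \<Rightarrow> 'a set set" where
  "cliques E D k = {S \<in> rsets k D. \<forall>x\<in>S. \<forall>y\<in>S. x \<noteq> y \<longrightarrow> E x y}"

definition common_nbrs :: "('a \<Rightarrow> 'a \<Rightarrow> bool) \<Rightarrow> 'a set \<Rightarrow> 'a set \<Rightarrow> 'a set" where
  "common_nbrs E D S = {v \<in> D. \<forall>x\<in>S. E v x}"

lemma finite_cliques [simp]: "finite D \<Longrightarrow> finite (cliques E D k)"
  by (simp add: cliques_def)

lemma finite_common_nbrs [simp]: "finite D \<Longrightarrow> finite (common_nbrs E D S)"
  by (simp add: common_nbrs_def)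

lemma cliquesD:
  assumes "finite D" "S \<in> cliques E D k"
  shows "S \<subseteq> D" "finite S" "card S = k"
  using assms by (auto simp: cliques_def rsets_def dest: finite_subset)

text \<open>Weighted double counting of pairs of a \<open>(k + 1)\<close>-clique and a vertex in it:
  removing the vertex leaves a \<open>k\<close>-clique of which it is a common neighbour.\<close>

lemma sum_cliques_Suc:
  assumes "finite D" "symp E" "irreflp E"
  shows "(\<Sum>Z\<in>cliques E D k. \<Sum>v\<in>common_nbrs E D Z. g Z v) =
         (\<Sum>S\<in>cliques E D (Suc k). \<Sum>v\<in>S. g (S - {v}) v)"
proof -
  note D = cliquesD[OF assms(1)]
  have notin: "v \<notin> Z" if "v \<in> common_nbrs E D Z" for v Z
    using that assms(3) by (auto simp: common_nbrs_def irreflp_def)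
  have "(\<Sum>Z\<in>cliques E D k. \<Sum>v\<in>common_nbrs E D Z. g Z v) =
        (\<Sum>(Z, v)\<in>Sigma (cliques E D k) (common_nbrs E D). g Z v)"
    using assms(1) by (subst sum.Sigma) auto
  also have "\<dots> = (\<Sum>(S, v)\<in>Sigma (cliques E D (Suc k)) (\<lambda>S. S). g (S - {v}) v)"
  proof (rule sum.reindex_bij_witness[where i = "\<lambda>(S, v). (S - {v}, v)"
      and j = "\<lambda>(Z, v). (insert v Z, v)"])
    fix a assume a: "a \<in> Sigma (cliques E D k) (common_nbrs E D)"
    obtain Z v where Z: "a = (Z, v)" "Z \<in> cliques E D k" "v \<in> common_nbrs E D Z" using a by auto
    note n = notin[OF Z(3)]
    show "(case case a of (Z, v) \<Rightarrow> (insert v Z, v) of (S, v) \<Rightarrow> (S - {v}, v)) = a"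
      using Z n by simp
    have "insert v Z \<in> cliques E D (Suc k)"
      using Z n D[OF Z(2)] assms(2) by (auto simp: cliques_def rsets_def common_nbrs_def symp_def)
    then show "(case a of (Z, v) \<Rightarrow> (insert v Z, v)) \<in> Sigma (cliques E D (Suc k)) (\<lambda>S. S)"
      using Z by simp
    show "(case case a of (Z, v) \<Rightarrow> (insert v Z, v) of (S, v) \<Rightarrow> g (S - {v}) v) =
        (case a of (Z, v) \<Rightarrow> g Z v)"
      using Z n by simp
  next
    fix b assume b: "b \<in> Sigma (cliques E D (Suc k)) (\<lambda>S. S)"
    obtain S v where S: "b = (S, v)" "S \<in> cliques E D (Suc k)" "v \<in> S" using b by auto
    show "(case case b of (S, v) \<Rightarrow> (S - {v}, v) of (Z, v) \<Rightarrow> (insert v Z, v)) = b"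
      using S by auto
    have "S - {v} \<in> cliques E D k" "v \<in> common_nbrs E D (S - {v})"
      using S D[OF S(2)] by (auto simp: cliques_def rsets_def common_nbrs_def)
    then show "(case b of (S, v) \<Rightarrow> (S - {v}, v)) \<in> Sigma (cliques E D k) (common_nbrs E D)"
      using S by simp
  qed
  also have "\<dots> = (\<Sum>S\<in>cliques E D (Suc k). \<Sum>v\<in>S. g (S - {v}) v)"
    using assms(1) D by (subst sum.Sigma) auto
  finally show ?thesis .
qed

lemma sum_card_common_nbrs:
  assumes "finite D" "symp E" "irreflp E"
  shows "(\<Sum>Z\<in>cliques E D k. card (common_nbrs E D Z)) = Suc k * card (cliques E D (Suc k))"
proof -
  have "(\<Sum>Z\<in>cliques E D k. card (common_nbrs E D Z)) = (\<Sum>S\<in>cliques E D (Suc k). card S)"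
    using sum_cliques_Suc[OF assms, of "\<lambda>_ _. 1::nat" k] by simp
  also have "\<dots> = (\<Sum>S\<in>cliques E D (Suc k). Suc k)"
    using cliquesD(3)[OF assms(1)] by (intro sum.cong) auto
  finally show ?thesis by simp
qed

lemma square_sum_le_card_mult_sum_squares:
  fixes f :: "'a \<Rightarrow> real"
  assumes "finite I"
  shows "(\<Sum>i\<in>I. f i)\<^sup>2 \<le> real (card I) * (\<Sum>i\<in>I. (f i)\<^sup>2)"
proof -
  have "0 \<le> (\<Sum>i\<in>I. \<Sum>j\<in>I. (f i - f j)\<^sup>2)" by (intro sum_nonneg) auto
  also have "\<dots> = (\<Sum>i\<in>I. \<Sum>j\<in>I. (f i)\<^sup>2 + (f j)\<^sup>2 - 2 * (f i * f j))"
    by (simp add: power2_diff algebra_simps)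
  also have "\<dots> = 2 * (real (card I) * (\<Sum>i\<in>I. (f i)\<^sup>2)) - 2 * (\<Sum>i\<in>I. f i)\<^sup>2"
    by (simp only: sum.distrib sum_subtractf sum_distrib_left[symmetric]
        sum_distrib_right[symmetric]
        power2_eq_square sum_constant) (simp add: sum_distrib_left algebra_simps)
  finally show ?thesis by simp
qed

text \<open>A vertex adjacent to all of \<open>S\<close> is counted \<open>card S\<close> times on the left,
  any other vertex at most once.\<close>

lemma sum_card_common_nbrs_remove:
  assumes "finite D" "finite S" "S \<noteq> {}"
  shows "(\<Sum>v\<in>S. card (common_nbrs E D (S - {v}))) \<le>
         card D + (card S - 1) * card (common_nbrs E D S)"
proof -
  have "(\<Sum>v\<in>S. card (common_nbrs E D (S - {v}))) =
        (\<Sum>v\<in>S. \<Sum>y\<in>D. if y \<in> common_nbrs E D (S - {v}) then 1 else 0)"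
  proof (rule sum.cong[OF refl])
    fix v
    have "D \<inter> {y. y \<in> common_nbrs E D (S - {v})} = common_nbrs E D (S - {v})"
      by (auto simp: common_nbrs_def)
    then show "card (common_nbrs E D (S - {v})) =
        (\<Sum>y\<in>D. if y \<in> common_nbrs E D (S - {v}) then 1 else 0)"
      using assms(1) by (simp add: sum.If_cases)
  qed
  also have "\<dots> = (\<Sum>y\<in>D. \<Sum>v\<in>S. if y \<in> common_nbrs E D (S - {v}) then 1 else 0)"
    by (rule sum.swap)
  also have "\<dots> \<le> (\<Sum>y\<in>D. 1 + (card S - 1) * (if y \<in> common_nbrs E D S then 1 else 0))"
  proof (rule sum_mono)
    fix y assume y: "y \<in> D"
    have eq: "(\<Sum>v\<in>S. if y \<in> common_nbrs E D (S - {v}) then 1 else 0) =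
        card {v\<in>S. y \<in> common_nbrs E D (S - {v})}"
      using assms(2) by (simp add: sum.If_cases Int_def)
    show "(\<Sum>v\<in>S. if y \<in> common_nbrs E D (S - {v}) then 1 else 0) \<le>
        1 + (card S - 1) * (if y \<in> common_nbrs E D S then 1 else 0)"
    proof (cases "y \<in> common_nbrs E D S")
      case True
      have "card {v\<in>S. y \<in> common_nbrs E D (S - {v})} \<le> card S"
        using assms(2) by (intro card_mono) auto
      then show ?thesis using True assms eq by (simp add: card_gt_0_iff)
    next
      case False
      then obtain x where "x \<in> S" "\<not> E y x" using y by (auto simp: common_nbrs_def)
      then have "{v\<in>S. y \<in> common_nbrs E D (S - {v})} \<subseteq> {x}" by (auto simp: common_nbrs_def)
      then have "card {v\<in>S. y \<in> common_nbrs E D (S - {v})} \<le> 1"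
        using card_mono[of "{x}"] by simp
      then show ?thesis using False eq by simp
    qed
  qed
  also have "\<dots> = card D + (card S - 1) * (\<Sum>y\<in>D. if y \<in> common_nbrs E D S then 1 else 0)"
    unfolding sum.distrib sum_distrib_left[symmetric] by simp
  also have "(\<Sum>y\<in>D. if y \<in> common_nbrs E D S then 1 else 0) = card (common_nbrs E D S)"
  proof -
    have "D \<inter> {y. y \<in> common_nbrs E D S} = common_nbrs E D S" by (auto simp: common_nbrs_def)
    then show ?thesis using assms(1) by (simp add: sum.If_cases)
  qed
  finally show ?thesis .
qed

text \<open>Cauchy--Schwarz for the numbers of common neighbours of the \<open>k\<close>-cliques.
  Their squares are summed over \<open>(k + 1)\<close>-cliques instead, where
  \<open>sum_card_common_nbrs_remove\<close> applies. A real bound \<open>y\<close> stands in for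
  \<open>card D\<close> because it will be a fraction of the number of vertices.\<close>

lemma moon_moser:
  assumes "finite D" "symp E" "irreflp E" "real (card D) \<le> y"
  defines "c \<equiv> \<lambda>k. real (card (cliques E D k))"
  shows "(real (Suc k) * c (Suc k))\<^sup>2 \<le> c k * (y * c (Suc k) +
      real k * real (Suc (Suc k)) * c (Suc (Suc k)))"
proof -
  let ?d = "\<lambda>Z. real (card (common_nbrs E D Z))"
  have 1: "(\<Sum>Z\<in>cliques E D k. ?d Z) = real (Suc k) * c (Suc k)" for k
    unfolding c_def by (metis sum_card_common_nbrs[OF assms(1-3)] of_nat_sum of_nat_mult)
  have "(\<Sum>Z\<in>cliques E D k. (?d Z)\<^sup>2) =
      (\<Sum>Z\<in>cliques E D k. \<Sum>v\<in>common_nbrs E D Z. ?d Z)"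
    by (simp add: power2_eq_square)
  also have "\<dots> = (\<Sum>S\<in>cliques E D (Suc k). \<Sum>v\<in>S. ?d (S - {v}))"
    by (rule sum_cliques_Suc[OF assms(1-3)])
  also have "\<dots> \<le> (\<Sum>S\<in>cliques E D (Suc k). y + real k * ?d S)"
  proof (rule sum_mono)
    fix S assume "S \<in> cliques E D (Suc k)"
    then have S: "finite S" "card S = Suc k" using cliquesD[OF assms(1)] by auto
    then have "real (\<Sum>v\<in>S. card (common_nbrs E D (S - {v}))) \<le>
         real (card D + (card S - 1) * card (common_nbrs E D S))"
      using sum_card_common_nbrs_remove[OF assms(1) S(1)]
          by (metis card.empty nat.distinct(1) of_nat_le_iff)
    then show "(\<Sum>v\<in>S. ?d (S - {v})) \<le> y + real k * ?d S"
      using assms(4) S by simp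
  qed
  also have "\<dots> = y * c (Suc k) + real k * (real (Suc (Suc k)) * c (Suc (Suc k)))"
    by (simp only: sum.distrib sum_distrib_left[symmetric] 1) (simp add: c_def)
  finally have 2: "(\<Sum>Z\<in>cliques E D k. (?d Z)\<^sup>2) \<le> \<dots>" .
  have "(real (Suc k) * c (Suc k))\<^sup>2 \<le> c k * (\<Sum>Z\<in>cliques E D k. (?d Z)\<^sup>2)"
    using square_sum_le_card_mult_sum_squares[OF finite_cliques[OF assms(1)], of ?d E k]
    unfolding 1 c_def .
  also have "\<dots> \<le> c k * (y * c (Suc k) + real k * (real (Suc (Suc k)) * c (Suc (Suc k))))"
    using 2 by (intro mult_left_mono) (auto simp: c_def)
  finally show ?thesis by (simp add: mult.assoc)
qed

text \<open>For \<open>\<beta> = 1 / p\<close> this is the number of ordered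
  \<open>m\<close>-cliques, divided by the \<open>m\<close>-th power of the order, in the complete
  \<open>p\<close>-partite graph with equal parts: each chosen vertex excludes a proportion
  \<open>\<beta>\<close>.\<close>

definition turan_density_prod :: "real \<Rightarrow> nat \<Rightarrow> real" where
  "turan_density_prod \<beta> m = (\<Prod>i<m. 1 - real i * \<beta>)"

text \<open>By Moon--Moser, if one ratio of consecutive clique counts is at least that of the
  multipartite model with density \<open>\<beta>\<close>, so is the next. If all ratios below
  \<open>s\<close> fell short, the count of \<open>s\<close>-cliques would contradict
  \<open>large\<close>; hence some ratio starts the chain, and multiplying the ratios from
  \<open>s\<close> to \<open>k\<close> gives the claim.\<close>

lemma clique_supersaturation:
  fixes y \<beta> :: real
  assumes D: "finite D" "symp E" "irreflp E" "real (card D) \<le> y" and y: "y > 0"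
    and \<beta>: "0 \<le> \<beta>" "real k * \<beta> < 1" and s: "1 \<le> s" "s \<le> k"
    and large: "fact s * real (card (cliques E D s)) > turan_density_prod \<beta> s * y ^ s"
  shows "fact (Suc k) * real (card (cliques E D (Suc k))) \<ge> turan_density_prod \<beta> (Suc k) * y ^ Suc
      k"
proof -
  \<comment> \<open>Counting ordered cliques makes the ratio of the model equal to
    \<open>(1 - real m * \<beta>) * y\<close>.\<close>
  define N where "N k = fact k * real (card (cliques E D k))" for k
  have N0: "N 0 = 1"
  proof -
    have "cliques E D 0 = {{}}" using D(1) by (auto simp: cliques_def rsets_0)
    then show ?thesis by (simp add: N_def)
  qed
  have nn: "N k \<ge> 0" for k by (simp add: N_def)
  have fac: "1 - real i * \<beta> > 0" if "i \<le> k" for i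
    using \<beta> that mult_right_mono[of "real i" "real k" \<beta>] by auto
  have up: "N (Suc m) \<le> y * N m" for m
  proof -
    have "real (Suc m * card (cliques E D (Suc m))) = (\<Sum>Z\<in>cliques E D m. real (card (common_nbrs E D
        Z)))"
      using sum_card_common_nbrs[OF D(1-3), of m] by (metis of_nat_sum)
    also have "\<dots> \<le> (\<Sum>Z\<in>cliques E D m. y)"
    proof (rule sum_mono)
      fix Z
      have "card (common_nbrs E D Z) \<le> card D" using D(1)
          by (intro card_mono) (auto simp: common_nbrs_def)
      then show "real (card (common_nbrs E D Z)) \<le> y" using D(4) by linarith
    qed
    finally have "real (Suc m) * real (card (cliques E D (Suc m))) \<le>
        y * real (card (cliques E D m))"
      by (simp only: of_nat_mult sum_constant mult.commute)
    then have "fact m * (real (Suc m) * real (card (cliques E D (Suc m)))) \<le>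
        fact m * (y * real (card (cliques E D m)))"
      by (rule mult_left_mono) simp
    moreover have "N (Suc m) = fact m * (real (Suc m) * real (card (cliques E D (Suc m))))"
      by (simp add: N_def algebra_simps)
    moreover have "y * N m = fact m * (y * real (card (cliques E D m)))" by (simp add: N_def)
    ultimately show ?thesis by linarith
  qed
  have MM: "real (Suc m) * (N (Suc m))\<^sup>2 \<le> N m * (y * N (Suc m) + real m * N (Suc (Suc m)))" for m
  proof -
    let ?c = "\<lambda>k. real (card (cliques E D k))"
    have "(fact m * fact m * real (Suc m)) * (real (Suc m) * ?c (Suc m))\<^sup>2 \<le>
        (fact m * fact m * real (Suc m)) *
        (?c m * (y * ?c (Suc m) + real m * real (Suc (Suc m)) * ?c (Suc (Suc m))))"
      by (intro mult_left_mono moon_moser D) auto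
    then show ?thesis by (simp add: N_def power2_eq_square algebra_simps)
  qed
  have ratio_step: "N (Suc (Suc m)) \<ge> (1 - real (Suc m) * \<beta>) * y * N (Suc m)"
    if m: "1 \<le> m" "m \<le> k" "N (Suc m) > 0" "N (Suc m) \<ge> (1 - real m * \<beta>) * y * N m" for m
  proof -
    have "(1 - real m * \<beta>) * y * (real (Suc m) * (N (Suc m))\<^sup>2) \<le>
        (1 - real m * \<beta>) * y * (N m * (y * N (Suc m) + real m * N (Suc (Suc m))))"
      using MM[of m] y fac[OF m(2)] by (intro mult_left_mono) auto
    also have "\<dots> = ((1 - real m * \<beta>) * y * N m) * (y * N (Suc m) + real m * N (Suc (Suc m)))"
      by simp
    also have "\<dots> \<le> N (Suc m) * (y * N (Suc m) + real m * N (Suc (Suc m)))"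
      using m nn y by (intro mult_right_mono add_nonneg_nonneg mult_nonneg_nonneg) auto
    finally have "N (Suc m) * ((1 - real m * \<beta>) * y * real (Suc m) * N (Suc m)) \<le>
        N (Suc m) * (y * N (Suc m) + real m * N (Suc (Suc m)))"
      by (simp add: power2_eq_square algebra_simps)
    then have "(1 - real m * \<beta>) * y * real (Suc m) * N (Suc m) \<le> y * N (Suc m) +
        real m * N (Suc (Suc m))"
      using m(3) by (simp only: mult_le_cancel_left_pos)
    then have "real m * ((1 - real (Suc m) * \<beta>) * y * N (Suc m)) \<le> real m * N (Suc (Suc m))"
      by (simp add: algebra_simps)
    then show ?thesis using m(1) by (subst (asm) mult_le_cancel_left_pos) auto
  qed
  let ?P = "turan_density_prod \<beta>"
  have Ppos: "?P m > 0" if "m \<le> Suc k" for m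
    unfolding turan_density_prod_def using that by (intro prod_pos ballI fac) auto
  have PSuc: "?P (Suc m) = ?P m * (1 - real m * \<beta>)" for m
    by (simp add: turan_density_prod_def)
  have Npos: "N m > 0" if "m \<le> s" for m
    using that
  proof (induction m rule: inc_induct)
    case base
    have "0 < ?P s * y ^ s" using Ppos[of s] s y by simp
    then show ?case using large unfolding N_def by linarith
  next
    case (step m)
    then show ?case using up[of m] y nn[of m] by (cases "N m = 0") auto
  qed
  \<comment> \<open>A first good ratio exists, as otherwise the product of the deficient ratios
    bounds \<open>N s\<close> by the model. The ratio at \<open>0\<close> is at most
    \<open>y\<close> in any case, so the search starts at \<open>1\<close>.\<close>
  have "\<exists>m. 1 \<le> m \<and> m < s \<and> N (Suc m) \<ge> (1 - real m * \<beta>) * y * N m"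
  proof (rule ccontr)
    assume "\<not> ?thesis"
    then have less: "N (Suc m) \<le> (1 - real m * \<beta>) * y * N m" if "1 \<le> m" "m < s" for m
      using that by force
    have "N (Suc m) \<le> ?P (Suc m) * y ^ Suc m" if "m < s" for m
      using that
    proof (induction m)
      case 0
      then show ?case using up[of 0] N0 by (simp add: turan_density_prod_def)
    next
      case (Suc m)
      have "N (Suc (Suc m)) \<le> (1 - real (Suc m) * \<beta>) * y * N (Suc m)" using less[of "Suc m"] Suc
          by simp
      also have "\<dots> \<le> (1 - real (Suc m) * \<beta>) * y * (?P (Suc m) * y ^ Suc m)"
        using Suc y fac[of "Suc m"] s by (intro mult_left_mono mult_nonneg_nonneg) auto
      finally show ?case by (simp only: PSuc[of "Suc m"] power_Suc mult_ac)
    qed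
    from this[of "s - 1"] show False using large s unfolding N_def by simp
  qed
  then obtain j where j: "1 \<le> j" "j < s" "N (Suc j) \<ge> (1 - real j * \<beta>) * y * N j" by blast
  have chain: "N (Suc m) > 0 \<and> N (Suc m) \<ge> (1 - real m * \<beta>) * y * N m" if "j \<le> m" "m \<le> k" for m
    using that
  proof (induction m rule: dec_induct)
    case base
    then show ?case using j Npos[of "Suc j"] by simp
  next
    case (step m)
    then have m: "N (Suc m) > 0" "N (Suc m) \<ge> (1 - real m * \<beta>) * y * N m" by auto
    have 1: "N (Suc (Suc m)) \<ge> (1 - real (Suc m) * \<beta>) * y * N (Suc m)"
      using ratio_step[of m] m step j by auto
    moreover have "(1 - real (Suc m) * \<beta>) * y * N (Suc m) > 0"
      using fac[of "Suc m"] step y m by simp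
    ultimately show ?case by linarith
  qed
  have "N m \<ge> ?P m * y ^ m" if "s \<le> m" "m \<le> Suc k" for m
    using that
  proof (induction m rule: dec_induct)
    case base
    then show ?case using large by (simp add: N_def)
  next
    case (step m)
    have "?P (Suc m) * y ^ Suc m = (1 - real m * \<beta>) * y * (?P m * y ^ m)"
      by (simp only: PSuc power_Suc mult_ac)
    also have "\<dots> \<le> (1 - real m * \<beta>) * y * N m"
      using step y fac[of m] by (intro mult_left_mono mult_nonneg_nonneg) auto
    also have "\<dots> \<le> N (Suc m)" using chain[of m] step j by auto
    finally show ?case .
  qed
  from this[of "Suc k"] show ?thesis using s by (simp add: N_def)
qed

section \<open>Boxes in dense sets of tuples (the Erdos theorem on \<open>k\<close>-partite
  \<open>k\<close>-graphs)\<close>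

definition blowup_at :: "nat \<Rightarrow> nat \<Rightarrow> real \<Rightarrow> nat \<Rightarrow> bool" where
  "blowup_at k T c n \<longleftrightarrow> (\<forall>(W :: nat set) R. finite W \<and> card W = n \<and>
     R \<subseteq> {xs. set xs \<subseteq> W \<and> length xs = k} \<and> c * real n ^ k \<le> real (card R) \<longrightarrow>
     (\<exists>A. (\<forall>i<k. A i \<subseteq> W \<and> card (A i) = T) \<and>
        (\<forall>xs. length xs = k \<and> (\<forall>i<k. xs ! i \<in> A i) \<longrightarrow> xs \<in> R)))"

lemma blowup_atD:
  fixes W :: "nat set"
  assumes "blowup_at k T c n" "finite W" "card W = n"
    "R \<subseteq> {xs. set xs \<subseteq> W \<and> length xs = k}" "c * real n ^ k \<le> real (card R)"
  obtains A where "\<And>i. i < k \<Longrightarrow> A i \<subseteq> W \<and> card (A i) = T"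
    "\<And>xs. length xs = k \<Longrightarrow> (\<And>i. i < k \<Longrightarrow> xs ! i \<in> A i) \<Longrightarrow> xs \<in> R"
proof -
  have "\<exists>A. (\<forall>i<k. A i \<subseteq> W \<and> card (A i) = T) \<and>
        (\<forall>xs. length xs = k \<and> (\<forall>i<k. xs ! i \<in> A i) \<longrightarrow> xs \<in> R)"
    using assms(1)[unfolded blowup_at_def, THEN spec, of W, THEN spec, of R] assms(2-5) by blast
  then show ?thesis using that by blast
qed

text \<open>Induction on \<open>k\<close>: fix a bounded set \<open>Y\<close> of heads with many
  extensions; many tails extend at least \<open>T\<close> of these heads, and by pigeonhole many of
  those have the same set \<open>S\<close> of heads in \<open>Y\<close>. The induction hypothesis
  applies to these tails, and the first side of the box is taken inside \<open>S\<close>. Lists with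
  possible repetitions allow the first coordinate to be split off.\<close>

lemma eventually_blowup_at:
  assumes "c > 0"
  shows "\<forall>\<^sub>F n in sequentially. blowup_at k T c n"
  using assms
proof (induction k arbitrary: c)
  case 0
  have "[] \<in> R" if "R \<subseteq> {xs :: nat list. set xs \<subseteq> W \<and> length xs = 0}"
      "c * real n ^ 0 \<le> real (card R)"
    for R n W
  proof (cases "R = {}")
    case True
    then show ?thesis using that(2) 0 by simp
  next
    case False
    then show ?thesis using that(1) by auto
  qed
  then have "blowup_at 0 T c n" for n unfolding blowup_at_def by auto
  then show ?case by simp
next
  case (Suc k)
  \<comment> \<open>An average tail extends at least \<open>c * K / 2\<close> of the
    \<open>K\<close> heads, which is at least \<open>2 * T\<close>; this leaves a proportion
    \<open>c / 4\<close> of tails with \<open>T\<close> of them. The factor \<open>2 ^ K\<close> in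
    \<open>c'\<close> counts the possible sets of heads.\<close>
  define K where "K = nat \<lceil>4 * real T / c\<rceil>"
  have KT: "real T \<le> c * real K / 4"
  proof -
    have "4 * real T / c \<le> real K" unfolding K_def by linarith
    then show ?thesis using Suc.prems by (simp add: field_simps)
  qed
  define c' where "c' = c / 4 / 2 ^ K"
  have c': "c' > 0" using Suc.prems by (simp add: c'_def)
  have ev: "\<forall>\<^sub>F n in sequentially. real n \<ge> 2 * real K / c + 1" 
    using filterlim_real_sequentially by (simp add: filterlim_at_top)
  show ?case
    using Suc.IH[OF c'] ev
  proof eventually_elim
    case (elim n)
    have n: "n > 0" "c / 2 * real n \<ge> real K"
    proof -
      have "2 * real K / c \<ge> 0" using Suc.prems by simp
      then show "n > 0" using elim(2) by (cases n) auto
      have "2 * real K / c \<le> real n" using elim(2) by linarith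
      then show "c / 2 * real n \<ge> real K" using Suc.prems by (simp add: field_simps)
    qed
    show ?case
      unfolding blowup_at_def
    proof (intro allI impI, elim conjE)
      fix W :: "nat set" and R
      assume W: "finite W" "card W = n" and R: "R \<subseteq> {xs. set xs \<subseteq> W \<and> length xs = Suc k}"
        and big: "c * real n ^ Suc k \<le> real (card R)"
      define L where "L = {xs. set xs \<subseteq> W \<and> length xs = k}"
      have L: "finite L" "card L = n ^ k"
        using W finite_lists_length_eq[OF W(1)] card_lists_length_eq[OF W(1)] by (auto simp: L_def)
      define d where "d x = card {xs \<in> L. x # xs \<in> R}" for x
      have dle: "real (d x) \<le> real n ^ k" for x
        using card_mono[OF L(1), of "{xs \<in> L. x # xs \<in> R}"] L(2)
        by (simp add: d_def flip: of_nat_power)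
      define Hi where "Hi = {x \<in> W. real (d x) \<ge> c / 2 * real n ^ k}"
      have Hi: "Hi \<subseteq> W" "finite Hi" using W by (auto simp: Hi_def)
      have "R \<subseteq> (\<lambda>(x, xs). x # xs) ` Sigma W (\<lambda>x. {xs \<in> L. x # xs \<in> R})" (is "_ \<subseteq> ?R")
      proof
          fix xs assume xs: "xs \<in> R"
          then obtain y ys where "xs = y # ys" using R by (cases xs) auto
          then show "xs \<in> ?R" using xs R by (force simp: L_def)
      qed
      moreover have "finite (Sigma W (\<lambda>x. {xs \<in> L. x # xs \<in> R}))" using W L by auto
      ultimately have "card R \<le> card (Sigma W (\<lambda>x. {xs \<in> L. x # xs \<in> R}))"
        by (rule surj_card_le[rotated])
      also have "\<dots> = (\<Sum>x\<in>W. d x)" using W L by (simp add: d_def)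
      finally have "real (card R) \<le> (\<Sum>x\<in>W. real (d x))"
          by (simp only: of_nat_le_iff flip: of_nat_sum)
      also have "\<dots> \<le> (\<Sum>x\<in>W. (if x \<in> Hi then real n ^ k else 0) + c / 2 * real n ^ k)"
        using dle Suc.prems
            by (intro sum_mono) (auto simp: Hi_def intro: add_increasing2 less_imp_le)
      also have "\<dots> = real (card Hi) * real n ^ k + c / 2 * real n ^ Suc k"
        using W Hi by (simp add: sum.distrib sum.If_cases Int_absorb1)
      finally have "c / 2 * real n * real n ^ k \<le> real (card Hi) * real n ^ k"
        using big by (simp add: algebra_simps)
      then have "c / 2 * real n \<le> real (card Hi)" using n by (simp add: mult_le_cancel_right)
      then have "K \<le> card Hi" using n by linarith
      then obtain Y where Y: "Y \<subseteq> Hi" "card Y = K" by (metis obtain_subset_with_card_n)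
      have fY: "finite Y" "Y \<subseteq> W" using Y Hi finite_subset by auto
      define M where "M xs = {x \<in> Y. x # xs \<in> R}" for xs
      have M: "card (M xs) \<le> K" "M xs \<subseteq> Y" for xs
        using card_mono[OF fY(1), of "M xs"] Y by (auto simp: M_def)
      define Gd where "Gd = {xs \<in> L. T \<le> card (M xs)}"
      have fG: "finite Gd" using L by (simp add: Gd_def)
      have "(\<Sum>xs\<in>L. card (M xs)) = (\<Sum>xs\<in>L. \<Sum>x\<in>Y. if x # xs \<in> R then 1 else 0)"
        using fY by (simp add: M_def sum.If_cases Int_def)
      also have "\<dots> = (\<Sum>x\<in>Y. \<Sum>xs\<in>L. if x # xs \<in> R then 1 else 0)" by (rule sum.swap)
      also have "\<dots> = (\<Sum>x\<in>Y. d x)"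
        using L by (simp add: d_def sum.If_cases Int_def)
      finally have "real (\<Sum>xs\<in>L. card (M xs)) = (\<Sum>x\<in>Y. real (d x))" by simp
      also have "\<dots> \<ge> (\<Sum>x\<in>Y. c / 2 * real n ^ k)"
        using Y by (intro sum_mono) (auto simp: Hi_def)
      finally have low: "real K * (c / 2 * real n ^ k) \<le> real (\<Sum>xs\<in>L. card (M xs))" using Y by simp
      have "(\<Sum>xs\<in>L. card (M xs)) \<le> (\<Sum>xs\<in>L. (if xs \<in> Gd then K else 0) + T)"
        using M by (intro sum_mono) (auto simp: Gd_def intro: le_add1 trans_le_add1)
      also have "\<dots> = card Gd * K + n ^ k * T"
      proof -
        have "L \<inter> Gd = Gd" by (auto simp: Gd_def)
        then show ?thesis using L by (simp add: sum.distrib sum.If_cases)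
      qed
      finally have "real (\<Sum>xs\<in>L. card (M xs)) \<le> real (card Gd) * real K + real n ^ k * real T"
        by (metis of_nat_le_iff of_nat_add of_nat_mult of_nat_power)
      also have "\<dots> \<le> real (card Gd) * real K + real n ^ k * (c * real K / 4)"
        using KT by (intro add_left_mono mult_left_mono) auto
      finally have up: "real (\<Sum>xs\<in>L. card (M xs)) \<le> \<dots>" .
      show "\<exists>A. (\<forall>i<Suc k. A i \<subseteq> W \<and> card (A i) = T) \<and>
        (\<forall>xs. length xs = Suc k \<and> (\<forall>i<Suc k. xs ! i \<in> A i) \<longrightarrow> xs \<in> R)"
      proof (cases "T = 0")
        case True
        then show ?thesis by (intro exI[of _ "\<lambda>_. {}"]) auto
      next
        case False
        then have K: "real K > 0" using KT Suc.prems by (cases K) auto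
        have "real K * (c / 4 * real n ^ k) \<le> real K * real (card Gd)"
          using low up by (simp add: algebra_simps)
        then have Gd: "c / 4 * real n ^ k \<le> real (card Gd)" using K by simp
        have "\<exists>S\<subseteq>Y. c' * real n ^ k \<le> real (card {xs \<in> Gd. M xs = S}) \<and> {xs \<in> Gd. M xs = S} \<noteq> {}"
        proof (rule ccontr)
          assume neg: "\<not> ?thesis"
          have lt: "real (card {xs \<in> Gd. M xs = S}) < c' * real n ^ k" if "S \<subseteq> Y" for S
          proof (cases "{xs \<in> Gd. M xs = S} = {}")
            case True
            then show ?thesis using c' n by (simp only: card.empty) simp
          next
            case False
            then show ?thesis using neg that by (meson not_le)
          qed
          have "Gd \<subseteq> (\<Union>S\<in>Pow Y. {xs \<in> Gd. M xs = S})" using M by blast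
          then have "card Gd \<le> card (\<Union>S\<in>Pow Y. {xs \<in> Gd. M xs = S})"
            using fG fY by (intro card_mono) auto
          also have "\<dots> \<le> (\<Sum>S\<in>Pow Y. card {xs \<in> Gd. M xs = S})"
            using fY by (intro card_UN_le) auto
          finally have "real (card Gd) \<le> (\<Sum>S\<in>Pow Y. real (card {xs \<in> Gd. M xs = S}))"
            by (simp only: of_nat_le_iff flip: of_nat_sum)
          also have "\<dots> < (\<Sum>S\<in>Pow Y. c' * real n ^ k)"
            using fY lt by (intro sum_strict_mono) auto
          also have "\<dots> = c / 4 * real n ^ k"
            using fY Y by (simp add: card_Pow c'_def)
          finally show False using Gd by simp
        qed
        then obtain S where S: "S \<subseteq> Y" "c' * real n ^ k \<le> real (card {xs \<in> Gd. M xs = S})"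
          "{xs \<in> Gd. M xs = S} \<noteq> {}" by blast
        then have "T \<le> card S" by (auto simp: Gd_def)
        then obtain A0 where A0: "A0 \<subseteq> S" "card A0 = T" by (metis obtain_subset_with_card_n)
        have sub: "{xs \<in> Gd. M xs = S} \<subseteq> {xs. set xs \<subseteq> W \<and> length xs = k}"
            by (auto simp: Gd_def L_def)
        obtain A where A: "\<And>i. i < k \<Longrightarrow> A i \<subseteq> W \<and> card (A i) = T"
          "\<And>xs. length xs = k \<Longrightarrow> (\<And>i. i < k \<Longrightarrow> xs ! i \<in> A i) \<Longrightarrow> xs \<in> {xs \<in> Gd. M xs = S}"
          by (rule blowup_atD[OF elim(1) W sub S(2)]) blast
        show ?thesis
        proof (intro exI[of _ "case_nat A0 A"] conjI allI impI)
          fix i assume "i < Suc k"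
          then show "case_nat A0 A i \<subseteq> W" "card (case_nat A0 A i) = T"
            using A0 S(1) fY A(1) by (auto split: nat.split)
        next
          fix xs assume xs: "length xs = Suc k \<and> (\<forall>i<Suc k. xs ! i \<in> case_nat A0 A i)"
          then obtain y ys where ys: "xs = y # ys" by (cases xs) auto
          have "ys \<in> {xs \<in> Gd. M xs = S}"
          proof (rule A(2))
            show "length ys = k" using xs ys by simp
            show "ys ! i \<in> A i" if "i < k" for i
              using conjunct2[OF xs, THEN spec, of "Suc i"] that ys by simp
          qed
          moreover have "y \<in> S" using xs ys A0 by force
          ultimately show "xs \<in> R" using ys by (auto simp: M_def)
        qed
      qed
    qed
  qed
qed

text \<open>Each clique is listed as a tuple of its elements. In a box of such tuples, fixing the
  other coordinates at \<open>a0\<close> shows that elements of different sides are distinct members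
  of a common clique, hence adjacent.\<close>

lemma blowup_cliques:
  fixes W :: "nat set"
  assumes b: "blowup_at k T c (card W)" and T: "T > 0" and W: "finite W" "D \<subseteq> W"
    and irr: "irreflp E" and many: "c * real (card W) ^ k \<le> real (card (cliques E D k))"
  obtains A where "\<And>i. i \<in> {1..k} \<Longrightarrow> A i \<subseteq> D \<and> card (A i) = T"
    "\<And>i j a b. i \<in> {1..k} \<Longrightarrow> j \<in> {1..k} \<Longrightarrow> i \<noteq> j \<Longrightarrow> a \<in> A i \<Longrightarrow> b \<in> A j \<Longrightarrow> E a b"
proof -
  define R where "R = {xs. distinct xs \<and> length xs = k \<and> set xs \<in> cliques E D k}"
  have fD: "finite D" using W finite_subset by blast
  have R: "R \<subseteq> {xs. set xs \<subseteq> W \<and> length xs = k}"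
    using W by (auto simp: R_def cliques_def rsets_def)
  have "cliques E D k \<subseteq> set ` R"
  proof
    fix S assume S: "S \<in> cliques E D k"
    then obtain xs where "set xs = S" "distinct xs"
      using cliquesD[OF fD S] finite_distinct_list by metis
    then show "S \<in> set ` R" using S cliquesD[OF fD S] distinct_card by (force simp: R_def)
  qed
  moreover have "finite R" using finite_subset[OF R finite_lists_length_eq[OF W(1)]] .
  ultimately have "card (cliques E D k) \<le> card R" by (rule surj_card_le[rotated])
  then have Rc: "c * real (card W) ^ k \<le> real (card R)" using many by linarith
  obtain A where A: "\<And>i. i < k \<Longrightarrow> A i \<subseteq> W \<and> card (A i) = T"
    "\<And>xs. length xs = k \<Longrightarrow> (\<And>i. i < k \<Longrightarrow> xs ! i \<in> A i) \<Longrightarrow> xs \<in> R"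
    by (rule blowup_atD[OF b W(1) refl R Rc]) blast
  have "\<exists>a. a \<in> A i" if "i < k" for i using A(1)[OF that] T
      by (metis card.empty ex_in_conv less_irrefl)
  then obtain a0 where a0: "\<And>i. i < k \<Longrightarrow> a0 i \<in> A i" by metis
  have key: "map (\<lambda>m. if m = i then a else if m = j then b else a0 m) [0..<k] \<in> R"
    if "i < k" "j < k" "a \<in> A i" "b \<in> A j" for i j a b
    using that a0 by (intro A(2)) auto
  have inD: "a \<in> D" if "i < k" "a \<in> A i" for i a
    using key[OF that(1) that(1) that(2) that(2)] that(1)
    by (force simp: R_def cliques_def rsets_def)
  have adj: "E a b" if h: "i < k" "j < k" "i \<noteq> j" "a \<in> A i" "b \<in> A j" for i j a b
  proof -
    let ?xs = "map (\<lambda>m. if m = i then a else if m = j then b else a0 m) [0..<k]"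
    have xs: "distinct ?xs" "set ?xs \<in> cliques E D k" using key[OF h(1,2,4,5)] by (auto simp: R_def)
    have i: "?xs ! i = a" "?xs ! j = b" "length ?xs = k" using h by auto
    then have "a \<noteq> b" using nth_eq_iff_index_eq[OF xs(1), of i j] h by metis
    moreover have "a \<in> set ?xs" "b \<in> set ?xs" using i h by (metis nth_mem)+
    ultimately show ?thesis using xs(2) unfolding cliques_def by blast
  qed
  show ?thesis
  proof (rule that[of "\<lambda>i. A (i - 1)"])
    fix i assume "i \<in> {1..k}"
    then show "A (i - 1) \<subseteq> D \<and> card (A (i - 1)) = T" using A(1)[of "i - 1"] inD[of "i - 1"] by auto
  next
    fix i j a b assume "i \<in> {1..k}" "j \<in> {1..k}" "i \<noteq> j" "a \<in> A (i - 1)" "b \<in> A (j - 1)"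
    then show "E a b" using adj[of "i - 1" "j - 1" a b] by auto
  qed
qed

section \<open>Expansions and greedy embeddings\<close>

text \<open>Recognises a copy from data on \<open>F\<close> itself: an embedding
  \<open>\<psi>\<close> of the vertices and an \<open>r\<close>-set \<open>h e\<close> for each
  edge. The new vertices of \<open>e\<close> are mapped onto the part of \<open>h e\<close> outside
  the image of \<open>e\<close>; the two intersection conditions make the combined map
  injective.\<close>

lemma expansion_copy:
  fixes h :: "'a set \<Rightarrow> 'b set"
  assumes V: "\<Union>F \<subseteq> V" "inj_on \<psi> V"
    and e: "\<And>e. e \<in> F \<Longrightarrow> finite (h e) \<and> card (h e) = r \<and> card e = 2 \<and> h e \<inter> \<psi> ` V = \<psi> ` e"
    and d: "\<And>e e'. e \<in> F \<Longrightarrow> e' \<in> F \<Longrightarrow> e \<noteq> e' \<Longrightarrow> h e \<inter> h e' \<subseteq> \<psi> ` V"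
  shows "is_copy (h ` F) (expansion r F)"
proof -
  have "\<exists>g. bij_betw g {..<r - 2} (h e - \<psi> ` e)" if "e \<in> F" for e
  proof -
    have "inj_on \<psi> e" using V that by (blast intro: inj_on_subset)
    then have "card (\<psi> ` e) = 2" using e[OF that] by (simp add: card_image)
    moreover have "\<psi> ` e \<subseteq> h e" using e[OF that] by blast
    ultimately have "card (h e - \<psi> ` e) = r - 2"
      using e[OF that] by (metis card_Diff_subset finite_subset)
    then show ?thesis
      using ex_bij_betw_nat_finite[of "h e - \<psi> ` e"] e[OF that] by (simp add: atLeast0LessThan)
  qed
  then obtain g where g: "\<And>e. e \<in> F \<Longrightarrow> bij_betw (g e) {..<r - 2} (h e - \<psi> ` e)" by metis
  have sub: "\<psi> ` e \<subseteq> h e" if "e \<in> F" for e using e[OF that] Int_lower1[of "h e" "\<psi> ` V"] by simp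
  define \<phi> where "\<phi> = case_sum \<psi> (\<lambda>(e, i). g e i)"
  let ?X = "\<lambda>e. Inl ` e \<union> (\<lambda>i. Inr (e, i)) ` {..<r - 2}"
  have im: "\<phi> ` ?X e = h e" if "e \<in> F" for e
  proof -
    have "\<phi> ` ?X e = \<psi> ` e \<union> g e ` {..<r - 2}"
      by (simp add: image_Un image_image \<phi>_def)
    also have "g e ` {..<r - 2} = h e - \<psi> ` e" using g[OF that] by (simp add: bij_betw_def)
    finally show ?thesis using sub[OF that] by auto
  qed
  have gin: "g e i \<in> h e" "g e i \<notin> \<psi> ` V" if "e \<in> F" "i < r - 2" for e i
  proof -
    have "g e i \<in> h e - \<psi> ` e" using g[OF that(1)] that(2) by (auto simp: bij_betw_def)
    then show "g e i \<in> h e" "g e i \<notin> \<psi> ` V" using e[OF that(1)] by blast+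
  qed
  have mix: "\<psi> v \<noteq> g e i" if "v \<in> V" "e \<in> F" "i < r - 2" for v e i
    using gin(2)[OF that(2,3)] that(1) by (metis imageI)
  have edges: "(\<lambda>e. \<phi> ` e) ` expansion r F = h ` F"
    unfolding expansion_def image_image using im by (intro image_cong) auto
  have "inj_on \<phi> (\<Union>(expansion r F))"
  proof (rule inj_onI)
    fix a b assume a: "a \<in> \<Union>(expansion r F)" and b: "b \<in> \<Union>(expansion r F)" and eq: "\<phi> a = \<phi> b"
    have el: "(\<exists>v\<in>V. a = Inl v) \<or> (\<exists>e\<in>F. \<exists>i<r - 2. a = Inr (e, i))" if "a \<in> \<Union>(expansion r F)" for a
      using that V(1) unfolding expansion_def by blast
    show "a = b"
    proof (cases a; cases b)
      fix v w assume "a = Inl v" "b = Inl w"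
      then show ?thesis using el[OF a] el[OF b] eq V(2) by (auto simp: \<phi>_def inj_on_def)
    next
      fix v w assume "a = Inl v" "b = Inr w"
      then show ?thesis using el[OF a] el[OF b] eq mix by (auto simp: \<phi>_def)
    next
      fix v w assume "a = Inr v" "b = Inl w"
      then show ?thesis using el[OF a] el[OF b] eq[symmetric] mix by (auto simp: \<phi>_def)
    next
      fix v w assume "a = Inr v" "b = Inr w"
      then obtain e i e' i' where w: "a = Inr (e, i)" "b = Inr (e', i')" "e \<in> F" "e' \<in> F"
          "i < r - 2" "i' < r - 2"
        using el[OF a] el[OF b] by auto
      then have eq': "g e i = g e' i'" using eq by (simp add: \<phi>_def)
      have "e = e'"
      proof (rule ccontr)
        assume "e \<noteq> e'"
        then have "g e i \<in> \<psi> ` V" using d[OF w(3,4)] gin w eq' by (metis IntI subsetD)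
        then show False using gin w by blast
      qed
      then show ?thesis using w eq' g[OF w(3)] by (auto simp: bij_betw_def inj_on_def)
    qed
  qed
  moreover have "\<phi> ` \<Union>(expansion r F) = \<Union>(h ` F)" unfolding edges[symmetric] by blast
  ultimately show ?thesis
    unfolding is_copy_def bij_betw_def by (intro exI[of _ \<phi>] conjI edges[symmetric])
qed

lemma card_rsets_superset:
  assumes "finite W" "finite S" "card S \<le> r"
  shows "card {e \<in> rsets r W. S \<subseteq> e} \<le> card W ^ (r - card S)"
proof -
  have "card {e \<in> rsets r W. S \<subseteq> e} \<le> card (rsets (r - card S) W)"
  proof (rule card_inj_on_le[where f = "\<lambda>e. e - S"])
    show "inj_on (\<lambda>e. e - S) {e \<in> rsets r W. S \<subseteq> e}" by (auto simp: inj_on_def)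
    show "(\<lambda>e. e - S) ` {e \<in> rsets r W. S \<subseteq> e} \<subseteq> rsets (r - card S) W"
      using assms by (auto simp: rsets_def card_Diff_subset)
  qed (use assms in simp)
  also have "\<dots> \<le> card W ^ (r - card S)"
    using binomial_le_pow[of "r - card S" "card W"]
    by (cases "r - card S \<le> card W") (auto simp: card_rsets[OF assms(1)] binomial_eq_0)
  finally show ?thesis .
qed

lemma extend_to_rset:
  assumes "finite W" "S \<subseteq> W" "card S \<le> r" "finite X" "card X + r \<le> card W"
  obtains f where "f \<in> rsets r W" "S \<subseteq> f" "f \<inter> X \<subseteq> S"
proof -
  have fS: "finite S" using assms finite_subset by blast
  have "card W \<le> card (W - (S \<union> X)) + card (S \<union> X)"
    using card_mono[of "(W - (S \<union> X)) \<union> (S \<union> X)" W] assms fS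
    by (intro order_trans[OF _ card_Un_le]) auto
  moreover have "card (S \<union> X) \<le> card S + card X" by (rule card_Un_le)
  ultimately have "r - card S \<le> card (W - (S \<union> X))" using assms by linarith
  then obtain R where R: "R \<subseteq> W - (S \<union> X)" "card R = r - card S"
    by (metis obtain_subset_with_card_n)
  have "card (S \<union> R) = r"
    using R fS assms finite_subset[of R W] by (subst card_Un_disjoint) auto
  then show ?thesis using R assms by (intro that[of "S \<union> R"]) (auto simp: rsets_def)
qed

lemma ex_diff_of_card_less:
  assumes "finite X" "card X < card A"
  shows "\<exists>a\<in>A. a \<notin> X"
proof (rule ccontr)
  assume "\<not> ?thesis"
  then have "card A \<le> card X" using assms(1) by (intro card_mono) auto
  then show False using assms(2) by simp
qed

definition part_verts :: "nat \<Rightarrow> nat \<Rightarrow> (nat \<times> nat) set" where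
  "part_verts l t = {1..l} \<times> {1..t}"

text \<open>Greedy embedding, one vertex at a time. The next vertex must avoid \<open>Z\<close>, at
  most \<open>l * t\<close> images already used, and at most \<open>\<beta>\<close> non-neighbours
  of each of them, whence the lower bound on \<open>card (S i)\<close>. The prescribed vertices of
  \<open>P\<close> may use the larger sets \<open>V i\<close>, so non-neighbours are bounded for all
  vertices of \<open>V i\<close>.\<close>

lemma extend_multipartite_embedding:
  fixes S V :: "nat \<Rightarrow> 'a set" and \<beta> :: real and l t :: nat
  defines "verts \<equiv> part_verts l t"
  assumes E: "symp E" and \<beta>: "\<beta> \<ge> 0"
    and S: "\<And>i. i \<in> {1..l} \<Longrightarrow> finite (S i) \<and> S i \<subseteq> V i \<and> real (l * t) * (\<beta> + 1) + real (card Z) <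
        real (card (S i))"
    and miss: "\<And>i j x. i \<in> {1..l} \<Longrightarrow> j \<in> {1..l} \<Longrightarrow> i \<noteq> j \<Longrightarrow> x \<in> V i \<Longrightarrow> real (card {y \<in> S j. \<not> E x y}) \<le>
        \<beta>"
    and P: "P \<subseteq> verts" "inj_on \<psi>0 P" "\<And>x. x \<in> P \<Longrightarrow> \<psi>0 x \<in> V (fst x)"
      "\<And>x y. x \<in> P \<Longrightarrow> y \<in> P \<Longrightarrow> fst x \<noteq> fst y \<Longrightarrow> E (\<psi>0 x) (\<psi>0 y)"
    and Z: "finite Z"
  shows "\<exists>\<psi>. (\<forall>x\<in>P. \<psi> x = \<psi>0 x) \<and> inj_on \<psi> verts \<and> (\<forall>x\<in>verts. \<psi> x \<in> V (fst x)) \<and>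
    (\<forall>x\<in>verts. \<forall>y\<in>verts. fst x \<noteq> fst y \<longrightarrow> E (\<psi> x) (\<psi> y)) \<and> (\<forall>x\<in>verts - P. \<psi> x \<in> S (fst x) - Z)"
proof -
  have fv: "finite verts" "card verts = l * t" by (auto simp: verts_def part_verts_def)
  have "\<exists>\<psi>. (\<forall>x\<in>P. \<psi> x = \<psi>0 x) \<and> inj_on \<psi> (P \<union> M) \<and> (\<forall>x\<in>P \<union> M. \<psi> x \<in> V (fst x)) \<and>
      (\<forall>x\<in>P \<union> M. \<forall>y\<in>P \<union> M. fst x \<noteq> fst y \<longrightarrow> E (\<psi> x) (\<psi> y)) \<and> (\<forall>x\<in>M. \<psi> x \<in> S (fst x) - Z)"
    if "finite M" "M \<subseteq> verts - P" for M
    using that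
  proof (induction M rule: finite_induct)
    case empty
    then show ?case using P by (intro exI[of _ \<psi>0]) auto
  next
    case (insert m M)
    then obtain \<psi> where \<psi>: "\<forall>x\<in>P. \<psi> x = \<psi>0 x" "inj_on \<psi> (P \<union> M)" "\<forall>x\<in>P \<union> M. \<psi> x \<in> V (fst x)"
      "\<forall>x\<in>P \<union> M. \<forall>y\<in>P \<union> M. fst x \<noteq> fst y \<longrightarrow> E (\<psi> x) (\<psi> y)" "\<forall>x\<in>M. \<psi> x \<in> S (fst x) - Z"
      by auto
    let ?Q = "P \<union> M"
    have Q: "?Q \<subseteq> verts" "finite ?Q" using insert P(1) fv finite_subset[of P] by auto
    then have cQ: "card ?Q \<le> l * t" using card_mono[OF fv(1)] fv(2) by metis
    have m: "m \<in> verts" "fst m \<in> {1..l}" "m \<notin> ?Q" using insert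
        by (auto simp: verts_def part_verts_def)
    note Sm = S[OF m(2)]
    let ?B = "\<lambda>y. {z \<in> S (fst m). \<not> E (\<psi> y) z}"
    let ?R = "{y \<in> ?Q. fst y \<noteq> fst m}"
    let ?bad = "Z \<union> \<psi> ` ?Q \<union> (\<Union>y\<in>?R. ?B y)"
    have B: "real (card (?B y)) \<le> \<beta>" if "y \<in> ?R" for y
      using that \<psi>(3) Q(1) m by (intro miss[of "fst y"]) (auto simp: verts_def part_verts_def)
    have "real (card (\<Union>y\<in>?R. ?B y)) \<le> (\<Sum>y\<in>?R. real (card (?B y)))"
    proof -
      have "card (\<Union>y\<in>?R. ?B y) \<le> (\<Sum>y\<in>?R. card (?B y))"
        by (rule card_UN_le) (use Q(2) in simp)
      then show ?thesis by (simp only: of_nat_le_iff flip: of_nat_sum)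
    qed
    also have "\<dots> \<le> (\<Sum>y\<in>?R. \<beta>)" by (rule sum_mono) (rule B)
    also have "\<dots> \<le> real (l * t) * \<beta>"
    proof -
      have "card ?R \<le> card ?Q" by (rule card_mono[OF Q(2)]) auto
      then have "card ?R \<le> l * t" using cQ by (rule order_trans)
      then have "real (card ?R) \<le> real (l * t)" by (simp only: of_nat_le_iff)
      then show ?thesis using mult_right_mono[OF _ \<beta>] by (simp only: sum_constant)
    qed
    finally have b1: "real (card (\<Union>y\<in>?R. ?B y)) \<le> real (l * t) * \<beta>" .
    have "card (\<psi> ` ?Q) \<le> l * t" using card_image_le[OF Q(2), of \<psi>] cQ by simp
    then have b2: "real (card (\<psi> ` ?Q)) \<le> real (l * t)" by (simp only: of_nat_le_iff)
    have "card ?bad \<le> card Z + card (\<psi> ` ?Q) + card (\<Union>y\<in>?R. ?B y)"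
      by (rule order_trans[OF card_Un_le]) (simp add: card_Un_le)
    then have "real (card ?bad) \<le> real (card Z) + real (card (\<psi> ` ?Q)) + real (card (\<Union>y\<in>?R. ?B y))"
      by (simp only: of_nat_le_iff flip: of_nat_add)
    then have "real (card ?bad) < real (card (S (fst m)))"
      using b1 b2 Sm by (simp add: algebra_simps)
    moreover have "finite ?bad" using Z Q(2) Sm by auto
    ultimately obtain z where z: "z \<in> S (fst m)" "z \<notin> ?bad"
      using ex_diff_of_card_less[of ?bad "S (fst m)"] by auto
    have adj: "E (\<psi> y) z \<and> E z (\<psi> y)" if "y \<in> ?Q" "fst y \<noteq> fst m" for y
    proof -
      have "E (\<psi> y) z" using that z by blast
      then show ?thesis using E by (auto dest: sympD)
    qed
    show ?case
    proof (intro exI[of _ "\<psi>(m := z)"] conjI)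
      show "\<forall>x\<in>P. (\<psi>(m := z)) x = \<psi>0 x" using \<psi>(1) m by auto
      show "inj_on (\<psi>(m := z)) (P \<union> insert m M)"
        using \<psi>(2) m z by (auto simp: inj_on_def)
      show "\<forall>x\<in>P \<union> insert m M. (\<psi>(m := z)) x \<in> V (fst x)"
        using \<psi>(3) z Sm by auto
      show "\<forall>x\<in>insert m M. (\<psi>(m := z)) x \<in> S (fst x) - Z"
        using \<psi>(5) z by auto
      show "\<forall>x\<in>P \<union> insert m M. \<forall>y\<in>P \<union> insert m M. fst x \<noteq> fst y \<longrightarrow> E ((\<psi>(m := z)) x) ((\<psi>(m := z)) y)"
        using \<psi>(4) adj m by (auto simp: fun_upd_def)
    qed
  qed
  from this[of "verts - P"] fv have "\<exists>\<psi>. (\<forall>x\<in>P. \<psi> x = \<psi>0 x) \<and> inj_on \<psi> (P \<union> (verts - P)) \<and>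
      (\<forall>x\<in>P \<union> (verts - P). \<psi> x \<in> V (fst x)) \<and>
      (\<forall>x\<in>P \<union> (verts - P). \<forall>y\<in>P \<union> (verts - P). fst x \<noteq> fst y \<longrightarrow> E (\<psi> x) (\<psi> y)) \<and> (\<forall>x\<in>verts - P. \<psi> x \<in>
          S (fst x) - Z)"
    by blast
  moreover have "P \<union> (verts - P) = verts" using P(1) by auto
  ultimately show ?thesis by (simp only:)
qed

text \<open>Relabels the parts: the first extra edge of \<open>F\<close> lies in part
  \<open>1\<close>, but has to be realised in a given part \<open>i\<close>.\<close>

lemma ex_inj_swap:
  fixes l :: nat
  assumes "i \<in> {1..l}"
  shows "\<exists>\<sigma>. inj_on \<sigma> {1..l} \<and> \<sigma> ` {1..l} \<subseteq> {1..l} \<and> \<sigma> 1 = i"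
proof (intro exI[of _ "transpose 1 i"] conjI)
  show "inj_on (transpose 1 i) {1..l}" by (rule inj_on_subset[OF _ subset_UNIV]) simp
qed (use assms in \<open>auto simp: transpose_def\<close>)

lemma ex_inj_swap2:
  fixes l :: nat
  assumes "i \<in> {1..l}" "j \<in> {1..l}" "i \<noteq> j"
  shows "\<exists>\<sigma>. inj_on \<sigma> {1..l} \<and> \<sigma> ` {1..l} \<subseteq> {1..l} \<and> \<sigma> 1 = i \<and> \<sigma> 2 = j"
proof -
  define k where "k = transpose 1 i j"
  \<comment> \<open>The swap of \<open>1\<close> and \<open>i\<close> moves \<open>k\<close> back to
    \<open>j\<close>, so swapping \<open>2\<close> and \<open>k\<close> beforehand sends
    \<open>2\<close> to \<open>j\<close>.\<close>
  have k: "k \<in> {1..l}" "k \<noteq> 1" "transpose 1 i k = j"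
    using assms by (auto simp: k_def transpose_def)
  have l: "2 \<in> {1..l}" using assms by auto
  show ?thesis
  proof (intro exI[of _ "transpose 1 i \<circ> transpose 2 k"] conjI)
    show "inj_on (transpose 1 i \<circ> transpose 2 k) {1..l}"
      by (rule inj_on_subset[OF _ subset_UNIV]) (simp add: inj_compose)
    show "(transpose 1 i \<circ> transpose 2 k) ` {1..l} \<subseteq> {1..l}"
      using assms(1) k(1) l by (auto simp: transpose_def)
  qed (use k in \<open>auto simp: transpose_def\<close>)
qed

section \<open>The codegree graph of a colouring without rainbow copy\<close>

abbreviation first_edge :: "(nat \<times> nat) set" where
  "first_edge \<equiv> {(1, 1), (1, 2)}"

lemma complete_multipartite_edge:
  assumes "k \<in> complete_multipartite l t"
  obtains x y where "k = {x, y}" "x \<in> part_verts l t" "y \<in> part_verts l t" "fst x \<noteq> fst y"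
proof -
  obtain i j a b where "k = {(i, a), (j, b)}" "i \<in> {1..l}" "j \<in> {1..l}" "i \<noteq> j" "a \<in> {1..t}"
      "b \<in> {1..t}"
    using assms unfolding complete_multipartite_def by blast
  then show ?thesis by (intro that[of "(i, a)" "(j, b)"]) (simp_all add: part_verts_def)
qed

lemma finite_complete_multipartite: "finite (complete_multipartite l t)"
proof (rule finite_subset)
  show "complete_multipartite l t \<subseteq> Pow (part_verts l t)"
    by (auto elim!: complete_multipartite_edge)
qed (simp add: part_verts_def)

text \<open>\<open>G\<close> selects one edge of each colour, so its size is the number of colours.
  The three graphs share \<open>first_edge\<close>; \<open>q\<close> is the other extra edge. The
  vertex set is an arbitrary finite \<open>W\<close> because vertices are deleted before the
  structure is analysed.\<close>

locale rainbow_free =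
  fixes r l t :: nat and q :: "(nat \<times> nat) set" and \<chi> :: "nat set \<Rightarrow> nat"
    and W :: "nat set" and G :: "nat set set"
  assumes r: "4 \<le> r" "r \<le> l" and t: "4 \<le> t"
    and q: "q \<in> {{(1, 2), (1, 3)}, {(1, 3), (1, 4)}, {(2, 1), (2, 2)}}"
    and W: "finite W"
    and G: "G \<subseteq> rsets r W" "inj_on \<chi> G" "\<chi> ` G = \<chi> ` rsets r W"
    and free: "\<not> (\<exists>H \<subseteq> rsets r W.
      is_copy H (expansion r (complete_multipartite l t \<union> {first_edge, q})) \<and> rainbow \<chi> H)"
begin

abbreviation "verts \<equiv> part_verts l t"
abbreviation "K \<equiv> complete_multipartite l t"

text \<open>The number of vertices occupied by a partially built copy of the expansion.\<close>

definition avoid_bound :: nat where "avoid_bound = l * t + r * (2 + card K)"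
definition codeg_factor :: nat where "codeg_factor = avoid_bound + 2"

text \<open>At most \<open>card W ^ (r - 3)\<close> edges contain \<open>u\<close>, \<open>v\<close>
  and a given third vertex. A pair above the threshold thus lies in an edge avoiding
  \<open>avoid_bound\<close> further vertices and, by the extra 2 in \<open>codeg_factor\<close>,
  two colours.\<close>

definition adj :: "nat \<Rightarrow> nat \<Rightarrow> bool" where
  "adj u v \<longleftrightarrow> u \<noteq> v \<and> codeg_factor * card W ^ (r - 3) < card {e \<in> G. u \<in> e \<and> v \<in> e}"

lemma finite_G: "finite G"
  using G(1) W by (simp add: finite_subset)

lemma G_edgeD: "e \<in> G \<Longrightarrow> e \<subseteq> W \<and> card e = r \<and> finite e"
  using G(1) W by (auto simp: rsets_def dest: finite_subset)

lemma symp_adj: "symp adj"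
  unfolding adj_def by (rule sympI) (simp add: conj_commute)

lemma irreflp_adj: "irreflp adj"
  by (rule irreflpI) (simp add: adj_def)

lemma adj_in_W: assumes "adj u v" shows "u \<in> W" "v \<in> W"
proof -
  have "{e \<in> G. u \<in> e \<and> v \<in> e} \<noteq> {}" using assms unfolding adj_def
      by (metis card.empty not_less_zero)
  then show "u \<in> W" "v \<in> W" using G_edgeD by blast+
qed

lemma finite_verts [simp]: "finite verts" and card_verts [simp]: "card verts = l * t"
  by (auto simp: part_verts_def)

lemma q_cases:
  obtains "q = {(1, 2), (1, 3)}" | "q = {(1, 3), (1, 4)}" | "q = {(2, 1), (2, 2)}"
  using q by blast

lemma first_edge_q:
  "first_edge \<subseteq> verts" "q \<subseteq> verts" "first_edge \<noteq> q" "card first_edge = 2" "card q = 2"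
  "first_edge \<notin> K" "q \<notin> K"
proof -
  show "first_edge \<subseteq> verts" using r t by (simp add: part_verts_def)
  show "q \<subseteq> verts" by (rule q_cases) (use r t in \<open>simp_all add: part_verts_def\<close>)
  show "first_edge \<noteq> q" by (rule q_cases) (simp_all add: doubleton_eq_iff)
  show "card first_edge = 2" by simp
  show "card q = 2" by (rule q_cases) simp_all
  have "fst x \<noteq> fst y" if "{x, y} \<in> K" for x y
    using that by (auto elim!: complete_multipartite_edge simp: doubleton_eq_iff)
  from this[of "(1, 1)" "(1, 2)"] this[of "(1, 2)" "(1, 3)"] this[of "(1, 3)" "(1, 4)"] this[of
      "(2, 1)" "(2, 2)"]
  have "first_edge \<notin> K" "{(1, 2), (1, 3)} \<notin> K" "{(1, 3), (1, 4)} \<notin> K" "{(2, 1), (2, 2)} \<notin> K" by auto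
  then show "first_edge \<notin> K" "q \<notin> K" using q_cases by metis+
qed

text \<open>Each vertex of \<open>Z\<close> other than \<open>u\<close> and \<open>v\<close> rules
  out at most \<open>card W ^ (r - 3)\<close> edges, and each colour in \<open>Cs\<close> at most
  one, since \<open>\<chi>\<close> is injective on \<open>G\<close>; the codegree exceeds the
  total.\<close>

lemma adj_extend:
  assumes "adj u v" "finite Z" "card Z \<le> avoid_bound" "finite Cs" "card Cs \<le> 2"
  obtains e where "e \<in> G" "u \<in> e" "v \<in> e" "e \<inter> Z \<subseteq> {u, v}" "\<chi> e \<notin> Cs"
proof -
  let ?A = "{e \<in> G. u \<in> e \<and> v \<in> e}"
  let ?B = "\<lambda>w. {e \<in> rsets r W. {u, v, w} \<subseteq> e}"
  let ?bad = "(\<Union>w\<in>Z - {u, v}. ?B w) \<union> {e \<in> G. \<chi> e \<in> Cs}"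
  have uv: "u \<noteq> v" using assms(1) by (simp add: adj_def)
  have n: "1 \<le> card W ^ (r - 3)"
    using adj_in_W[OF assms(1)] W
        by (metis One_nat_def Suc_leI card_gt_0_iff empty_iff zero_less_power)
  have B: "card (?B w) \<le> card W ^ (r - 3)" if "w \<in> Z - {u, v}" for w
  proof -
    have "card {u, v, w} = 3" using that uv by auto
    then show ?thesis using card_rsets_superset[OF W, of "{u, v, w}" r] r by simp
  qed
  have "card (\<Union>w\<in>Z - {u, v}. ?B w) \<le> (\<Sum>w\<in>Z - {u, v}. card (?B w))"
    by (rule card_UN_le) (use assms(2) in simp)
  also have "\<dots> \<le> (\<Sum>w\<in>Z - {u, v}. card W ^ (r - 3))" by (rule sum_mono) (rule B)
  also have "\<dots> = card (Z - {u, v}) * card W ^ (r - 3)" by simp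
  also have "\<dots> \<le> avoid_bound * card W ^ (r - 3)"
    using card_mono[OF assms(2), of "Z - {u, v}"] assms(3) by (intro mult_right_mono) auto
  finally have 1: "card (\<Union>w\<in>Z - {u, v}. ?B w) \<le> avoid_bound * card W ^ (r - 3)" .
  have "card {e \<in> G. \<chi> e \<in> Cs} \<le> card Cs"
    by (rule card_inj_on_le[where f = \<chi>]) (use G(2) assms(4) in \<open>auto simp: inj_on_def\<close>)
  then have 2: "card {e \<in> G. \<chi> e \<in> Cs} \<le> 2 * card W ^ (r - 3)" using assms(5) n by linarith
  have "card ?bad \<le> card (\<Union>w\<in>Z - {u, v}. ?B w) + card {e \<in> G. \<chi> e \<in> Cs}" by (rule card_Un_le)
  also have "\<dots> \<le> codeg_factor * card W ^ (r - 3)" using 1 2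
      by (simp add: codeg_factor_def algebra_simps)
  also have "\<dots> < card ?A" using assms(1) by (simp add: adj_def)
  finally have "card ?bad < card ?A" .
  moreover have "finite ?bad" using assms(2) W finite_G by auto
  ultimately obtain e where e: "e \<in> ?A" "e \<notin> ?bad" using ex_diff_of_card_less by blast
  then have "e \<in> rsets r W" using G(1) by auto
  then have "e \<inter> Z \<subseteq> {u, v}" using e by blast
  moreover have "\<chi> e \<notin> Cs" "e \<in> G" "u \<in> e" "v \<in> e" using e by blast+
  ultimately show ?thesis by (intro that)
qed

text \<open>Greedy choice over the edges of \<open>K\<close>, with the vertices of all earlier
  choices added to \<open>Z\<close>. Inside \<open>G\<close> distinct edges differ in colour anyway;
  \<open>Cs\<close> is reserved for the colours of the two extra edges.\<close>

lemma select_edges: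
  assumes cross: "\<And>x y. x \<in> verts \<Longrightarrow> y \<in> verts \<Longrightarrow> fst x \<noteq> fst y \<Longrightarrow> adj (\<psi> x) (\<psi> y)"
    and Z: "finite Z" "card Z \<le> l * t + 2 * r" and Cs: "finite Cs" "card Cs \<le> 2"
  shows "\<exists>h. \<forall>k\<in>K. h k \<in> G \<and> \<psi> ` k \<subseteq> h k \<and> h k \<inter> Z \<subseteq> \<psi> ` k \<and> \<chi> (h k) \<notin> Cs \<and>
    (\<forall>k'\<in>K. k' \<noteq> k \<longrightarrow> h k \<inter> h k' \<subseteq> \<psi> ` verts)"
proof -
  have "\<exists>h. \<forall>k\<in>M. h k \<in> G \<and> \<psi> ` k \<subseteq> h k \<and> h k \<inter> Z \<subseteq> \<psi> ` k \<and> \<chi> (h k) \<notin> Cs \<and>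
    (\<forall>k'\<in>M. k' \<noteq> k \<longrightarrow> h k \<inter> h k' \<subseteq> \<psi> ` verts)" if "finite M" "M \<subseteq> K" for M
    using that
  proof (induction M rule: finite_induct)
    case (insert m M)
    then have "\<exists>h. \<forall>k\<in>M. h k \<in> G \<and> \<psi> ` k \<subseteq> h k \<and> h k \<inter> Z \<subseteq> \<psi> ` k \<and> \<chi> (h k) \<notin> Cs \<and>
      (\<forall>k'\<in>M. k' \<noteq> k \<longrightarrow> h k \<inter> h k' \<subseteq> \<psi> ` verts)" by simp
    then obtain h where h0: "\<forall>k\<in>M. h k \<in> G \<and> \<psi> ` k \<subseteq> h k \<and> h k \<inter> Z \<subseteq> \<psi> ` k \<and> \<chi> (h k) \<notin> Cs \<and>
      (\<forall>k'\<in>M. k' \<noteq> k \<longrightarrow> h k \<inter> h k' \<subseteq> \<psi> ` verts)" ..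
    have hG: "h k \<in> G" and h: "\<psi> ` k \<subseteq> h k \<and> h k \<inter> Z \<subseteq> \<psi> ` k \<and> \<chi> (h k) \<notin> Cs"
      and hd: "\<And>k'. k' \<in> M \<Longrightarrow> k' \<noteq> k \<Longrightarrow> h k \<inter> h k' \<subseteq> \<psi> ` verts" if "k \<in> M" for k
      using bspec[OF h0 that] by simp_all
    obtain x y where m: "m = {x, y}" "x \<in> verts" "y \<in> verts" "fst x \<noteq> fst y"
      using insert by (auto elim: complete_multipartite_edge)
    let ?Z = "Z \<union> (\<Union>k\<in>M. h k)"
    have "card (\<Union>k\<in>M. h k) \<le> (\<Sum>k\<in>M. card (h k))" by (rule card_UN_le) (rule insert)
    also have "\<dots> = (\<Sum>k\<in>M. r)" using hG G_edgeD by (intro sum.cong) auto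
    also have "\<dots> = r * card M" by simp
    also have "\<dots> \<le> r * card K"
      using insert by (intro mult_left_mono card_mono finite_complete_multipartite) auto
    finally have cZ: "card ?Z \<le> avoid_bound"
      using Z(2) card_Un_le[of Z "\<Union>k\<in>M. h k"] by (simp add: avoid_bound_def algebra_simps)
    have fZ: "finite ?Z" using Z(1) insert(1) hG G_edgeD by auto
    obtain e where e: "e \<in> G" "\<psi> x \<in> e" "\<psi> y \<in> e" "e \<inter> ?Z \<subseteq> {\<psi> x, \<psi> y}" "\<chi> e \<notin> Cs"
      by (rule adj_extend[OF cross[OF m(2-4)] fZ cZ Cs])
    have sub: "{\<psi> x, \<psi> y} \<subseteq> \<psi> ` verts" using m by auto
    have eh: "e \<inter> h k \<subseteq> \<psi> ` verts" if "k \<in> M" for k using e(4) sub that by blast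
    have em: "\<psi> ` m \<subseteq> e" "e \<inter> Z \<subseteq> \<psi> ` m" using e m by auto
    show ?case
    proof (intro exI[of _ "h(m := e)"] ballI)
      fix k assume k: "k \<in> insert m M"
      show "(h(m := e)) k \<in> G \<and> \<psi> ` k \<subseteq> (h(m := e)) k \<and> (h(m := e)) k \<inter> Z \<subseteq> \<psi> ` k \<and>
          \<chi> ((h(m := e)) k) \<notin> Cs \<and>
          (\<forall>k'\<in>insert m M. k' \<noteq> k \<longrightarrow> (h(m := e)) k \<inter> (h(m := e)) k' \<subseteq> \<psi> ` verts)"
      proof (cases "k = m")
        case True
        then show ?thesis using e(1,5) em eh by simp
      next
        case False
        then have "k \<in> M" using k by simp
        then show ?thesis using False hG[of k] h[of k] hd[of k] eh[of k] by (simp add: Int_commute)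
      qed
    qed
  qed simp
  then show ?thesis using finite_complete_multipartite by blast
qed

text \<open>The forcing principle behind all colour identities: once \<open>K\<^sub>l[t]\<close>
  sits in the codegree graph, two \<open>r\<close>-sets in the position of the extra edges agree in
  colour, since otherwise \<open>select_edges\<close> avoids both colours and completes a rainbow
  copy. Neither \<open>ep\<close> nor \<open>eq\<close> has to belong to \<open>G\<close>.\<close>

lemma completion:
  assumes \<psi>: "inj_on \<psi> verts" "\<psi> ` verts \<subseteq> W"
    and cross: "\<And>x y. x \<in> verts \<Longrightarrow> y \<in> verts \<Longrightarrow> fst x \<noteq> fst y \<Longrightarrow> adj (\<psi> x) (\<psi> y)"
    and ep: "ep \<in> rsets r W" "ep \<inter> \<psi> ` verts = \<psi> ` first_edge"
    and eq: "eq \<in> rsets r W" "eq \<inter> \<psi> ` verts = \<psi> ` q"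
    and disj: "ep \<inter> eq \<subseteq> \<psi> ` verts"
  shows "\<chi> ep = \<chi> eq"
proof (rule ccontr)
  assume ne: "\<chi> ep \<noteq> \<chi> eq"
  let ?Z = "\<psi> ` verts \<union> (ep \<union> eq)"
  have cp: "card ep = r" "card eq = r" "finite ep" "finite eq"
    using ep eq W by (auto simp: rsets_def dest: finite_subset)
  have "card ?Z \<le> card (\<psi> ` verts) + (card ep + card eq)"
    by (rule order_trans[OF card_Un_le]) (simp add: card_Un_le)
  then have Z: "finite ?Z" "card ?Z \<le> l * t + 2 * r"
    using card_image_le[OF finite_verts, of \<psi>] cp by auto
  have Cs: "finite {\<chi> ep, \<chi> eq}" "card {\<chi> ep, \<chi> eq} \<le> 2" by (auto simp: card_insert_if)
  obtain h where h0: "\<forall>k\<in>K. h k \<in> G \<and> \<psi> ` k \<subseteq> h k \<and> h k \<inter> ?Z \<subseteq> \<psi> ` k \<and> \<chi> (h k) \<notin> {\<chi> ep, \<chi> eq} \<and>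
    (\<forall>k'\<in>K. k' \<noteq> k \<longrightarrow> h k \<inter> h k' \<subseteq> \<psi> ` verts)"
    using select_edges[of \<psi>, OF cross Z Cs] ..
  have hG: "h k \<in> G" and hp: "\<psi> ` k \<subseteq> h k" and hZ: "h k \<inter> ?Z \<subseteq> \<psi> ` k"
      and hc: "\<chi> (h k) \<notin> {\<chi> ep, \<chi> eq}"
    and hd: "\<And>k'. k' \<in> K \<Longrightarrow> k' \<noteq> k \<Longrightarrow> h k \<inter> h k' \<subseteq> \<psi> ` verts" if "k \<in> K" for k
    using bspec[OF h0 that] by simp_all
  define H where "H = h(first_edge := ep, q := eq)"
  define F where "F = K \<union> {first_edge, q}"
  have F: "k \<in> K \<or> k = first_edge \<or> k = q" if "k \<in> F" for k using that unfolding F_def by blast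
  note fq = first_edge_q
  have HK: "H k = h k" if "k \<in> K" for k using that fq by (auto simp: H_def)
  have Hp: "H first_edge = ep" using fq(3) by (simp add: H_def)
  have Hq: "H q = eq" by (simp add: H_def)
  have Kv: "k \<subseteq> verts" "card k = 2" if "k \<in> K" for k
    using that by (auto elim!: complete_multipartite_edge)
  have good: "H k \<in> rsets r W \<and> card k = 2 \<and> k \<subseteq> verts \<and> H k \<inter> \<psi> ` verts = \<psi> ` k" if kF: "k \<in> F"
      for k
  proof -
    consider "k \<in> K" | "k = first_edge" | "k = q" using F[OF kF] by blast
    then show ?thesis
    proof cases
      case 1
      have "h k \<inter> \<psi> ` verts = \<psi> ` k" using hp[OF 1] hZ[OF 1] Kv(1)[OF 1] by blast
      moreover have "h k \<in> rsets r W" using hG[OF 1] G(1) by blast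
      ultimately show ?thesis using HK[OF 1] Kv[OF 1] by simp
    next
      case 2
      then show ?thesis using Hp ep fq by simp
    next
      case 3
      then show ?thesis using Hq eq fq by simp
    qed
  qed
  have out: "h k \<inter> ep \<subseteq> \<psi> ` verts" "h k \<inter> eq \<subseteq> \<psi> ` verts" if "k \<in> K" for k
    using hZ[OF that] Kv(1)[OF that] by blast+
  have dd: "H k \<inter> H k' \<subseteq> \<psi> ` verts" if kk: "k \<in> F" "k' \<in> F" "k \<noteq> k'" for k k'
  proof -
    have KK: "h k \<inter> h k' \<subseteq> \<psi> ` verts" if "k \<in> K" "k' \<in> K" using hd[OF that] kk(3) by simp
    show ?thesis
    proof (cases "k \<in> K")
      case True
      show ?thesis
      proof (cases "k' \<in> K")
        case True
        then show ?thesis using KK \<open>k \<in> K\<close> HK by simp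
      next
        case False
        then have "k' = first_edge \<or> k' = q" using F[OF kk(2)] by simp
        then show ?thesis using out[OF \<open>k \<in> K\<close>] HK[OF \<open>k \<in> K\<close>] Hp Hq by metis
      qed
    next
      case False
      then have k: "k = first_edge \<or> k = q" using F[OF kk(1)] by simp
      show ?thesis
      proof (cases "k' \<in> K")
        case True
        then show ?thesis using k out[OF True] HK[OF True] Hp Hq by (metis Int_commute)
      next
        case False
        then have "k' = first_edge \<or> k' = q" using F[OF kk(2)] by simp
        then consider "k = first_edge" "k' = q" | "k = q" "k' = first_edge" using k kk(3) by metis
        then show ?thesis by cases (use Hp Hq disj in \<open>simp_all add: Int_commute\<close>)
      qed
    qed
  qed
  have "is_copy (H ` F) (expansion r F)"
  proof (rule expansion_copy[OF _ \<psi>(1)])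
    show "\<Union> F \<subseteq> verts" using good by blast
    show "finite (H e) \<and> card (H e) = r \<and> card e = 2 \<and> H e \<inter> \<psi> ` verts = \<psi> ` e" if "e \<in> F" for e
      using good[OF that] W by (auto simp: rsets_def dest: finite_subset)
  qed (rule dd)
  moreover have "H ` F \<subseteq> rsets r W" using good by blast
  moreover have "rainbow \<chi> (H ` F)"
    unfolding rainbow_def
  proof (intro ballI impI)
    fix a b assume ab: "a \<in> H ` F" "b \<in> H ` F" "a \<noteq> b"
    have c: "a \<in> G \<and> \<chi> a \<notin> {\<chi> ep, \<chi> eq} \<or> a = ep \<or> a = eq" if aF: "a \<in> H ` F" for a
    proof -
      obtain k where k: "a = H k" "k \<in> F" using aF by (rule imageE)
      show ?thesis
      proof (cases "k \<in> K")
        case True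
        then show ?thesis using hG[OF True] hc[OF True] HK[OF True] k by simp
      next
        case False
        then have "k = first_edge \<or> k = q" using F[OF k(2)] by simp
        then show ?thesis using k Hp Hq by metis
      qed
    qed
    show "\<chi> a \<noteq> \<chi> b"
      using c[OF ab(1)] c[OF ab(2)] ab(3) ne inj_onD[OF G(2), of a b] by (metis insertI1 insertI2)
  qed
  ultimately show False using free unfolding F_def by blast
qed

text \<open>The extra edge \<open>q\<close> may be realised by an arbitrary \<open>r\<close>-set, since there are enough edges of
  \<open>G\<close> to avoid its colour. Hence already \<open>K\<^sub>l[t]\<close> plus one edge is excluded in the codegree graph.\<close>

lemma no_multipartite_plus_edge:
  assumes S: "\<And>j. j \<in> {1..l} \<Longrightarrow> S j \<subseteq> W \<and> real (l * t) * (\<beta> + 1) < real (card (S j))"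
    and miss: "\<And>i j x. i \<in> {1..l} \<Longrightarrow> j \<in> {1..l} \<Longrightarrow> i \<noteq> j \<Longrightarrow> x \<in> S i \<Longrightarrow>
        real (card {y \<in> S j. \<not> adj x y}) \<le> \<beta>"
    and \<beta>: "\<beta> \<ge> 0" and i: "i \<in> {1..l}" and xy: "adj x y"
    and missx: "\<And>j. j \<in> {1..l} \<Longrightarrow> j \<noteq> i \<Longrightarrow> real (card {z \<in> S j. \<not> adj x z}) \<le> \<beta>"
    and missy: "\<And>j. j \<in> {1..l} \<Longrightarrow> j \<noteq> i \<Longrightarrow> real (card {z \<in> S j. \<not> adj y z}) \<le> \<beta>"
    and large: "avoid_bound \<le> card W"
  shows False
proof -
  obtain \<sigma> where \<sigma>: "inj_on \<sigma> {1..l}" "\<sigma> ` {1..l} \<subseteq> {1..l}" "\<sigma> 1 = i" using ex_inj_swap[OF i]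
      by blast
  \<comment> \<open>Only part \<open>i\<close>, relabelled as part \<open>1\<close>, is enlarged, by
    the prescribed ends of the first edge. Their non-neighbour bounds are needed for the other parts
    only.\<close>
  define V where "V j = S (\<sigma> j) \<union> (if j = 1 then {x, y} else {})" for j
  define \<psi>0 where "\<psi>0 v = (if v = (1, 1) then x else y)" for v :: "nat \<times> nat"
  have ne: "x \<noteq> y" using xy by (simp add: adj_def)
  have one: "1 \<in> {1..l}" using r by auto
  have sne: "\<sigma> a \<noteq> \<sigma> b" if "a \<in> {1..l}" "b \<in> {1..l}" "a \<noteq> b" for a b
    using inj_on_eq_iff[OF \<sigma>(1)] that by simp
  have sl: "\<sigma> a \<in> {1..l}" if "a \<in> {1..l}" for a using \<sigma>(2) that by blast
  have S': "finite (S (\<sigma> a)) \<and> S (\<sigma> a) \<subseteq> V a \<and> real (l * t) * (\<beta> + 1) +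
      real (card ({} :: nat set)) < real (card (S (\<sigma> a)))"
    if a: "a \<in> {1..l}" for a
    using S[OF sl[OF a]] W by (auto simp: V_def dest: finite_subset)
  have miss': "real (card {z \<in> S (\<sigma> b). \<not> adj v z}) \<le> \<beta>"
    if ab: "a \<in> {1..l}" "b \<in> {1..l}" "a \<noteq> b" "v \<in> V a" for a b v
  proof (cases "v \<in> S (\<sigma> a)")
    case True
    then show ?thesis using miss[OF sl[OF ab(1)] sl[OF ab(2)] sne[OF ab(1-3)]] by simp
  next
    case False
    then have v: "a = 1" "v = x \<or> v = y" using ab(4) by (auto simp: V_def split: if_splits)
    have "\<sigma> b \<noteq> i" using sne[OF ab(2) one] ab(3) v \<sigma>(3) by auto
    then show ?thesis using v missx[OF sl[OF ab(2)]] missy[OF sl[OF ab(2)]] by auto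
  qed
  have P: "inj_on \<psi>0 first_edge" "\<And>v. v \<in> first_edge \<Longrightarrow> \<psi>0 v \<in> V (fst v)"
    "\<And>v w. v \<in> first_edge \<Longrightarrow> w \<in> first_edge \<Longrightarrow> fst v \<noteq> fst w \<Longrightarrow> adj (\<psi>0 v) (\<psi>0 w)"
    using ne by (auto simp: \<psi>0_def V_def inj_on_def)
  have "\<exists>\<psi>. (\<forall>v\<in>first_edge. \<psi> v = \<psi>0 v) \<and> inj_on \<psi> verts \<and> (\<forall>v\<in>verts. \<psi> v \<in> V (fst v)) \<and>
    (\<forall>v\<in>verts. \<forall>w\<in>verts. fst v \<noteq> fst w \<longrightarrow> adj (\<psi> v) (\<psi> w)) \<and> (\<forall>v\<in>verts - first_edge. \<psi> v \<in> S (\<sigma> (fst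
        v)) - {})"
    by (rule extend_multipartite_embedding[where \<beta> = \<beta>])
       (fact symp_adj \<beta> S' miss' first_edge_q(1) P finite.emptyI)+
  then obtain \<psi> where \<psi>0: "(\<forall>v\<in>first_edge. \<psi> v = \<psi>0 v) \<and> inj_on \<psi> verts \<and>
      (\<forall>v\<in>verts. \<psi> v \<in> V (fst v)) \<and>
    (\<forall>v\<in>verts. \<forall>w\<in>verts. fst v \<noteq> fst w \<longrightarrow> adj (\<psi> v) (\<psi> w)) \<and> (\<forall>v\<in>verts - first_edge. \<psi> v \<in> S (\<sigma> (fst
        v)) - {})"
    ..
  then have \<psi>: "\<And>v. v \<in> first_edge \<Longrightarrow> \<psi> v = \<psi>0 v" "inj_on \<psi> verts"
    "\<And>v. v \<in> verts \<Longrightarrow> \<psi> v \<in> V (fst v)"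
    "\<And>v w. v \<in> verts \<Longrightarrow> w \<in> verts \<Longrightarrow> fst v \<noteq> fst w \<Longrightarrow> adj (\<psi> v) (\<psi> w)" by blast+
  have VW: "V j \<subseteq> W" if "j \<in> {1..l}" for j
    using S[OF sl[OF that]] adj_in_W[OF xy] by (simp add: V_def)
  have inW: "\<psi> ` verts \<subseteq> W"
  proof
    fix z assume "z \<in> \<psi> ` verts"
    then obtain v where v: "z = \<psi> v" "v \<in> verts" by (rule imageE)
    then have "fst v \<in> {1..l}" by (auto simp: part_verts_def)
    then show "z \<in> W" using VW \<psi>(3)[OF v(2)] v(1) by blast
  qed
  have px: "\<psi> (1, 1) = x" "\<psi> (1, 2) = y" using \<psi>(1) by (auto simp: \<psi>0_def)
  have cv: "card (\<psi> ` verts) = l * t" using \<psi>(2) by (simp add: card_image)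
  have cq: "card (\<psi> ` q) = 2" using \<psi>(2) first_edge_q(2,5) by (metis card_image inj_on_subset)
  have r2: "l * t + r * 2 \<le> card W" using large by (simp add: avoid_bound_def)
  obtain eq where eq: "eq \<in> rsets r W" "\<psi> ` q \<subseteq> eq" "eq \<inter> \<psi> ` verts \<subseteq> \<psi> ` q"
    by (rule extend_to_rset[OF W, of "\<psi> ` q" r "\<psi> ` verts"])
       (use inW first_edge_q(2) cq r r2 cv in auto)
  have fe: "finite eq" "card eq = r" using eq W by (auto simp: rsets_def dest: finite_subset)
  have "card (\<psi> ` verts \<union> eq) \<le> avoid_bound"
    using card_Un_le[of "\<psi> ` verts" eq] cv fe by (simp add: avoid_bound_def)
  then obtain ep where ep: "ep \<in> G" "x \<in> ep" "y \<in> ep" "ep \<inter> (\<psi> ` verts \<union> eq) \<subseteq> {x, y}"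
      "\<chi> ep \<notin> {\<chi> eq}"
    using adj_extend[OF xy, of "\<psi> ` verts \<union> eq" "{\<chi> eq}"] fe by auto
  have fx: "\<psi> ` first_edge = {x, y}" using px by auto
  have xv: "{x, y} \<subseteq> \<psi> ` verts" using first_edge_q(1) fx by blast
  have "\<chi> ep = \<chi> eq"
  proof (rule completion[OF \<psi>(2) inW \<psi>(4)])
    show "ep \<in> rsets r W" using ep G(1) by blast
    show "ep \<inter> \<psi> ` verts = \<psi> ` first_edge" using ep xv unfolding fx by blast
    show "eq \<inter> \<psi> ` verts = \<psi> ` q" using eq first_edge_q(2) by blast
    show "ep \<inter> eq \<subseteq> \<psi> ` verts" using ep(4) xv by blast
  qed (use eq in auto)
  then show False using ep by simp
qed

end

section \<open>Edges with two vertices in one part\<close>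

lemma ex_two_diff_of_card_less:
  assumes "finite X" "card X + 1 < card A"
  obtains a b where "a \<in> A" "b \<in> A" "a \<noteq> b" "a \<notin> X" "b \<notin> X"
proof -
  have "card X < card A" using assms(2) by simp
  then obtain a where a: "a \<in> A" "a \<notin> X" using ex_diff_of_card_less[OF assms(1)] by blast
  have "card (insert a X) < card A" using a assms by simp
  then obtain b where "b \<in> A" "b \<notin> insert a X" using ex_diff_of_card_less[of
      "insert a X" A] assms(1) by blast
  then show ?thesis using a by (intro that[of a b]) auto
qed

context rainbow_free
begin

text \<open>An embedding into a core places a few prescribed vertices in the sets \<open>V i\<close>
    and all others in the
  sets \<open>U i\<close>; the margin \<open>8 * r\<close> leaves room to avoid the vertices of a few \<open>r\<close>-sets.\<close>

definition core :: "(nat \<Rightarrow> nat set) \<Rightarrow> (nat \<Rightarrow> nat set) \<Rightarrow> real \<Rightarrow> bool" where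
  "core U V \<beta> \<longleftrightarrow> 0 \<le> \<beta> \<and>
     (\<forall>i\<in>{1..l}. U i \<subseteq> V i \<and> V i \<subseteq> W \<and> real (l * t) * (\<beta> + 1) + real (8 * r) < real (card (U i))) \<and>
     (\<forall>i\<in>{1..l}. \<forall>j\<in>{1..l}. i \<noteq> j \<longrightarrow> (\<forall>x\<in>V i. real (card {y \<in> U j. \<not> adj x y}) \<le> \<beta>))"

lemma coreD:
  assumes "core U V \<beta>"
  shows "0 \<le> \<beta>"
    and "i \<in> {1..l} \<Longrightarrow> U i \<subseteq> V i" "i \<in> {1..l} \<Longrightarrow> V i \<subseteq> W" "i \<in> {1..l} \<Longrightarrow> finite (U i)"
    and "i \<in> {1..l} \<Longrightarrow> real (l * t) * (\<beta> + 1) + real (8 * r) < real (card (U i))"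
    and "i \<in> {1..l} \<Longrightarrow> j \<in> {1..l} \<Longrightarrow> i \<noteq> j \<Longrightarrow> x \<in> V i \<Longrightarrow> real (card {y \<in> U j. \<not> adj x y}) \<le> \<beta>"
proof -
  show "i \<in> {1..l} \<Longrightarrow> finite (U i)"
    using assms W unfolding core_def by (meson finite_subset)
qed (use assms in \<open>auto simp: core_def\<close>)

lemma core_card_U:
  assumes "core U V \<beta>" "i \<in> {1..l}"
  shows "16 * (\<beta> + 1) + 8 * real r < real (card (U i))" "8 * r < card (U i)" "8 * r \<le> card W"
proof -
  have "4 * 4 \<le> l * t" using r t by (intro mult_mono) auto
  then have "16 \<le> real (l * t)"
      by (metis numeral_times_numeral of_nat_le_iff of_nat_numeral semiring_norm(12)
      semiring_norm(13) semiring_norm(11))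
  then have "16 * (\<beta> + 1) \<le> real (l * t) * (\<beta> + 1)" using coreD(1)[OF assms(1)]
      by (intro mult_right_mono) auto
  then show 1: "16 * (\<beta> + 1) + 8 * real r < real (card (U i))" using coreD(5)[OF assms] by simp
  then have "real (8 * r) < real (card (U i))" using coreD(1)[OF assms(1)] by simp
  then show 2: "8 * r < card (U i)" by (simp only: of_nat_less_iff)
  have "U i \<subseteq> W" using coreD(2,3)[OF assms] by blast
  from card_mono[OF W this] show "8 * r \<le> card W" using 2 by linarith
qed

text \<open>The ends of both extra edges are placed by hand in the sets \<open>V i\<close>, and the
  remaining vertices of \<open>K\<^sub>l[t]\<close> greedily in the sets \<open>U i\<close>, away
  from \<open>e\<close> and \<open>f\<close>; then \<open>completion\<close> applies. Greedy choice
  cannot supply adjacency among the prescribed vertices, so it is assumed wherever they lie in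
  different parts.\<close>

lemma forced:
  assumes c: "core U V \<beta>" and \<sigma>: "inj_on \<sigma> {1..l}" "\<sigma> ` {1..l} \<subseteq> {1..l}"
    and P: "inj_on \<psi>0 (first_edge \<union> q)" "\<And>x. x \<in> first_edge \<union> q \<Longrightarrow> \<psi>0 x \<in> V (\<sigma> (fst x))"
      "\<And>x y. x \<in> first_edge \<union> q \<Longrightarrow> y \<in> first_edge \<union> q \<Longrightarrow> fst x \<noteq> fst y \<Longrightarrow> adj (\<psi>0 x) (\<psi>0 y)"
    and e: "e \<in> rsets r W" "e \<inter> \<psi>0 ` (first_edge \<union> q) = \<psi>0 ` first_edge"
    and f: "f \<in> rsets r W" "f \<inter> \<psi>0 ` (first_edge \<union> q) = \<psi>0 ` q"
    and ef: "e \<inter> f \<subseteq> \<psi>0 ` (first_edge \<union> q)"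
  shows "\<chi> e = \<chi> f"
proof -
  define P where "P = first_edge \<union> q"
  have Pv: "P \<subseteq> verts" using first_edge_q by (simp add: P_def)
  have sl: "\<sigma> a \<in> {1..l}" if "a \<in> {1..l}" for a using \<sigma>(2) that by blast
  have sne: "\<sigma> a \<noteq> \<sigma> b" if "a \<in> {1..l}" "b \<in> {1..l}" "a \<noteq> b" for a b
    using inj_on_eq_iff[OF \<sigma>(1)] that by simp
  let ?Z = "e \<union> f"
  have fin: "finite e" "finite f" "card e = r" "card f = r"
    using e(1) f(1) W by (auto simp: rsets_def dest: finite_subset)
  have Z: "finite ?Z" "card ?Z \<le> 2 * r" using fin card_Un_le[of e f] by auto
  have S': "finite (U (\<sigma> a)) \<and> U (\<sigma> a) \<subseteq> V (\<sigma> a) \<and> real (l * t) * (\<beta> + 1) + real (card ?Z) <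
      real (card (U (\<sigma> a)))"
    if "a \<in> {1..l}" for a
  proof -
    have "real (card ?Z) \<le> real (8 * r)" using Z(2) by simp
    then show ?thesis using coreD(2,4,5)[OF c sl[OF that]] by simp
  qed
  have miss': "real (card {z \<in> U (\<sigma> b). \<not> adj v z}) \<le> \<beta>"
    if "a \<in> {1..l}" "b \<in> {1..l}" "a \<noteq> b" "v \<in> V (\<sigma> a)" for a b v
    using coreD(6)[OF c sl[OF that(1)] sl[OF that(2)] sne[OF that(1-3)] that(4)] .
  have "\<exists>\<psi>. (\<forall>v\<in>P. \<psi> v = \<psi>0 v) \<and> inj_on \<psi> verts \<and> (\<forall>v\<in>verts. \<psi> v \<in> V (\<sigma> (fst v))) \<and>
    (\<forall>v\<in>verts. \<forall>w\<in>verts. fst v \<noteq> fst w \<longrightarrow> adj (\<psi> v) (\<psi> w)) \<and> (\<forall>v\<in>verts - P. \<psi> v \<in> U (\<sigma> (fst v)) -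
        ?Z)"
    by (rule extend_multipartite_embedding[where \<beta> = \<beta> and V = "\<lambda>i. V (\<sigma> i)" and S = "\<lambda>i. U (\<sigma> i)"])
       (fact symp_adj coreD(1)[OF c] S' miss' Pv P[folded P_def] Z(1))+
  then obtain \<psi> where \<psi>0: "(\<forall>v\<in>P. \<psi> v = \<psi>0 v) \<and> inj_on \<psi> verts \<and> (\<forall>v\<in>verts. \<psi> v \<in> V (\<sigma> (fst v))) \<and>
    (\<forall>v\<in>verts. \<forall>w\<in>verts. fst v \<noteq> fst w \<longrightarrow> adj (\<psi> v) (\<psi> w)) \<and> (\<forall>v\<in>verts - P. \<psi> v \<in> U (\<sigma> (fst v)) -
        ?Z)"
    ..
  then have \<psi>: "\<And>v. v \<in> P \<Longrightarrow> \<psi> v = \<psi>0 v" "inj_on \<psi> verts" "\<And>v. v \<in> verts \<Longrightarrow> \<psi> v \<in> V (\<sigma> (fst v))"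
    "\<And>v w. v \<in> verts \<Longrightarrow> w \<in> verts \<Longrightarrow> fst v \<noteq> fst w \<Longrightarrow> adj (\<psi> v) (\<psi> w)"
    "\<And>v. v \<in> verts - P \<Longrightarrow> \<psi> v \<notin> ?Z" by blast+
  have inW: "\<psi> ` verts \<subseteq> W"
  proof
    fix z assume "z \<in> \<psi> ` verts"
    then obtain v where v: "z = \<psi> v" "v \<in> verts" by (rule imageE)
    then have "\<sigma> (fst v) \<in> {1..l}" using sl by (auto simp: part_verts_def)
    then show "z \<in> W" using coreD(3)[OF c] \<psi>(3)[OF v(2)] v(1) by blast
  qed
  have im: "\<psi> ` Q = \<psi>0 ` Q" if "Q \<subseteq> P" for Q using \<psi>(1) that by (intro image_cong) auto
  have split: "\<psi> ` verts = \<psi>0 ` P \<union> \<psi> ` (verts - P)" using im[of P] Pv by blast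
  have out: "?Z \<inter> \<psi> ` verts = ?Z \<inter> \<psi>0 ` P" unfolding split using \<psi>(5) by blast
  note e' = e(2)[folded P_def] and f' = f(2)[folded P_def] and ef' = ef[folded P_def]
  show ?thesis
  proof (rule completion[OF \<psi>(2) inW \<psi>(4) e(1) _ f(1)])
    have "e \<inter> \<psi> ` verts = e \<inter> \<psi>0 ` P" "f \<inter> \<psi> ` verts = f \<inter> \<psi>0 ` P" using out by blast+
    moreover have "first_edge \<subseteq> P" "q \<subseteq> P" unfolding P_def by blast+
    ultimately show "e \<inter> \<psi> ` verts = \<psi> ` first_edge" "f \<inter> \<psi> ` verts = \<psi> ` q"
      using e' f' im by metis+
    show "e \<inter> f \<subseteq> \<psi> ` verts" using ef' split by blast
  qed
qed

text \<open>The path \<open>u\<close>, \<open>v\<close>, \<open>w\<close> lies in part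
  \<open>i\<close>, so the two \<open>r\<close>-sets must meet exactly in its middle vertex
  \<open>v\<close>.\<close>

lemma forced_alpha:
  assumes q: "q = {(1, 2), (1, 3)}" and c: "core U V \<beta>" and i: "i \<in> {1..l}"
    and e: "e \<in> rsets r W" "u \<in> e" "v \<in> e" "u \<noteq> v" "u \<in> V i" "v \<in> V i"
    and f: "f \<in> rsets r W" "w \<in> f" "w \<in> V i" "e \<inter> f = {v}" "w \<noteq> v"
  shows "\<chi> e = \<chi> f"
proof -
  obtain \<sigma> where \<sigma>: "inj_on \<sigma> {1..l}" "\<sigma> ` {1..l} \<subseteq> {1..l}" "\<sigma> 1 = i" using ex_inj_swap[OF i]
      by blast
  have w: "w \<notin> e" "u \<notin> f" "v \<in> f" "u \<noteq> w" using e f by blast+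
  define \<psi>0 where "\<psi>0 x = (if x = (1, 1) then u else if x = (1, 2) then v else w)"
      for x :: "nat \<times> nat"
  have P: "first_edge \<union> q = {(1, 1), (1, 2), (1, 3)}" using q by auto
  have im: "\<psi>0 ` (first_edge \<union> q) = {u, v, w}" "\<psi>0 ` first_edge = {u, v}" "\<psi>0 ` q = {v, w}"
    unfolding P unfolding q by (auto simp: \<psi>0_def)
  show ?thesis
  proof (rule forced[OF c \<sigma>(1,2), of \<psi>0])
    show "inj_on \<psi>0 (first_edge \<union> q)" unfolding P using w e f by (simp add: \<psi>0_def)
    show "\<psi>0 x \<in> V (\<sigma> (fst x))" if "x \<in> first_edge \<union> q" for x
      using that unfolding P by (elim insertE emptyE) (use e f \<sigma>(3) in \<open>simp_all add: \<psi>0_def\<close>)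
    show "adj (\<psi>0 x) (\<psi>0 y)" if "x \<in> first_edge \<union> q" "y \<in> first_edge \<union> q" "fst x \<noteq> fst y" for x y
      using that unfolding P by (elim insertE emptyE) simp_all
  qed (unfold im, use e f w in auto)
qed

lemma forced_beta:
  assumes q: "q = {(1, 3), (1, 4)}" and c: "core U V \<beta>" and i: "i \<in> {1..l}"
    and e: "e \<in> rsets r W" "u \<in> e" "v \<in> e" "u \<noteq> v" "u \<in> V i" "v \<in> V i"
    and f: "f \<in> rsets r W" "x \<in> f" "y \<in> f" "x \<noteq> y" "x \<in> V i" "y \<in> V i" "e \<inter> f = {}"
  shows "\<chi> e = \<chi> f"
proof -
  obtain \<sigma> where \<sigma>: "inj_on \<sigma> {1..l}" "\<sigma> ` {1..l} \<subseteq> {1..l}" "\<sigma> 1 = i" using ex_inj_swap[OF i]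
      by blast
  have w: "x \<notin> e" "u \<notin> f" "v \<notin> f" "y \<notin> e" "u \<noteq> x" "u \<noteq> y" "v \<noteq> x" "v \<noteq> y" using e f by blast+
  define \<psi>0 where "\<psi>0 z = (if z = (1, 1) then u else if z = (1, 2) then v else if z =
      (1, 3) then x else y)"
    for z :: "nat \<times> nat"
  have P: "first_edge \<union> q = {(1, 1), (1, 2), (1, 3), (1, 4)}" using q by auto
  have im: "\<psi>0 ` (first_edge \<union> q) = {u, v, x, y}" "\<psi>0 ` first_edge = {u, v}" "\<psi>0 ` q = {x, y}"
    unfolding P unfolding q by (auto simp: \<psi>0_def)
  show ?thesis
  proof (rule forced[OF c \<sigma>(1,2), of \<psi>0])
    show "inj_on \<psi>0 (first_edge \<union> q)" unfolding P using w e f by (simp add: \<psi>0_def)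
    show "\<psi>0 z \<in> V (\<sigma> (fst z))" if "z \<in> first_edge \<union> q" for z
      using that unfolding P by (elim insertE emptyE) (use e f \<sigma>(3) in \<open>simp_all add: \<psi>0_def\<close>)
    show "adj (\<psi>0 a) (\<psi>0 b)" if "a \<in> first_edge \<union> q" "b \<in> first_edge \<union> q" "fst a \<noteq> fst b" for a b
      using that unfolding P by (elim insertE emptyE) simp_all
  qed (unfold im, use e f w in auto)
qed

text \<open>Here the four ends lie in two parts, so their adjacency across the parts has to be
  supplied; for the other two graphs they share a single part.\<close>

lemma forced_gamma:
  assumes q: "q = {(2, 1), (2, 2)}" and c: "core U V \<beta>" and i: "i \<in> {1..l}" "j \<in> {1..l}" "i \<noteq> j"
    and e: "e \<in> rsets r W" "u \<in> e" "v \<in> e" "u \<noteq> v" "u \<in> V i" "v \<in> V i"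
    and f: "f \<in> rsets r W" "x \<in> f" "y \<in> f" "x \<noteq> y" "x \<in> V j" "y \<in> V j" "e \<inter> f = {}"
    and a: "adj u x" "adj u y" "adj v x" "adj v y"
  shows "\<chi> e = \<chi> f"
proof -
  obtain \<sigma> where \<sigma>: "inj_on \<sigma> {1..l}" "\<sigma> ` {1..l} \<subseteq> {1..l}" "\<sigma> 1 = i" "\<sigma> 2 = j"
    using ex_inj_swap2[OF i] by blast
  have w: "x \<notin> e" "u \<notin> f" "v \<notin> f" "y \<notin> e" "u \<noteq> x" "u \<noteq> y" "v \<noteq> x" "v \<noteq> y" using e f by blast+
  have a': "adj x u" "adj y u" "adj x v" "adj y v" using a symp_adj by (auto dest: sympD)
  define \<psi>0 where "\<psi>0 z = (if z = (1, 1) then u else if z = (1, 2) then v else if z =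
      (2, 1) then x else y)"
    for z :: "nat \<times> nat"
  have P: "first_edge \<union> q = {(1, 1), (1, 2), (2, 1), (2, 2)}" using q by auto
  have im: "\<psi>0 ` (first_edge \<union> q) = {u, v, x, y}" "\<psi>0 ` first_edge = {u, v}" "\<psi>0 ` q = {x, y}"
    unfolding P unfolding q by (auto simp: \<psi>0_def)
  show ?thesis
  proof (rule forced[OF c \<sigma>(1,2), of \<psi>0])
    show "inj_on \<psi>0 (first_edge \<union> q)" unfolding P using w e f by (simp add: \<psi>0_def)
    show "\<psi>0 z \<in> V (\<sigma> (fst z))" if "z \<in> first_edge \<union> q" for z
      using that unfolding P by (elim insertE emptyE) (use e f \<sigma>(3,4) in \<open>simp_all add: \<psi>0_def\<close>)
    show "adj (\<psi>0 z) (\<psi>0 z')" if "z \<in> first_edge \<union> q" "z' \<in> first_edge \<union> q" "fst z \<noteq> fst z'"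
        for z z'
      using that unfolding P by (elim insertE emptyE) (use a a' in \<open>simp_all add: \<psi>0_def\<close>)
  qed (unfold im, use e f w in auto)
qed

text \<open>Both colours are forced onto a common fresh \<open>r\<close>-set; since it has to contain a pair for
  each of the two edges, this needs \<open>r \<ge> 4\<close>.\<close>

lemma non_transversal_same_color:
  assumes c: "core U V \<beta>"
    and e1: "e1 \<in> rsets r W" "i1 \<in> {1..l}" "u1 \<in> e1" "v1 \<in> e1" "u1 \<noteq> v1" "u1 \<in> V i1" "v1 \<in> V i1"
    and e2: "e2 \<in> rsets r W" "i2 \<in> {1..l}" "u2 \<in> e2" "v2 \<in> e2" "u2 \<noteq> v2" "u2 \<in> V i2" "v2 \<in> V i2"
  shows "\<chi> e1 = \<chi> e2"
proof -
  have inW: "U i \<subseteq> V i" "U i \<subseteq> W" if "i \<in> {1..l}" for i using coreD(2,3)[OF c that] by auto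
  note cU = core_card_U[OF c]
  have one: "1 \<in> {1..l}" "2 \<in> {1..l}" using r by auto
  have rs: "finite e \<and> card e = r \<and> e \<subseteq> W" if "e \<in> rsets r W" for e
    using that W by (auto simp: rsets_def dest: finite_subset)
  note r1 = rs[OF e1(1)] and r2 = rs[OF e2(1)]
  have cX: "card (e1 \<union> e2) \<le> 2 * r" "finite (e1 \<union> e2)" using card_Un_le[of e1 e2] r1 r2 by auto
  show ?thesis
  proof (rule q_cases)
    assume qa: "q = {(1, 2), (1, 3)}"
    \<comment> \<open>In the path case the two given pairs may lie in different parts, and the
      \<open>r\<close>-sets compared must meet in exactly one vertex. So each set is first replaced
      by one of the same colour that meets it in \<open>v\<close> alone, contains a further vertex
      \<open>w\<close> of the same part to complete a path, and carries a fresh pair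
      \<open>x\<close>, \<open>y\<close> in part \<open>1\<close>.\<close>
    have "\<exists>f x y. f \<in> rsets r W \<and> x \<in> f \<and> y \<in> f \<and> x \<noteq> y \<and> x \<in> U 1 \<and> y \<in> U 1 \<and> x \<notin> X \<and> y \<notin> X \<and>
        f \<inter> X \<subseteq> e \<and> \<chi> e = \<chi> f"
      if e: "e \<in> rsets r W" "i \<in> {1..l}" "u \<in> e" "v \<in> e" "u \<noteq> v" "u \<in> V i" "v \<in> V i"
        and X: "finite X" "card X \<le> 3 * r" "e \<subseteq> X" for e i u v X
    proof -
      have lt: "card X < card (U i)" "card (X) + 1 < card (U 1)"
        using X(2) cU(2)[OF e(2)] cU(2)[OF one(1)] r by linarith+
      obtain w where w: "w \<in> U i" "w \<notin> X" using ex_diff_of_card_less[OF X(1) lt(1)] by blast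
      obtain x y where xy: "x \<in> U 1" "y \<in> U 1" "x \<noteq> y" "x \<notin> X" "y \<notin> X"
        by (rule ex_two_diff_of_card_less[OF X(1) lt(2)])
      have sub: "{v, w, x, y} \<subseteq> W" using rs[OF e(1)] e(4) w xy inW(2) e(2) one by blast
      have c4: "card {v, w, x, y} \<le> r" using r(1) by (simp add: card_insert_if)
      have cW: "card X + r \<le> card W" using X(2) cU(3)[OF one(1)] by linarith
      obtain f where f: "f \<in> rsets r W" "{v, w, x, y} \<subseteq> f" "f \<inter> X \<subseteq> {v, w, x, y}"
        by (rule extend_to_rset[OF W sub c4 X(1) cW])
      have fX: "f \<inter> X \<subseteq> {v}" using f(3) w xy by blast
      have ef: "e \<inter> f = {v}" using fX f(2) e(4) X(3) by blast
      have wv: "w \<noteq> v" "w \<in> f" "w \<in> V i" using w e(4) X(3) f(2) inW(1)[OF e(2)] by auto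
      have "\<chi> e = \<chi> f" by (rule forced_alpha[OF qa c e(2) e(1) e(3-7) f(1) wv(2,3) ef wv(1)])
      moreover have "f \<inter> X \<subseteq> e" using fX e(4) by blast
      ultimately show ?thesis using f(1,2) xy by blast
    qed
    note replace = this
    obtain f1 x1 y1 where f1: "f1 \<in> rsets r W" "x1 \<in> f1" "y1 \<in> f1" "x1 \<noteq> y1" "x1 \<in> U 1" "y1 \<in> U 1"
      "x1 \<notin> e1 \<union> e2" "y1 \<notin> e1 \<union> e2" "\<chi> e1 = \<chi> f1"
      using replace[OF e1 cX(2)] cX(1) by force
    have X2: "finite (e2 \<union> f1)" "card (e2 \<union> f1) \<le> 3 * r"
      using card_Un_le[of e2 f1] r2 rs[OF f1(1)] by auto
    \<comment> \<open>\<open>f2\<close> meets \<open>f1\<close> only inside \<open>e2\<close>, hence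
      misses \<open>y1\<close>. This lets \<open>f3\<close> through \<open>y1\<close> and
      \<open>y2\<close> meet each of \<open>f1\<close> and \<open>f2\<close> in exactly one
      vertex.\<close>
    obtain f2 x2 y2 where f2: "f2 \<in> rsets r W" "x2 \<in> f2" "y2 \<in> f2" "x2 \<noteq> y2" "x2 \<in> U 1" "y2 \<in> U 1"
      "x2 \<notin> e2 \<union> f1" "y2 \<notin> e2 \<union> f1" "f2 \<inter> (e2 \<union> f1) \<subseteq> e2" "\<chi> e2 = \<chi> f2"
      using replace[OF e2 X2] by blast
    have y1: "y1 \<notin> f2" using f1(3,8) f2(9) by blast
    have X3: "finite (f1 \<union> f2)" "card (f1 \<union> f2) + r \<le> card W"
      using card_Un_le[of f1 f2] rs[OF f1(1)] rs[OF f2(1)] cU(3)[OF one(1)] by auto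
    have sub: "{y1, y2} \<subseteq> W" using f1(6) f2(6) inW(2)[OF one(1)] by blast
    have c4: "card {y1, y2} \<le> r" using r(1) by (simp add: card_insert_if)
    obtain f3 where f3: "f3 \<in> rsets r W" "{y1, y2} \<subseteq> f3" "f3 \<inter> (f1 \<union> f2) \<subseteq> {y1, y2}"
      by (rule extend_to_rset[OF W sub c4 X3])
    have i1: "f1 \<inter> f3 = {y1}" using f3 f2(8) f1(3) by blast
    have i2: "f2 \<inter> f3 = {y2}" using f3 y1 f2(3) by blast
    have V1: "x1 \<in> V 1" "y1 \<in> V 1" "x2 \<in> V 1" "y2 \<in> V 1"
      using f1 f2 inW(1)[OF one(1)] by blast+
    have ne: "y2 \<noteq> y1" "y1 \<in> f3" "y2 \<in> f3" using y1 f2(3) f3(2) by blast+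
    have "\<chi> f1 = \<chi> f3"
      by (rule forced_alpha[OF qa c one(1) f1(1-4) V1(1,2) f3(1) ne(3) V1(4) i1 ne(1)])
    moreover have "\<chi> f2 = \<chi> f3"
      by (rule forced_alpha[OF qa c one(1) f2(1-4) V1(3,4) f3(1) ne(2) V1(2) i2 ne(1)[symmetric]])
    ultimately show ?thesis using f1(9) f2(10) by simp
  next
    assume qb: "q = {(1, 3), (1, 4)}"
    have lt: "card (e1 \<union> e2) + 1 < card (U i1)" "card (e1 \<union> e2) + 1 < card (U i2)"
      using cX(1) cU(2)[OF e1(2)] cU(2)[OF e2(2)] r by linarith+
    obtain x1 y1 where x1: "x1 \<in> U i1" "y1 \<in> U i1" "x1 \<noteq> y1" "x1 \<notin> e1 \<union> e2" "y1 \<notin> e1 \<union> e2"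
      by (rule ex_two_diff_of_card_less[OF cX(2) lt(1)])
    obtain x2 y2 where x2: "x2 \<in> U i2" "y2 \<in> U i2" "x2 \<noteq> y2" "x2 \<notin> e1 \<union> e2" "y2 \<notin> e1 \<union> e2"
      by (rule ex_two_diff_of_card_less[OF cX(2) lt(2)])
    have sub: "{x1, y1, x2, y2} \<subseteq> W" using x1 x2 inW(2) e1(2) e2(2) by blast
    have c4: "card {x1, y1, x2, y2} \<le> r" using r(1) by (simp add: card_insert_if)
    have cW: "card (e1 \<union> e2) + r \<le> card W" using cX(1) cU(3)[OF one(1)] by linarith
    obtain f where f: "f \<in> rsets r W" "{x1, y1, x2, y2} \<subseteq> f" "f \<inter> (e1 \<union> e2) \<subseteq> {x1, y1, x2, y2}"
      by (rule extend_to_rset[OF W sub c4 cX(2) cW])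
    have d: "e1 \<inter> f = {}" "e2 \<inter> f = {}" using f(3) x1 x2 by blast+
    have m: "x1 \<in> f" "y1 \<in> f" "x2 \<in> f" "y2 \<in> f" "x1 \<in> V i1" "y1 \<in> V i1" "x2 \<in> V i2" "y2 \<in> V i2"
      using f(2) x1 x2 inW(1)[OF e1(2)] inW(1)[OF e2(2)] by auto
    have "\<chi> e1 = \<chi> f"
      by (rule forced_beta[OF qb c e1(2) e1(1) e1(3-7) f(1) m(1,2) x1(3) m(5,6) d(1)])
    moreover have "\<chi> e2 = \<chi> f"
      by (rule forced_beta[OF qb c e2(2) e2(1) e2(3-7) f(1) m(3,4) x2(3) m(7,8) d(2)])
    ultimately show ?thesis by simp
  next
    assume qc: "q = {(2, 1), (2, 2)}"
    have pick: "\<exists>j x y. j \<in> {1..l} \<and> i \<noteq> j \<and> x \<in> U j \<and> y \<in> U j \<and> x \<noteq> y \<and> x \<notin> e1 \<union> e2 \<and> y \<notin> e1 \<union> e2 \<and>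
      adj u x \<and> adj u y \<and> adj v x \<and> adj v y" if i: "i \<in> {1..l}" and u: "u \<in> V i" and v: "v \<in> V i"
          for i u v
    proof -
      \<comment> \<open>Any part other than \<open>i\<close> would do. The new pair avoids
        \<open>e1\<close>, \<open>e2\<close> and the non-neighbours of \<open>u\<close> and
        \<open>v\<close>, of which there are at most \<open>2 * \<beta>\<close> in
        \<open>U j\<close>.\<close>
      define j where "j = (if i = 1 then 2 else 1 :: nat)"
      have j: "j \<in> {1..l}" "i \<noteq> j" using one by (auto simp: j_def)
      let ?B = "\<lambda>u. {y \<in> U j. \<not> adj u y}"
      let ?X = "(e1 \<union> e2) \<union> (?B u \<union> ?B v)"
      have fin: "finite ?X" using cX(2) coreD(4)[OF c j(1)] by simp
      have "card ?X \<le> card (e1 \<union> e2) + (card (?B u) + card (?B v))"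
        by (rule order_trans[OF card_Un_le]) (simp add: card_Un_le)
      then have s1: "real (card ?X) \<le> real (card (e1 \<union> e2)) + (real (card (?B u)) +
          real (card (?B v)))"
        by (simp only: of_nat_le_iff flip: of_nat_add)
      have s2: "real (card (e1 \<union> e2)) \<le> 2 * real r" using cX(1) by simp
      have gen: "a + 1 < k" if "a \<le> b + (c + d)" "b \<le> 2 * real r" "c \<le> \<beta>" "d \<le> \<beta>"
        "16 * (\<beta> + 1) + 8 * real r < k" "0 \<le> \<beta>" for a b c d k :: real
        using that of_nat_0_le_iff[of r, where ?'a = real] by argo
      have "real (card ?X) + 1 < real (card (U j))"
        by (rule gen[OF s1 s2 coreD(6)[OF c i j(1,2) u] coreD(6)[OF c i j(1,2) v] cU(1)[OF j(1)]
            coreD(1)[OF c]])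
      then have lt: "card ?X + 1 < card (U j)" by linarith
      obtain x y where "x \<in> U j" "y \<in> U j" "x \<noteq> y" "x \<notin> ?X" "y \<notin> ?X"
        by (rule ex_two_diff_of_card_less[OF fin lt])
      then show ?thesis using j by blast
    qed
    obtain j1 x1 y1 where x1: "j1 \<in> {1..l}" "i1 \<noteq> j1" "x1 \<in> U j1" "y1 \<in> U j1" "x1 \<noteq> y1"
        "x1 \<notin> e1 \<union> e2" "y1 \<notin> e1 \<union> e2"
      "adj u1 x1" "adj u1 y1" "adj v1 x1" "adj v1 y1" using pick[OF e1(2,6,7)] by blast
    obtain j2 x2 y2 where x2: "j2 \<in> {1..l}" "i2 \<noteq> j2" "x2 \<in> U j2" "y2 \<in> U j2" "x2 \<noteq> y2"
        "x2 \<notin> e1 \<union> e2" "y2 \<notin> e1 \<union> e2"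
      "adj u2 x2" "adj u2 y2" "adj v2 x2" "adj v2 y2" using pick[OF e2(2,6,7)] by blast
    have sub: "{x1, y1, x2, y2} \<subseteq> W" using x1 x2 inW(2) by blast
    have c4: "card {x1, y1, x2, y2} \<le> r" using r(1) by (simp add: card_insert_if)
    have cW: "card (e1 \<union> e2) + r \<le> card W" using cX(1) cU(3)[OF one(1)] by linarith
    obtain f where f: "f \<in> rsets r W" "{x1, y1, x2, y2} \<subseteq> f" "f \<inter> (e1 \<union> e2) \<subseteq> {x1, y1, x2, y2}"
      by (rule extend_to_rset[OF W sub c4 cX(2) cW])
    have d: "e1 \<inter> f = {}" "e2 \<inter> f = {}" using f(3) x1(6,7) x2(6,7) by blast+
    have m: "x1 \<in> f" "y1 \<in> f" "x2 \<in> f" "y2 \<in> f" "x1 \<in> V j1" "y1 \<in> V j1" "x2 \<in> V j2" "y2 \<in> V j2"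
      using f(2) x1(3,4) x2(3,4) inW(1)[OF x1(1)] inW(1)[OF x2(1)] by auto
    have "\<chi> e1 = \<chi> f"
      by (rule forced_gamma[OF qc c e1(2) x1(1,2) e1(1) e1(3-7) f(1) m(1,2) x1(5) m(5,6) d(1)
          x1(8-11)])
    moreover have "\<chi> e2 = \<chi> f"
      by (rule forced_gamma[OF qc c e2(2) x2(1,2) e2(1) e2(3-7) f(1) m(3,4) x2(5) m(7,8) d(2)
          x2(8-11)])
    ultimately show ?thesis by simp
  qed
qed

section \<open>Structure of the codegree graph\<close>

abbreviation N :: real where "N \<equiv> real (card W)"

definition bad_edges :: "nat set set" where
  "bad_edges = {e \<in> G. \<exists>x\<in>e. \<exists>y\<in>e. x \<noteq> y \<and> \<not> adj x y}"

text \<open>There are at most \<open>card W ^ 2\<close> non-adjacent pairs, each in at most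
  \<open>codeg_factor * card W ^ (r - 3)\<close> edges. The result is one order below the trivial
  \<open>card W ^ r\<close>, which is what keeps the number of bad vertices bounded.\<close>

lemma card_bad_edges: "card bad_edges \<le> codeg_factor * card W ^ (r - 1)"
proof -
  let ?I = "{(u, v) \<in> W \<times> W. u \<noteq> v \<and> \<not> adj u v}"
  let ?E = "\<lambda>(u, v). {e \<in> G. u \<in> e \<and> v \<in> e}"
  have fin: "finite ?I" by (rule finite_subset[of _ "W \<times> W"]) (use W in auto)
  have "bad_edges \<subseteq> (\<Union>p\<in>?I. ?E p)" using G_edgeD by (fastforce simp: bad_edges_def)
  then have "card bad_edges \<le> card (\<Union>p\<in>?I. ?E p)"
    using fin finite_G by (intro card_mono) auto
  also have "\<dots> \<le> (\<Sum>p\<in>?I. card (?E p))" by (rule card_UN_le[OF fin])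
  also have "\<dots> \<le> (\<Sum>p\<in>?I. codeg_factor * card W ^ (r - 3))"
    by (rule sum_mono) (auto simp: adj_def)
  also have "\<dots> = card ?I * (codeg_factor * card W ^ (r - 3))" by simp
  also have "\<dots> \<le> card (W \<times> W) * (codeg_factor * card W ^ (r - 3))"
    using W by (intro mult_right_mono card_mono) auto
  also have "\<dots> = codeg_factor * (card W ^ 2 * card W ^ (r - 3))"
    by (simp add: card_cartesian_product power2_eq_square)
  also have "card W ^ 2 * card W ^ (r - 3) = card W ^ (r - 1)"
    using r unfolding power_add[symmetric] by (intro arg_cong[where f = "\<lambda>m. card W ^ m"]) simp
  finally show ?thesis .
qed

definition bad_verts :: "real \<Rightarrow> nat set" where
  "bad_verts \<epsilon> = {v \<in> W. \<epsilon> * N ^ (r - 1) < real (card {e \<in> bad_edges. v \<in> e})}"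

lemma finite_bad_edges: "finite bad_edges"
  using finite_G by (simp add: bad_edges_def)

text \<open>The degrees in \<open>bad_edges\<close> sum to at most
  \<open>r * codeg_factor * N ^ (r - 1)\<close>, and each bad vertex takes more than
  \<open>\<epsilon> * N ^ (r - 1)\<close> of this; the powers of \<open>N\<close> cancel.\<close>

lemma card_bad_verts:
  assumes "\<epsilon> > 0" "card W > 0"
  shows "real (card (bad_verts \<epsilon>)) \<le> real (r * codeg_factor) / \<epsilon>"
proof -
  have "(\<Sum>v\<in>W. card {e \<in> bad_edges. v \<in> e}) = (\<Sum>v\<in>W. \<Sum>e\<in>bad_edges. if v \<in> e then 1 else 0)"
    using finite_bad_edges by (simp add: sum.If_cases Int_def)
  also have "\<dots> = (\<Sum>e\<in>bad_edges. \<Sum>v\<in>W. if v \<in> e then 1 else 0)" by (rule sum.swap)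
  also have "\<dots> = (\<Sum>e\<in>bad_edges. r)"
  proof (rule sum.cong[OF refl])
    fix e assume "e \<in> bad_edges"
    then have "e \<subseteq> W" "card e = r" using G_edgeD by (auto simp: bad_edges_def)
    then show "(\<Sum>v\<in>W. if v \<in> e then 1 else 0) = r"
      using W by (simp add: sum.If_cases Int_absorb1)
  qed
  also have "\<dots> \<le> r * (codeg_factor * card W ^ (r - 1))" using card_bad_edges by simp
  finally have "real (\<Sum>v\<in>W. card {e \<in> bad_edges. v \<in> e}) \<le> real (r * (codeg_factor * card W ^ (r -
      1)))"
    by (simp only: of_nat_le_iff)
  then have up: "(\<Sum>v\<in>W. real (card {e \<in> bad_edges. v \<in> e})) \<le> real (r * codeg_factor) * N ^ (r - 1)"
    by simp
  have "real (card (bad_verts \<epsilon>)) * (\<epsilon> * N ^ (r - 1)) = (\<Sum>v\<in>bad_verts \<epsilon>. \<epsilon> * N ^ (r - 1))" by simp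
  also have "\<dots> \<le> (\<Sum>v\<in>bad_verts \<epsilon>. real (card {e \<in> bad_edges. v \<in> e}))"
    by (rule sum_mono) (simp add: bad_verts_def)
  also have "\<dots> \<le> (\<Sum>v\<in>W. real (card {e \<in> bad_edges. v \<in> e}))"
    using W by (intro sum_mono2) (auto simp: bad_verts_def)
  finally have "(real (card (bad_verts \<epsilon>)) * \<epsilon>) * N ^ (r - 1) \<le>
      real (r * codeg_factor) * N ^ (r - 1)"
    using up by (simp only: mult.assoc)
  then have "real (card (bad_verts \<epsilon>)) * \<epsilon> \<le> real (r * codeg_factor)"
    using assms(2) by (subst (asm) mult_le_cancel_right_pos) auto
  then show ?thesis using assms(1) by (simp add: pos_le_divide_eq)
qed

text \<open>If the neighbourhood \<open>D\<close> of \<open>v\<close> had at most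
  \<open>x * N\<close> vertices, the edges at \<open>v\<close> that are not bad would give too many
  \<open>(r - 1)\<close>-cliques in \<open>D\<close>, by \<open>gap\<close>. Supersaturation with
  \<open>k = l - 1\<close> then yields a positive proportion of \<open>l\<close>-cliques in
  \<open>D\<close>, hence a blow-up; \<open>v\<close> is joined to all of it, so \<open>v\<close>
  and a vertex of the first side form the forbidden extra edge.\<close>

lemma typical_degree:
  assumes v: "v \<in> W - bad_verts \<epsilon>" and deg: "\<delta> * N ^ (r - 1) \<le> real (card {e \<in> G. v \<in> e})"
    and \<beta>: "0 \<le> \<beta>" "real (l - 1) * \<beta> < 1" and x: "x > 0"
    and gap: "turan_density_prod \<beta> (r - 1) * x ^ (r - 1) < fact (r - 1) * (\<delta> - \<epsilon>)"
    and c: "c \<le> turan_density_prod \<beta> l * x ^ l / fact l" and b: "blowup_at l (l * t + 1) c (card W)"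
    and large: "avoid_bound \<le> card W"
  shows "x * N < real (card {u \<in> W. adj v u})"
proof (rule ccontr)
  assume neg: "\<not> ?thesis"
  define D where "D = {u \<in> W. adj v u}"
  have D: "finite D" "D \<subseteq> W" "real (card D) \<le> x * N" using W neg by (auto simp: D_def)
  have N: "N > 0" using v W by (auto simp: card_gt_0_iff)
  have "{e \<in> G. v \<in> e} \<subseteq> {e \<in> G - bad_edges. v \<in> e} \<union> {e \<in> bad_edges. v \<in> e}" by blast
  then have "card {e \<in> G. v \<in> e} \<le> card ({e \<in> G - bad_edges. v \<in> e} \<union> {e \<in> bad_edges. v \<in> e})"
    using finite_G finite_bad_edges by (intro card_mono) auto
  also have "\<dots> \<le> card {e \<in> G - bad_edges. v \<in> e} + card {e \<in> bad_edges. v \<in> e}" by (rule card_Un_le)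
  finally have "real (card {e \<in> G. v \<in> e}) \<le> real (card {e \<in> G - bad_edges. v \<in> e}) +
      real (card {e \<in> bad_edges. v \<in> e})"
    by (simp only: of_nat_le_iff flip: of_nat_add)
  moreover have "real (card {e \<in> bad_edges. v \<in> e}) \<le> \<epsilon> * N ^ (r - 1)" using v
      by (auto simp: bad_verts_def)
  ultimately have 1: "(\<delta> - \<epsilon>) * N ^ (r - 1) \<le> real (card {e \<in> G - bad_edges. v \<in> e})"
    using deg by (simp add: algebra_simps)
  have "card {e \<in> G - bad_edges. v \<in> e} \<le> card (cliques adj D (r - 1))"
  proof (rule card_inj_on_le[where f = "\<lambda>e. e - {v}"])
    show "inj_on (\<lambda>e. e - {v}) {e \<in> G - bad_edges. v \<in> e}" by (auto simp: inj_on_def)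
    show "(\<lambda>e. e - {v}) ` {e \<in> G - bad_edges. v \<in> e} \<subseteq> cliques adj D (r - 1)"
    proof (rule image_subsetI)
      fix e assume e: "e \<in> {e \<in> G - bad_edges. v \<in> e}"
      then have e': "e \<subseteq> W" "card e = r" "finite e" using G_edgeD by auto
      have a: "adj x y" if "x \<in> e" "y \<in> e" "x \<noteq> y" for x y using e that
          by (auto simp: bad_edges_def)
      have "card (e - {v}) = r - 1" using e e' by simp
      moreover have "e - {v} \<subseteq> D" using a[of v] e e' by (auto simp: D_def)
      ultimately show "e - {v} \<in> cliques adj D (r - 1)" using a
          by (auto simp: cliques_def rsets_def)
    qed
  qed (use D in simp)
  then have 2: "(\<delta> - \<epsilon>) * N ^ (r - 1) \<le> real (card (cliques adj D (r - 1)))" using 1 by linarith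
  have "turan_density_prod \<beta> (r - 1) * (x * N) ^ (r - 1) = (turan_density_prod \<beta> (r - 1) * x ^ (r -
      1)) * N ^ (r - 1)"
    by (simp add: power_mult_distrib)
  also have "\<dots> < (fact (r - 1) * (\<delta> - \<epsilon>)) * N ^ (r - 1)"
    using gap N by (intro mult_strict_right_mono) auto
  also have "\<dots> = fact (r - 1) * ((\<delta> - \<epsilon>) * N ^ (r - 1))" by simp
  also have "\<dots> \<le> fact (r - 1) * real (card (cliques adj D (r - 1)))"
    using 2 by (intro mult_left_mono) auto
  finally have big: "turan_density_prod \<beta> (r - 1) * (x * N) ^ (r - 1) <
      fact (r - 1) * real (card (cliques adj D (r - 1)))" .
  have l: "Suc (l - 1) = l" using r by simp
  have "turan_density_prod \<beta> (Suc (l - 1)) * (x * N) ^ Suc (l - 1) \<le>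
      fact (Suc (l - 1)) * real (card (cliques adj D (Suc (l - 1))))"
    by (rule clique_supersaturation[OF D(1) symp_adj irreflp_adj D(3) _ \<beta> _ _ big]) (use r N x in
        auto)
  then have "turan_density_prod \<beta> l * x ^ l / fact l * N ^ l \<le> real (card (cliques adj D l))"
    unfolding l by (simp add: power_mult_distrib field_simps)
  moreover have "c * N ^ l \<le> turan_density_prod \<beta> l * x ^ l / fact l * N ^ l"
    using c by (intro mult_right_mono) auto
  ultimately have many: "c * N ^ l \<le> real (card (cliques adj D l))" by linarith
  \<comment> \<open>Sides of size \<open>l * t + 1\<close> suffice because no pair between them is
    missing, so \<open>\<beta> = 0\<close> below.\<close>
  obtain A where A: "\<And>i. i \<in> {1..l} \<Longrightarrow> A i \<subseteq> D \<and> card (A i) = l * t + 1"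
    "\<And>i j a b. i \<in> {1..l} \<Longrightarrow> j \<in> {1..l} \<Longrightarrow> i \<noteq> j \<Longrightarrow> a \<in> A i \<Longrightarrow> b \<in> A j \<Longrightarrow> adj a b"
    by (rule blowup_cliques[OF b _ W D(2) irreflp_adj many]) auto
  have one: "1 \<in> {1..l}" using r by auto
  have "A 1 \<noteq> {}" using A(1)[OF one] by (metis card.empty add_is_0 one_neq_zero)
  then obtain y where y: "y \<in> A 1" by blast
  have z: "{z \<in> A j. \<not> adj a z} = {}" if "i \<in> {1..l}" "j \<in> {1..l}" "i \<noteq> j" "a \<in> A i" for i j a
    using A(2)[OF that(1-4)] by blast
  have zv: "{z \<in> A j. \<not> adj v z} = {}" if "j \<in> {1..l}" for j using A(1)[OF that]
      by (auto simp: D_def)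
  show False
  proof (rule no_multipartite_plus_edge[where S = A and \<beta> = 0 and i = 1 and x = v
      and y = y, OF _ _ order_refl one])
    show "A j \<subseteq> W \<and> real (l * t) * (0 + 1) < real (card (A j))" if "j \<in> {1..l}" for j
      using A(1)[OF that] D(2) by auto
    show "real (card {y \<in> A j. \<not> adj a y}) \<le> 0" if "i \<in> {1..l}" "j \<in> {1..l}" "i \<noteq> j" "a \<in> A i"
        for i j a
      using z[OF that] by (simp only: card.empty of_nat_0 order_refl)
    show "adj v y" using y A(1)[OF one] by (auto simp: D_def)
    show "real (card {z \<in> A j. \<not> adj v z}) \<le> 0" if "j \<in> {1..l}" "j \<noteq> 1" for j
      using zv[OF that(1)] by (simp only: card.empty of_nat_0 order_refl)
    show "real (card {z \<in> A j. \<not> adj y z}) \<le> 0" if "j \<in> {1..l}" "j \<noteq> 1" for j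
      using z[OF one that(1) that(2)[symmetric] y] by (simp only: card.empty of_nat_0 order_refl)
  qed (rule large)
qed

text \<open>Discarding \<open>B\<close> and the non-neighbours of fewer than \<open>l\<close>
  vertices leaves at least \<open>N - N (l - 1) (1 / l + \<epsilon>) - N / (4 l) \<ge> N / (2
  l)\<close> vertices. So cliques outside \<open>B\<close> can be grown vertex by vertex, which
  gives a positive proportion of \<open>l\<close>-cliques.\<close>

lemma ex_large_blowup:
  assumes B: "B \<subseteq> W" "real (card B) \<le> N / (4 * real l)"
    and deg: "\<And>u. u \<in> W - B \<Longrightarrow> (1 - 1 / real l - \<epsilon>) * N \<le> real (card {w \<in> W. adj u w})"
    and \<epsilon>: "0 \<le> \<epsilon>" "\<epsilon> \<le> 1 / (4 * (real l)\<^sup>2)" and T: "T > 0"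
    and c: "c \<le> (1 / (2 * real l)) ^ l / fact l" and b: "blowup_at l T c (card W)"
  obtains A where "\<And>i. i \<in> {1..l} \<Longrightarrow> A i \<subseteq> W - B \<and> card (A i) = T"
    "\<And>i j a b. i \<in> {1..l} \<Longrightarrow> j \<in> {1..l} \<Longrightarrow> i \<noteq> j \<Longrightarrow> a \<in> A i \<Longrightarrow> b \<in> A j \<Longrightarrow> adj a b"
proof -
  define D where "D = W - B"
  have D: "finite D" "D \<subseteq> W" using W by (auto simp: D_def)
  have l0: "real l > 0" using r by simp
  have non: "real (card {w \<in> W. \<not> adj u w}) \<le> (1 / real l + \<epsilon>) * N" if "u \<in> D" for u
  proof -
    have "card {w \<in> W. adj u w} + card {w \<in> W. \<not> adj u w} = card W"
      using W by (subst card_Un_disjoint[symmetric]) (auto intro: arg_cong[where f = card])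
    then have "real (card {w \<in> W. adj u w}) + real (card {w \<in> W. \<not> adj u w}) = N" by linarith
    then show ?thesis using deg[of u] that by (simp add: D_def algebra_simps)
  qed
  have nb: "N / (2 * real l) \<le> real (card (common_nbrs adj D Z))"
      if Z: "Z \<in> cliques adj D s" "s < l" for Z s
  proof -
    note Z' = cliquesD[OF D(1) Z(1)]
    have "W \<subseteq> common_nbrs adj D Z \<union> (B \<union> (\<Union>z\<in>Z. {w \<in> W. \<not> adj z w}))"
      using symp_adj by (auto simp: common_nbrs_def D_def dest: sympD)
    then have "card W \<le> card (common_nbrs adj D Z \<union> (B \<union> (\<Union>z\<in>Z. {w \<in> W. \<not> adj z w})))"
      using D(1) W B(1) Z'(2) by (intro card_mono) (auto intro: finite_subset)
    also have "\<dots> \<le> card (common_nbrs adj D Z) + (card B + card (\<Union>z\<in>Z. {w \<in> W. \<not> adj z w}))"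
      by (rule order_trans[OF card_Un_le]) (simp add: card_Un_le)
    finally have "N \<le> real (card (common_nbrs adj D Z)) + (real (card B) +
        real (card (\<Union>z\<in>Z. {w \<in> W. \<not> adj z w})))"
      by (simp only: of_nat_le_iff flip: of_nat_add)
    moreover have "real (card (\<Union>z\<in>Z. {w \<in> W. \<not> adj z w})) \<le> real s * ((1 / real l + \<epsilon>) * N)"
    proof -
      have "real (card (\<Union>z\<in>Z. {w \<in> W. \<not> adj z w})) \<le> (\<Sum>z\<in>Z. real (card {w \<in> W. \<not> adj z w}))"
        using card_UN_le[OF Z'(2), of "\<lambda>z. {w \<in> W. \<not> adj z w}"]
            by (simp only: of_nat_le_iff flip: of_nat_sum)
      also have "\<dots> \<le> (\<Sum>z\<in>Z. (1 / real l + \<epsilon>) * N)" using non Z'(1) by (intro sum_mono) auto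
      finally show ?thesis using Z'(3) by simp
    qed
    moreover have "real s * ((1 / real l + \<epsilon>) * N) \<le> (real l - 1) * ((1 / real l + \<epsilon>) * N)"
      using Z(2) \<epsilon> l0 by (intro mult_right_mono) auto
    moreover have "(real l - 1) * ((1 / real l + \<epsilon>) * N) \<le> N - N / real l + N / (4 * real l)"
    proof -
      have "(real l - 1) * \<epsilon> \<le> real l * (1 / (4 * (real l)\<^sup>2))"
        using \<epsilon> l0 by (intro mult_mono) auto
      also have "\<dots> = 1 / (4 * real l)" using l0 by (simp add: power2_eq_square field_simps)
      finally have "(real l - 1) * \<epsilon> * N \<le> 1 / (4 * real l) * N" by (intro mult_right_mono) auto
      moreover have "(real l - 1) * ((1 / real l + \<epsilon>) * N) = (N - N / real l) +
          (real l - 1) * \<epsilon> * N"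
        using l0 by (simp add: field_simps)
      ultimately show ?thesis by simp
    qed
    ultimately have "N / real l - N / (4 * real l) - N / (4 * real l) \<le>
        real (card (common_nbrs adj D Z))"
      using B(2) by linarith
    moreover have "N / real l - N / (4 * real l) - N / (4 * real l) = N / (2 * real l)"
      using l0 by (simp add: field_simps)
    ultimately show ?thesis by simp
  qed
  have cnt: "(N / (2 * real l)) ^ s \<le> fact s * real (card (cliques adj D s))" if "s \<le> l" for s
    using that
  proof (induction s)
    case 0
    have "cliques adj D 0 = {{}}" using D(1) by (auto simp: cliques_def rsets_0)
    then show ?case by simp
  next
    case (Suc s)
    have "(N / (2 * real l)) ^ Suc s = (N / (2 * real l)) * (N / (2 * real l)) ^ s" by simp
    also have "\<dots> \<le> (N / (2 * real l)) * (fact s * real (card (cliques adj D s)))"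
      using Suc l0 by (intro mult_left_mono) auto
    also have "\<dots> = fact s * (\<Sum>Z\<in>cliques adj D s. N / (2 * real l))" by simp
    also have "\<dots> \<le> fact s * (\<Sum>Z\<in>cliques adj D s. real (card (common_nbrs adj D Z)))"
      using nb Suc.prems by (intro mult_left_mono sum_mono) auto
    also have "(\<Sum>Z\<in>cliques adj D s. real (card (common_nbrs adj D Z))) =
        real (Suc s * card (cliques adj D (Suc s)))"
      by (simp only: sum_card_common_nbrs[OF D(1) symp_adj irreflp_adj] flip: of_nat_sum)
    finally show ?case by (simp add: algebra_simps)
  qed
  have "c * N ^ l \<le> (1 / (2 * real l)) ^ l / fact l * N ^ l" using c by (intro mult_right_mono) auto
  also have "\<dots> = (N / (2 * real l)) ^ l / fact l" by (simp add: power_divide)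
  also have "\<dots> \<le> real (card (cliques adj D l))" using cnt[of l]
      by (simp add: divide_le_eq mult.commute)
  finally have many: "c * N ^ l \<le> real (card (cliques adj D l))" .
  show ?thesis
    by (rule blowup_cliques[OF b T W D(2) irreflp_adj many, unfolded D_def], rule that)
qed


text \<open>The blow-up \<open>A\<close> serves as a frame of reference. A vertex with more than
  \<open>l * t\<close> neighbours in every side would create the forbidden graph, so each vertex has
  few neighbours in some side \<open>p x\<close>; counting the edges between \<open>W\<close> and
  \<open>A\<close> from both ends shows that almost every vertex is joined to most of the other
  sides. Vertices with the same side are grouped, and an edge within a group would have enough
  common neighbours in the other sides to be forbidden. Independence and the degree bound then
  control the sizes.\<close>

lemma ex_independent_parts:
  assumes B: "B \<subseteq> W" "real (card B) \<le> \<epsilon> * N"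
    and deg: "\<And>u. u \<in> W - B \<Longrightarrow> (1 - 1 / real l - \<epsilon>) * N \<le> real (card {w \<in> W. adj u w})"
    and \<epsilon>: "0 < \<epsilon>" and T: "real (l * t) \<le> \<epsilon> * real T" "2 * (l * t) < T"
    and A: "\<And>i. i \<in> {1..l} \<Longrightarrow> A i \<subseteq> W - B \<and> card (A i) = T"
      "\<And>i j a b. i \<in> {1..l} \<Longrightarrow> j \<in> {1..l} \<Longrightarrow> i \<noteq> j \<Longrightarrow> a \<in> A i \<Longrightarrow> b \<in> A j \<Longrightarrow> adj a b"
    and large: "avoid_bound \<le> card W"
  defines "\<epsilon>' \<equiv> (5 * real l + 6) * \<epsilon>"
  obtains U where "\<And>i. i \<in> {1..l} \<Longrightarrow> U i \<subseteq> W" "disjoint_family_on U {1..l}"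
    "real (card (W - (\<Union>i\<in>{1..l}. U i))) \<le> \<epsilon>' * N"
    "\<And>i. i \<in> {1..l} \<Longrightarrow> real (card (U i)) \<le> (1 / real l + \<epsilon>') * N"
    "\<And>i. i \<in> {1..l} \<Longrightarrow> (1 / real l - \<epsilon>') * N \<le> real (card (U i))"
    "\<And>i j u. i \<in> {1..l} \<Longrightarrow> j \<in> {1..l} \<Longrightarrow> i \<noteq> j \<Longrightarrow> u \<in> U i \<Longrightarrow> real (card {y \<in> U j. \<not> adj u y}) \<le> \<epsilon>' * N"
proof -
  let ?I = "{1..l}"
  have l0: "real l > 0" "real l \<ge> 1" and one: "1 \<in> ?I" using r by auto
  have fA: "finite (A i)" "A i \<subseteq> W" "card (A i) = T" if "i \<in> ?I" for i
    using A(1)[OF that] W by (auto dest: finite_subset)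
  have T0: "T > 0" using T(2) by simp
  have empA: "{z \<in> A j. \<not> adj a z} = {}" if "i \<in> ?I" "j \<in> ?I" "i \<noteq> j" "a \<in> A i" for i j a
    using A(2)[OF that] by blast
  have ex: "\<exists>i\<in>?I. card {a \<in> A i. adj x a} \<le> l * t" if x: "x \<in> W" for x
  proof (rule ccontr)
    assume neg: "\<not> ?thesis"
    let ?S = "\<lambda>j. {a \<in> A j. adj x a}"
    have big: "l * t < card (?S j)" if "j \<in> ?I" for j using neg that by force
    then have "?S 1 \<noteq> {}" using one by (metis card.empty not_less_zero)
    then obtain y where y: "y \<in> A 1" "adj x y" by blast
    show False
    proof (rule no_multipartite_plus_edge[where S = ?S and \<beta> = 0 and i = 1 and x = x
        and y = y, OF _ _ order_refl one y(2)])
      show "?S j \<subseteq> W \<and> real (l * t) * (0 + 1) < real (card (?S j))" if "j \<in> ?I" for j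
        using big[OF that] fA(2)[OF that] by (auto simp del: of_nat_mult)
      show "real (card {z \<in> ?S j. \<not> adj a z}) \<le> 0" if "i \<in> ?I" "j \<in> ?I" "i \<noteq> j" "a \<in> ?S i" for i j a
      proof -
        have "{z \<in> ?S j. \<not> adj a z} = {}" using empA[OF that(1-3), of a] that(4) by blast
        then show ?thesis by (simp only: card.empty of_nat_0 order_refl)
      qed
      show "real (card {z \<in> ?S j. \<not> adj x z}) \<le> 0" for j
      proof -
        have "{z \<in> ?S j. \<not> adj x z} = {}" by blast
        then show ?thesis by (simp only: card.empty of_nat_0 order_refl)
      qed
      show "real (card {z \<in> ?S j. \<not> adj y z}) \<le> 0" if "j \<in> ?I" "j \<noteq> 1" for j
      proof -
        have "{z \<in> ?S j. \<not> adj y z} = {}" using empA[OF one that(1) that(2)[symmetric] y(1)]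
            by blast
        then show ?thesis by (simp only: card.empty of_nat_0 order_refl)
      qed
    qed (rule large)
  qed
  then obtain p where p: "\<And>x. x \<in> W \<Longrightarrow> p x \<in> ?I \<and> card {a \<in> A (p x). adj x a} \<le> l * t" by metis
  \<comment> \<open>The deficiency of \<open>x\<close> against the perfect \<open>l\<close>-partite
    pattern. The double count below bounds its sum by
    \<open>(l + 1) * \<epsilon> * T * N\<close>.\<close>
  define m where "m x = (\<Sum>j\<in>?I - {p x}. real (card {a \<in> A j. \<not> adj x a}))" for x
  have m0: "m x \<ge> 0" for x by (simp add: m_def sum_nonneg)
  have splitA: "real (card {a \<in> A j. adj x a}) = real T - real (card {a \<in> A j. \<not> adj x a})"
      if "j \<in> ?I" for j x
  proof -
    have "card {a \<in> A j. adj x a} + card {a \<in> A j. \<not> adj x a} = card (A j)"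
      using fA(1)[OF that]
          by (subst card_Un_disjoint[symmetric]) (auto intro: arg_cong[where f = card])
    then show ?thesis using fA(3)[OF that] by linarith
  qed
  have degA: "(\<Sum>j\<in>?I. real (card {a \<in> A j. adj x a})) \<le> real (l * t) + (real l - 1) * real T - m x"
      if x: "x \<in> W" for x
  proof -
    note px = p[OF x]
    have "(\<Sum>j\<in>?I. real (card {a \<in> A j. adj x a})) =
        real (card {a \<in> A (p x). adj x a}) + (\<Sum>j\<in>?I - {p x}. real (card {a \<in> A j. adj x a}))"
      using px by (subst sum.remove[of _ "p x"]) auto
    also have "(\<Sum>j\<in>?I - {p x}. real (card {a \<in> A j. adj x a})) =
        (\<Sum>j\<in>?I - {p x}. real T - real (card {a \<in> A j. \<not> adj x a}))"
      by (rule sum.cong[OF refl]) (rule splitA, simp)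
    also have "\<dots> = (real l - 1) * real T - m x"
      using px l0 by (simp add: sum_subtractf m_def card_Diff_singleton of_nat_diff)
    finally show ?thesis using px by (simp del: of_nat_mult)
  qed
  have "(\<Sum>x\<in>W. \<Sum>j\<in>?I. card {a \<in> A j. adj x a}) = (\<Sum>x\<in>W. \<Sum>j\<in>?I. \<Sum>a\<in>A j. if adj x a then 1 else 0)"
    using fA(1) by (intro sum.cong refl) (simp add: sum.If_cases Int_def)
  also have "\<dots> = (\<Sum>j\<in>?I. \<Sum>x\<in>W. \<Sum>a\<in>A j. if adj x a then 1 else 0)" by (rule sum.swap)
  also have "\<dots> = (\<Sum>j\<in>?I. \<Sum>a\<in>A j. \<Sum>x\<in>W. if adj x a then 1 else 0)"
    by (intro sum.cong[OF refl] sum.swap)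
  also have "\<dots> = (\<Sum>j\<in>?I. \<Sum>a\<in>A j. card {w \<in> W. adj a w})"
  proof (intro sum.cong refl)
    fix a
    have "{w \<in> W. adj a w} = {w \<in> W. adj w a}" using symp_adj by (auto dest: sympD)
    then show "(\<Sum>x\<in>W. if adj x a then 1 else 0) = card {w \<in> W. adj a w}"
      using W by (simp add: sum.If_cases Int_def)
  qed
  finally have swap: "real (\<Sum>x\<in>W. \<Sum>j\<in>?I. card {a \<in> A j. adj x a}) =
      real (\<Sum>j\<in>?I. \<Sum>a\<in>A j. card {w \<in> W. adj a w})"
    by (simp only:)
  have "real l * (real T * ((1 - 1 / real l - \<epsilon>) * N)) = (\<Sum>j\<in>?I. \<Sum>a\<in>A j. (1 - 1 / real l - \<epsilon>) * N)"
    using fA(3) by simp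
  also have "\<dots> \<le> (\<Sum>j\<in>?I. \<Sum>a\<in>A j. real (card {w \<in> W. adj a w}))"
    using A(1) by (intro sum_mono deg) blast
  also have "\<dots> = (\<Sum>x\<in>W. \<Sum>j\<in>?I. real (card {a \<in> A j. adj x a}))"
    using swap by simp
  also have "\<dots> \<le> (\<Sum>x\<in>W. real (l * t) + (real l - 1) * real T - m x)"
    by (rule sum_mono) (rule degA)
  also have "\<dots> = N * (real (l * t) + (real l - 1) * real T) - (\<Sum>x\<in>W. m x)"
    by (simp add: sum_subtractf)
  finally have "(\<Sum>x\<in>W. m x) \<le> N * (real (l * t) + (real l - 1) * real T) - real l * (real T * ((1 -
      1 / real l - \<epsilon>) * N))"
    by linarith
  also have "\<dots> = N * (real (l * t) + real l * real T * \<epsilon>)" using l0 by (simp add: field_simps)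
  also have "\<dots> \<le> N * (\<epsilon> * real T + real l * real T * \<epsilon>)" using T(1)
      by (intro mult_left_mono) (auto simp del: of_nat_mult)
  finally have summ: "(\<Sum>x\<in>W. m x) \<le> N * ((real l + 1) * \<epsilon> * real T)" by (simp add: algebra_simps)
  define H where "H = {x \<in> W. real T < 4 * m x}"
  have H: "real (card H) \<le> 4 * (real l + 1) * \<epsilon> * N"
  proof -
    have "real (card H) * (real T / 4) = (\<Sum>x\<in>H. real T / 4)" by simp
    also have "\<dots> \<le> (\<Sum>x\<in>H. m x)" by (rule sum_mono) (simp add: H_def)
    also have "\<dots> \<le> (\<Sum>x\<in>W. m x)" using W m0 by (intro sum_mono2) (auto simp: H_def)
    also note summ
    also have "N * ((real l + 1) * \<epsilon> * real T) = (4 * (real l + 1) * \<epsilon> * N) * (real T / 4)" by simp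
    finally show ?thesis using T0 by (subst (asm) mult_le_cancel_right_pos) auto
  qed
  \<comment> \<open>With deficiency at most \<open>T / 4\<close>, two vertices of \<open>U i\<close>
    share at least \<open>T / 2 > l * t\<close> neighbours in every other side.\<close>
  define U where "U i = {x \<in> W - B. p x = i \<and> 4 * m x \<le> real T}" for i
  have UW: "U i \<subseteq> W" "finite (U i)" for i using W by (auto simp: U_def)
  have mj: "4 * card {a \<in> A j. \<not> adj x a} \<le> T" if "x \<in> U i" "j \<in> ?I" "j \<noteq> i" for x i j
  proof -
    have "real (card {a \<in> A j. \<not> adj x a}) \<le> m x"
      unfolding m_def using that by (intro member_le_sum) (auto simp: U_def)
    moreover have "4 * m x \<le> real T" using that by (simp add: U_def)
    ultimately show ?thesis by linarith
  qed
  have indep: "\<not> adj x y" if i: "i \<in> ?I" and x: "x \<in> U i" and y: "y \<in> U i" for i x y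
  proof
    assume xy: "adj x y"
    \<comment> \<open>Side \<open>i\<close> is kept whole: it only has to be joined to the other
      sides, and \<open>x\<close>, \<open>y\<close> need no neighbours in it.\<close>
    let ?S = "\<lambda>j. if j = i then A j else {a \<in> A j. adj x a \<and> adj y a}"
    have SA: "?S j \<subseteq> A j" for j by auto
    show False
    proof (rule no_multipartite_plus_edge[where S = ?S and \<beta> = 0 and i = i and x = x
        and y = y, OF _ _ order_refl i xy])
      show "?S j \<subseteq> W \<and> real (l * t) * (0 + 1) < real (card (?S j))" if j: "j \<in> ?I" for j
      proof
        show "?S j \<subseteq> W" using SA fA(2)[OF j] by blast
        have "l * t < card (?S j)"
        proof (cases "j = i")
          case True
          then show ?thesis using fA(3)[OF j] T(2) by simp
        next
          case False
          have "card (A j) \<le> card ({a \<in> A j. adj x a \<and>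
              adj y a} \<union> ({a \<in> A j. \<not> adj x a} \<union> {a \<in> A j. \<not> adj y a}))"
            using fA(1)[OF j] by (intro card_mono) auto
          also have "\<dots> \<le> card {a \<in> A j. adj x a \<and>
              adj y a} + card ({a \<in> A j. \<not> adj x a} \<union> {a \<in> A j. \<not> adj y a})"
            by (rule card_Un_le)
          finally have "T \<le> card {a \<in> A j. adj x a \<and> adj y a} + (card {a \<in> A j. \<not> adj x a} +
              card {a \<in> A j. \<not> adj y a})"
            using fA(3)[OF j] card_Un_le[of "{a \<in> A j. \<not> adj x a}" "{a \<in> A j. \<not> adj y a}"]
                by linarith
          then show ?thesis using mj[OF x j False] mj[OF y j False] T(2) False by simp
        qed
        then show "real (l * t) * (0 + 1) < real (card (?S j))" by (simp del: of_nat_mult)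
      qed
      show "real (card {z \<in> ?S j. \<not> adj a z}) \<le> 0" if "k \<in> ?I" "j \<in> ?I" "k \<noteq> j" "a \<in> ?S k" for k j a
      proof -
        have "{z \<in> ?S j. \<not> adj a z} = {}" using empA[OF that(1-3), of a] that(4) SA by blast
        then show ?thesis by (simp only: card.empty of_nat_0 order_refl)
      qed
      show "real (card {z \<in> ?S j. \<not> adj x z}) \<le> 0" if "j \<in> ?I" "j \<noteq> i" for j
      proof -
        have "{z \<in> ?S j. \<not> adj x z} = {}" using that by auto
        then show ?thesis by (simp only: card.empty of_nat_0 order_refl)
      qed
      show "real (card {z \<in> ?S j. \<not> adj y z}) \<le> 0" if "j \<in> ?I" "j \<noteq> i" for j
      proof -
        have "{z \<in> ?S j. \<not> adj y z} = {}" using that by auto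
        then show ?thesis by (simp only: card.empty of_nat_0 order_refl)
      qed
    qed (rule large)
  qed
  have non: "real (card {w \<in> W. \<not> adj u w}) \<le> (1 / real l + \<epsilon>) * N" if "u \<in> W - B" for u
  proof -
    have "card {w \<in> W. adj u w} + card {w \<in> W. \<not> adj u w} = card W"
      using W by (subst card_Un_disjoint[symmetric]) (auto intro: arg_cong[where f = card])
    then have "real (card {w \<in> W. adj u w}) + real (card {w \<in> W. \<not> adj u w}) = N" by linarith
    then show ?thesis using deg[OF that] by (simp add: algebra_simps)
  qed
  have up: "real (card (U i)) \<le> (1 / real l + \<epsilon>) * N" if i: "i \<in> ?I" for i
  proof (cases "U i = {}")
    case True
    then show ?thesis using \<epsilon> by simp
  next
    case False
    then obtain u where u: "u \<in> U i" by blast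
    have "card (U i) \<le> card {w \<in> W. \<not> adj u w}"
      using indep[OF i u] UW W by (intro card_mono) auto
    then show ?thesis using non[of u] u by (auto simp: U_def)
  qed
  have disj: "disjoint_family_on U ?I" by (auto simp: disjoint_family_on_def U_def)
  let ?R = "W - (\<Union>i\<in>?I. U i)"
  have R: "real (card ?R) \<le> (4 * real l + 5) * \<epsilon> * N"
  proof -
    have "?R \<subseteq> B \<union> H" using p by (auto simp: U_def H_def not_le)
    then have "card ?R \<le> card (B \<union> H)" using W B(1)
        by (intro card_mono) (auto simp: H_def intro: finite_subset)
    also have "\<dots> \<le> card B + card H" by (rule card_Un_le)
    finally have "real (card ?R) \<le> real (card B) + real (card H)"
        by (simp only: of_nat_le_iff flip: of_nat_add)
    then show ?thesis using B(2) H by (simp add: algebra_simps)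
  qed
  have sumU: "N = real (card ?R) + (\<Sum>i\<in>?I. real (card (U i)))"
  proof -
    have "card W = card ?R + card (\<Union>i\<in>?I. U i)"
      using W UW by (subst card_Un_disjoint[symmetric]) (auto intro: arg_cong[where f = card])
    also have "card (\<Union>i\<in>?I. U i) = (\<Sum>i\<in>?I. card (U i))"
      using disj UW unfolding disjoint_family_on_def by (intro card_UN_disjoint) auto
    finally show ?thesis by simp
  qed
  have low: "(1 / real l - (5 * real l + 5) * \<epsilon>) * N \<le> real (card (U i))" if i: "i \<in> ?I" for i
  proof -
    have "(\<Sum>j\<in>?I. real (card (U j))) = real (card (U i)) + (\<Sum>j\<in>?I - {i}. real (card (U j)))"
      using i by (subst sum.remove[of _ i]) auto
    also have "(\<Sum>j\<in>?I - {i}. real (card (U j))) \<le> (\<Sum>j\<in>?I - {i}. (1 / real l + \<epsilon>) * N)"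
      by (rule sum_mono) (rule up, simp)
    also have "\<dots> = (real l - 1) * ((1 / real l + \<epsilon>) * N)"
      using i l0 by (simp add: card_Diff_singleton of_nat_diff)
    finally have "N \<le> (4 * real l + 5) * \<epsilon> * N + real (card (U i)) + (real l - 1) * ((1 / real l +
        \<epsilon>) * N)"
      using sumU R by linarith
    moreover have "(real l - 1) * ((1 / real l + \<epsilon>) * N) = N - N / real l + (real l - 1) * \<epsilon> * N"
      using l0 by (simp add: field_simps)
    ultimately have "N / real l - ((5 * real l + 4) * \<epsilon>) * N \<le> real (card (U i))"
      by (simp add: algebra_simps)
    moreover have "((5 * real l + 4) * \<epsilon>) * N \<le> ((5 * real l + 5) * \<epsilon>) * N"
      using \<epsilon> by (intro mult_right_mono) auto
    ultimately show ?thesis by (simp add: left_diff_distrib)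
  qed
  \<comment> \<open>\<open>U i\<close> already uses up nearly all the non-neighbours that
    \<open>u\<close> may have. The errors \<open>\<epsilon>\<close> in their number and
    \<open>(5 * l + 5) * \<epsilon>\<close> in the size of \<open>U i\<close> add up to
    \<open>\<epsilon>'\<close>.\<close>
  have miss: "real (card {y \<in> U j. \<not> adj u y}) \<le> \<epsilon>' * N"
    if i: "i \<in> ?I" "j \<in> ?I" "i \<noteq> j" "u \<in> U i" for i j u
  proof -
    have "U i \<inter> {y \<in> U j. \<not> adj u y} = {}" using disj i unfolding disjoint_family_on_def by blast
    then have "card (U i) + card {y \<in> U j. \<not> adj u y} = card (U i \<union> {y \<in> U j. \<not> adj u y})"
      using UW by (intro card_Un_disjoint[symmetric]) auto
    also have "\<dots> \<le> card {w \<in> W. \<not> adj u w}"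
      using indep[OF i(1) i(4)] UW W by (intro card_mono) auto
    finally have "real (card (U i)) + real (card {y \<in> U j. \<not> adj u y}) \<le>
        real (card {w \<in> W. \<not> adj u w})"
      by (simp only: of_nat_le_iff flip: of_nat_add)
    moreover have "real (card {w \<in> W. \<not> adj u w}) \<le> (1 / real l + \<epsilon>) * N" using i(4)
        by (intro non) (simp add: U_def)
    ultimately have "real (card {y \<in> U j. \<not> adj u y}) \<le> (1 / real l +
        \<epsilon>) * N - (1 / real l - (5 * real l + 5) * \<epsilon>) * N"
      using low[OF i(1)] by linarith
    also have "\<dots> = \<epsilon>' * N" by (simp add: \<epsilon>'_def algebra_simps)
    finally show ?thesis .
  qed
  have le: "(4 * real l + 5) * \<epsilon> * N \<le> \<epsilon>' * N" "(1 / real l + \<epsilon>) * N \<le> (1 / real l + \<epsilon>') * N"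
    "(1 / real l - \<epsilon>') * N \<le> (1 / real l - (5 * real l + 5) * \<epsilon>) * N"
    unfolding \<epsilon>'_def using \<epsilon> l0 by (auto intro!: mult_right_mono simp: algebra_simps)
  show ?thesis
  proof (rule that[of U])
    show "real (card ?R) \<le> \<epsilon>' * N" using R le(1) by linarith
    show "real (card (U i)) \<le> (1 / real l + \<epsilon>') * N" if "i \<in> ?I" for i using up[OF that] le(2)
        by linarith
    show "(1 / real l - \<epsilon>') * N \<le> real (card (U i))" if "i \<in> ?I" for i using low[OF that] le(3)
        by linarith
  qed (use UW disj miss in auto)
qed

end

lemma esym_real_le:
  fixes a :: real
  assumes "finite I" "\<And>i. i \<in> I \<Longrightarrow> real (x i) \<le> a" "0 \<le> a"
  shows "real (esym I x k) \<le> real (card I choose k) * a ^ k"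
proof -
  have "x i \<le> nat \<lfloor>a\<rfloor>" if "i \<in> I" for i using assms(2)[OF that] by linarith
  then have "esym I x k \<le> esym I (\<lambda>_. nat \<lfloor>a\<rfloor>) k" by (rule esym_mono)
  also have "\<dots> = (card I choose k) * nat \<lfloor>a\<rfloor> ^ k" by (rule esym_const[OF assms(1)])
  finally have "real (esym I x k) \<le> real (card I choose k) * real (nat \<lfloor>a\<rfloor>) ^ k"
    by (simp only: of_nat_le_iff flip: of_nat_mult of_nat_power)
  also have "\<dots> \<le> real (card I choose k) * a ^ k"
    using assms(3) by (intro mult_left_mono power_mono) auto
  finally show ?thesis .
qed

section \<open>Placing the atypical vertices and counting colours\<close>

context rainbow_free
begin

lemma card_edges_meeting:
  assumes "finite Y"
  shows "card {e \<in> rsets r W. x \<in> e \<and> (\<exists>y\<in>Y. y \<in> e \<and> y \<noteq> x)} \<le> card Y * card W ^ (r - 2)"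
proof -
  let ?E = "\<lambda>y. {e \<in> rsets r W. {x, y} \<subseteq> e}"
  have "{e \<in> rsets r W. x \<in> e \<and> (\<exists>y\<in>Y. y \<in> e \<and> y \<noteq> x)} \<subseteq> (\<Union>y\<in>Y - {x}. ?E y)" by blast
  then have "card {e \<in> rsets r W. x \<in> e \<and> (\<exists>y\<in>Y. y \<in> e \<and> y \<noteq> x)} \<le> card (\<Union>y\<in>Y - {x}. ?E y)"
    using assms W by (intro card_mono) auto
  also have "\<dots> \<le> (\<Sum>y\<in>Y - {x}. card (?E y))" using assms by (intro card_UN_le) auto
  also have "\<dots> \<le> (\<Sum>y\<in>Y - {x}. card W ^ (r - 2))"
  proof (rule sum_mono)
    fix y assume "y \<in> Y - {x}"
    then have "card {x, y} = 2" by auto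
    then show "card (?E y) \<le> card W ^ (r - 2)" using card_rsets_superset[OF W, of "{x, y}" r] r
        by simp
  qed
  also have "\<dots> = card (Y - {x}) * card W ^ (r - 2)" by simp
  also have "\<dots> \<le> card Y * card W ^ (r - 2)" using assms by (intro mult_right_mono card_mono) auto
  finally show ?thesis .
qed

text \<open>Only pairs through \<open>x\<close> count here, so the bound has order
  \<open>N ^ (r - 2)\<close> and holds for every vertex, including the bad ones.\<close>

lemma card_edges_nonadj:
  "card {e \<in> G. x \<in> e \<and> (\<exists>y\<in>e. y \<noteq> x \<and> \<not> adj x y)} \<le> codeg_factor * card W ^ (r - 2)"
proof -
  let ?Y = "{y \<in> W. y \<noteq> x \<and> \<not> adj x y}"
  let ?E = "\<lambda>y. {e \<in> G. x \<in> e \<and> y \<in> e}"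
  have "{e \<in> G. x \<in> e \<and> (\<exists>y\<in>e. y \<noteq> x \<and> \<not> adj x y)} \<subseteq> (\<Union>y\<in>?Y. ?E y)" using G_edgeD by blast
  then have "card {e \<in> G. x \<in> e \<and> (\<exists>y\<in>e. y \<noteq> x \<and> \<not> adj x y)} \<le> card (\<Union>y\<in>?Y. ?E y)"
    using W finite_G by (intro card_mono) auto
  also have "\<dots> \<le> (\<Sum>y\<in>?Y. card (?E y))" using W by (intro card_UN_le) auto
  also have "\<dots> \<le> (\<Sum>y\<in>?Y. codeg_factor * card W ^ (r - 3))"
    by (rule sum_mono) (auto simp: adj_def)
  also have "\<dots> = card ?Y * (codeg_factor * card W ^ (r - 3))" by simp
  also have "\<dots> \<le> card W * (codeg_factor * card W ^ (r - 3))"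
    using W by (intro mult_right_mono card_mono) auto
  also have "\<dots> = codeg_factor * card W ^ Suc (r - 3)" by simp
  also have "Suc (r - 3) = r - 2" using r by simp
  finally show ?thesis .
qed

text \<open>Some part \<open>U i\<close> contains few neighbours of \<open>x\<close>, as otherwise
  \<open>x\<close> creates the forbidden graph. Up to small errors the edges of \<open>G\<close> at
  \<open>x\<close> then come from transversals of its neighbourhoods in the other
  \<open>l - 1\<close> parts; if one of these had fewer than \<open>(1 / l - \<mu>) * N\<close>
  vertices, the degree of \<open>x\<close> would be below \<open>\<delta> * N ^ (r - 1)\<close>, by
  \<open>gap\<close>.\<close>

lemma nearly_complete_to_other_parts:
  assumes U: "\<And>i. i \<in> {1..l} \<Longrightarrow> U i \<subseteq> W" "disjoint_family_on U {1..l}"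
      "real (card (W - (\<Union>i\<in>{1..l}. U i))) \<le> \<epsilon> * N"
      "\<And>i. i \<in> {1..l} \<Longrightarrow> real (card (U i)) \<le> (1 / real l + \<epsilon>) * N"
    and c: "core U U (\<epsilon> * N)"
    and x: "x \<in> W" and deg: "\<delta> * N ^ (r - 1) \<le> real (card {e \<in> G. x \<in> e})"
    and \<epsilon>: "\<epsilon> > 0" and \<eta>: "real (l * t) * (\<epsilon> * N + 1) < \<eta> * N"
        and \<zeta>: "real codeg_factor + 1 \<le> \<zeta> * N"
    and gap: "\<epsilon> + \<eta> + \<zeta> + (real (l - 2 choose (r - 1)) * (1 / real l + \<epsilon>) ^ (r - 1) +
      (1 / real l - \<mu>) * (real (l - 2 choose (r - 2)) * (1 / real l + \<epsilon>) ^ (r - 2))) < \<delta>"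
    and large: "avoid_bound \<le> card W"
  shows "\<exists>i\<in>{1..l}. \<forall>j\<in>{1..l}. j \<noteq> i \<longrightarrow> (1 / real l - \<mu>) * N \<le> real (card {y \<in> U j. adj x y})"
proof -
  let ?I = "{1..l}"
  define M where "M j = {y \<in> U j. adj x y}" for j
  have one: "1 \<in> ?I" using r by auto
  have fU: "finite (U i)" if "i \<in> ?I" for i using U(1)[OF that] W finite_subset by blast
  have fM: "finite (M i)" "M i \<subseteq> U i" if "i \<in> ?I" for i using fU[OF that] by (auto simp: M_def)
  have N: "N > 0" using x W by (auto simp: card_gt_0_iff)
  have "\<exists>i\<in>?I. real (card (M i)) \<le> \<eta> * N"
  proof (rule ccontr)
    assume neg: "\<not> ?thesis"
    have big: "real (l * t) * (\<epsilon> * N + 1) < real (card (M j))" if "j \<in> ?I" for j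
      using neg that \<eta> by force
    have "0 \<le> real (l * t) * (\<epsilon> * N + 1)" using \<epsilon> by simp
    then have "M 1 \<noteq> {}" using big[OF one] by auto
    then obtain y where y: "y \<in> M 1" by blast
    have sub: "real (card {z \<in> M j. \<not> adj a z}) \<le> \<epsilon> * N" if "i \<in> ?I" "j \<in> ?I" "i \<noteq> j" "a \<in> M i"
        for i j a
    proof -
      have "card {z \<in> M j. \<not> adj a z} \<le> card {z \<in> U j. \<not> adj a z}"
        using fU[OF that(2)] by (intro card_mono) (auto simp: M_def)
      moreover have "real (card {z \<in> U j. \<not> adj a z}) \<le> \<epsilon> * N"
        using coreD(6)[OF c that(1-3)] that(4) by (auto simp: M_def)
      ultimately show ?thesis by linarith
    qed
    show False
    proof (rule no_multipartite_plus_edge[where S = M and \<beta> = "\<epsilon> * N" and i = 1 and x = x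
        and y = y])
      show "M j \<subseteq> W \<and> real (l * t) * (\<epsilon> * N + 1) < real (card (M j))" if "j \<in> ?I" for j
        using big[OF that] U(1)[OF that] by (auto simp: M_def)
      show "adj x y" using y by (simp add: M_def)
      show "0 \<le> \<epsilon> * N" using \<epsilon> by simp
      show "real (card {z \<in> M j. \<not> adj x z}) \<le> \<epsilon> * N" for j
      proof -
        have "{z \<in> M j. \<not> adj x z} = {}" by (auto simp: M_def)
        then have "real (card {z \<in> M j. \<not> adj x z}) = 0" by (simp only: card.empty of_nat_0)
        then show ?thesis using \<epsilon> by simp
      qed
      show "real (card {z \<in> M j. \<not> adj y z}) \<le> \<epsilon> * N" if "j \<in> ?I" "j \<noteq> 1" for j
        using sub[OF one that(1) that(2)[symmetric] y] .
    qed (use sub one large in auto)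
  qed
  then obtain i where i: "i \<in> ?I" "real (card (M i)) \<le> \<eta> * N" by blast
  have "(1 / real l - \<mu>) * N \<le> real (card (M j0))" if j0: "j0 \<in> ?I" "j0 \<noteq> i" for j0
  proof (rule ccontr)
    assume neg: "\<not> ?thesis"
    let ?R = "W - (\<Union>i\<in>?I. U i)"
    let ?E1 = "{e \<in> rsets r W. x \<in> e \<and> (\<exists>y\<in>?R. y \<in> e \<and> y \<noteq> x)}"
    let ?E2 = "{e \<in> G. x \<in> e \<and> (\<exists>y\<in>e. y \<noteq> x \<and> \<not> adj x y)}"
    let ?E3 = "{e \<in> G. \<exists>j\<in>?I. \<exists>u\<in>e \<inter> U j. \<exists>v\<in>e \<inter> U j. u \<noteq> v}"
    let ?E4 = "{e \<in> rsets r W. x \<in> e \<and> (\<exists>y\<in>M i. y \<in> e \<and> y \<noteq> x)}"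
    let ?E = "{e \<in> G. x \<in> e}"
    let ?E5 = "?E - (?E1 \<union> ?E2 \<union> ?E3 \<union> ?E4)"
    define J where "J = ?I - {i, j0}"
    have J: "finite J" "j0 \<notin> J" "?I - {i} = insert j0 J" "card J = l - 2"
      using i(1) j0 by (auto simp: J_def card_Diff_subset)
    have b1: "real (card ?E1) \<le> \<epsilon> * N * N ^ (r - 2)"
    proof -
      have "real (card ?E1) \<le> real (card ?R) * N ^ (r - 2)"
        using card_edges_meeting[of ?R x] W by (simp flip: of_nat_mult of_nat_power)
      also have "\<dots> \<le> \<epsilon> * N * N ^ (r - 2)" using U(3) by (intro mult_right_mono) auto
      finally show ?thesis .
    qed
    have b2: "real (card ?E2) \<le> real codeg_factor * N ^ (r - 2)"
      using card_edges_nonadj[of x] by (simp flip: of_nat_mult of_nat_power)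
    \<comment> \<open>All these edges have the same colour by
      \<open>non_transversal_same_color\<close>, and \<open>G\<close> contains only one edge of each
      colour.\<close>
    have "card ?E3 \<le> Suc 0"
    proof (subst card_le_Suc0_iff_eq)
      show "finite ?E3" using finite_G by simp
      show "\<forall>a\<in>?E3. \<forall>b\<in>?E3. a = b"
      proof (intro ballI)
        fix a b assume a: "a \<in> ?E3" and b: "b \<in> ?E3"
        obtain j u v where a': "a \<in> G" "j \<in> ?I" "u \<in> a" "v \<in> a" "u \<noteq> v" "u \<in> U j" "v \<in> U j" using a
            by blast
        obtain k u' v' where b': "b \<in> G" "k \<in> ?I" "u' \<in> b" "v' \<in> b" "u' \<noteq> v'" "u' \<in> U k" "v' \<in> U k"
            using b by blast
        have ab: "a \<in> rsets r W" "b \<in> rsets r W" using a'(1) b'(1) G(1) by auto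
        have "\<chi> a = \<chi> b" by (rule non_transversal_same_color[OF c ab(1) a'(2-7) ab(2) b'(2-7)])
        then show "a = b" using inj_onD[OF G(2)] a'(1) b'(1) by blast
      qed
    qed
    then have b3: "real (card ?E3) \<le> N ^ (r - 2)"
    proof -
      have "N \<ge> 1" using N by (simp add: Suc_le_eq)
      then have "N ^ (r - 2) \<ge> 1" by (rule one_le_power)
      then show ?thesis using \<open>card ?E3 \<le> Suc 0\<close> by linarith
    qed
    have b4: "real (card ?E4) \<le> \<eta> * N * N ^ (r - 2)"
    proof -
      have "real (card ?E4) \<le> real (card (M i)) * N ^ (r - 2)"
        using card_edges_meeting[of "M i" x] fM(1)[OF i(1)] by (simp flip: of_nat_mult of_nat_power)
      also have "\<dots> \<le> \<eta> * N * N ^ (r - 2)" using i(2) by (intro mult_right_mono) auto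
      finally show ?thesis .
    qed
    have disjM: "disjoint_family_on M (?I - {i})"
      using U(2) unfolding disjoint_family_on_def M_def by blast
    have "card ?E5 \<le> card (transversals (?I - {i}) M (r - 1))"
    proof (rule card_inj_on_le[where f = "\<lambda>e. e - {x}"])
      show "inj_on (\<lambda>e. e - {x}) ?E5" by (auto simp: inj_on_def)
      show "finite (transversals (?I - {i}) M (r - 1))" using fM by (auto simp: transversals_def)
      show "(\<lambda>e. e - {x}) ` ?E5 \<subseteq> transversals (?I - {i}) M (r - 1)"
      proof (rule image_subsetI)
        fix e assume e: "e \<in> ?E5"
        then have e': "e \<subseteq> W" "card e = r" "finite e" "x \<in> e" "e \<in> G" "e \<in> rsets r W"
            using G_edgeD G(1) by auto
        have "y \<in> (\<Union>j\<in>?I - {i}. M j)" if y: "y \<in> e - {x}" for y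
        proof -
          have "y \<in> (\<Union>i\<in>?I. U i)" using e e' y by blast
          then obtain j where j: "j \<in> ?I" "y \<in> U j" by blast
          have "adj x y" using e e' y by blast
          then have yM: "y \<in> M j" using j by (simp add: M_def)
          have "y \<notin> M i" using e e' y by blast
          then have "j \<noteq> i" using yM by blast
          then show ?thesis using j yM by blast
        qed
        then have 1: "e - {x} \<subseteq> (\<Union>j\<in>?I - {i}. M j)" by blast
        have 2: "card ((e - {x}) \<inter> M j) \<le> 1" if "j \<in> ?I - {i}" for j
        proof -
          have "a = b" if ab: "a \<in> (e - {x}) \<inter> M j" "b \<in> (e - {x}) \<inter> M j" for a b
          proof (rule ccontr)
            assume "a \<noteq> b"
            moreover have "a \<in> e \<inter> U j" "b \<in> e \<inter> U j" using ab by (auto simp: M_def)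
            ultimately have "e \<in> ?E3" using e'(5) \<open>j \<in> ?I - {i}\<close> by blast
            then show False using e by blast
          qed
          then show ?thesis using e'(3) by (simp add: card_le_Suc0_iff_eq)
        qed
        have "card (e - {x}) = r - 1" using e' by simp
        then show "e - {x} \<in> transversals (?I - {i}) M (r - 1)"
          using 1 2 by (simp add: transversals_def rsets_def)
      qed
    qed
    also have "\<dots> = esym (?I - {i}) (\<lambda>j. card (M j)) (r - 1)"
      using disjM fM(1) by (intro card_transversals) auto
    also have "\<dots> = esym (insert j0 J) (\<lambda>j. card (M j)) (Suc (r - 2))"
    proof -
      have "r - 1 = Suc (r - 2)" using r by simp
      then show ?thesis by (simp only: J(3))
    qed
    also have "\<dots> = esym J (\<lambda>j. card (M j)) (r - 1) + card (M j0) * esym J (\<lambda>j. card (M j)) (r - 2)"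
    proof -
      have "r - 1 = Suc (r - 2)" using r by simp
      then show ?thesis by (simp only: esym_insert[OF J(1,2)])
    qed
    finally have "real (card ?E5) \<le> real (esym J (\<lambda>j. card (M j)) (r - 1)) +
        real (card (M j0)) * real (esym J (\<lambda>j. card (M j)) (r - 2))"
      by (simp only: of_nat_le_iff flip: of_nat_mult of_nat_add)
    also have "\<dots> \<le> real (l - 2 choose (r - 1)) * ((1 / real l + \<epsilon>) * N) ^ (r - 1) +
        (1 / real l - \<mu>) * N * (real (l - 2 choose (r - 2)) * ((1 / real l + \<epsilon>) * N) ^ (r - 2))"
    proof -
      have Ma: "real (card (M j)) \<le> (1 / real l + \<epsilon>) * N" if "j \<in> J" for j
      proof -
        have j: "j \<in> ?I" using that by (simp add: J_def)
        have "card (M j) \<le> card (U j)" using fU[OF j] fM(2)[OF j] by (rule card_mono)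
        then show ?thesis using U(4)[OF j] by linarith
      qed
      have a0: "0 \<le> (1 / real l + \<epsilon>) * N" using \<epsilon> by simp
      have es: "real (esym J (\<lambda>j. card (M j)) k) \<le> real (l - 2 choose k) * ((1 / real l +
          \<epsilon>) * N) ^ k" for k
        unfolding J(4)[symmetric] by (rule esym_real_le[OF J(1) Ma a0])
      have le: "real (card (M j0)) \<le> (1 / real l - \<mu>) * N" using neg by linarith
      have b0: "0 \<le> (1 / real l - \<mu>) * N" by (rule order_trans[OF of_nat_0_le_iff le])
      have "real (card (M j0)) * real (esym J (\<lambda>j. card (M j)) (r - 2)) \<le>
          (1 / real l - \<mu>) * N * (real (l - 2 choose (r - 2)) * ((1 / real l + \<epsilon>) * N) ^ (r - 2))"
        by (rule mult_mono[OF le es b0 of_nat_0_le_iff])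
      then show ?thesis using es[of "r - 1"] by linarith
    qed
    also have "\<dots> = (real (l - 2 choose (r - 1)) * (1 / real l + \<epsilon>) ^ (r - 1) +
        (1 / real l - \<mu>) * (real (l - 2 choose (r - 2)) * (1 / real l + \<epsilon>) ^ (r - 2))) * N ^ (r -
            1)"
    proof -
      have "r - 1 = Suc (r - 2)" using r by simp
      then have N1: "N ^ (r - 1) = N * N ^ (r - 2)" by simp
      have "c1 * (a1 * (N * m)) + d * N * (c2 * (a2 * m)) = (c1 * a1 + d * (c2 * a2)) * (N * m)"
          for c1 a1 c2 a2 d m :: real
        by (simp add: algebra_simps)
      then show ?thesis unfolding power_mult_distrib N1 .
    qed
    finally have b5: "real (card ?E5) \<le> \<dots>" .
    have Npow: "N * N ^ (r - 2) = N ^ (r - 1)"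
    proof -
      have "r - 1 = Suc (r - 2)" using r by simp
      then show ?thesis by simp
    qed
    have "card ?E \<le> card (?E5 \<union> (?E1 \<union> (?E2 \<union> (?E3 \<union> ?E4))))"
      using finite_G W by (intro card_mono) auto
    also have "\<dots> \<le> card ?E5 + (card ?E1 + (card ?E2 + (card ?E3 + card ?E4)))"
      by (intro order_trans[OF card_Un_le] add_left_mono order_refl)
    finally have "real (card ?E) \<le> real (card ?E5) + (real (card ?E1) + (real (card ?E2) +
        (real (card ?E3) + real (card ?E4))))"
      by (simp only: of_nat_le_iff flip: of_nat_add)
    then have "\<delta> * N ^ (r - 1) \<le> (real (l - 2 choose (r - 1)) * (1 / real l + \<epsilon>) ^ (r - 1) +
        (1 / real l - \<mu>) * (real (l - 2 choose (r - 2)) * (1 / real l + \<epsilon>) ^ (r - 2))) * N ^ (r - 1)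
            +
        (\<epsilon> * N * N ^ (r - 2) + (real codeg_factor * N ^ (r - 2) + (N ^ (r - 2) + \<eta> * N * N ^ (r -
            2))))"
      using deg b1 b2 b3 b4 b5 by linarith
    also have "\<dots> \<le> (real (l - 2 choose (r - 1)) * (1 / real l + \<epsilon>) ^ (r - 1) +
        (1 / real l - \<mu>) * (real (l - 2 choose (r - 2)) * (1 / real l + \<epsilon>) ^ (r - 2))) * N ^ (r - 1)
            +
        (\<epsilon> * N ^ (r - 1) + (\<zeta> * N ^ (r - 1) + \<eta> * N ^ (r - 1)))"
    proof -
      have "real codeg_factor * N ^ (r - 2) + N ^ (r - 2) = (real codeg_factor + 1) * N ^ (r - 2)"
        by (simp add: algebra_simps)
      also have "\<dots> \<le> \<zeta> * N * N ^ (r - 2)" using \<zeta> by (intro mult_right_mono) auto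
      finally have "real codeg_factor * N ^ (r - 2) + N ^ (r - 2) \<le> \<zeta> * N ^ (r - 1)"
        unfolding Npow[symmetric] by (simp add: mult.assoc)
      then show ?thesis unfolding mult.assoc[of _ N] Npow by linarith
    qed
    also have "\<dots> = (\<epsilon> + \<eta> + \<zeta> + (real (l - 2 choose (r - 1)) * (1 / real l + \<epsilon>) ^ (r - 1) +
      (1 / real l - \<mu>) * (real (l - 2 choose (r - 2)) * (1 / real l + \<epsilon>) ^ (r - 2)))) * N ^ (r - 1)"
      by (simp add: algebra_simps)
    also have "\<dots> < \<delta> * N ^ (r - 1)" using gap N by (intro mult_strict_right_mono) auto
    finally show False by simp
  qed
  then show ?thesis using i(1) unfolding M_def by blast
qed

text \<open>Vertices outside all \<open>U i\<close> join the exceptional part given by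
  \<open>nearly_complete_to_other_parts\<close>; the others stay. The resulting partition
  \<open>V\<close> of \<open>W\<close> is still a core over \<open>U\<close>, now with tolerance
  \<open>(\<mu> + \<epsilon>) * N\<close>. So the non-transversal \<open>r\<close>-sets have at most
  one colour, and the transversals number at most the Turan number.\<close>

lemma card_colors_le:
  assumes U: "\<And>i. i \<in> {1..l} \<Longrightarrow> U i \<subseteq> W" "disjoint_family_on U {1..l}"
      "real (card (W - (\<Union>i\<in>{1..l}. U i))) \<le> \<epsilon> * N"
      "\<And>i. i \<in> {1..l} \<Longrightarrow> real (card (U i)) \<le> (1 / real l + \<epsilon>) * N"
      "\<And>i. i \<in> {1..l} \<Longrightarrow> (1 / real l - \<epsilon>) * N \<le> real (card (U i))"
      "\<And>i j u. i \<in> {1..l} \<Longrightarrow> j \<in> {1..l} \<Longrightarrow> i \<noteq> j \<Longrightarrow> u \<in> U i \<Longrightarrow> real (card {y \<in> U j. \<not> adj u y}) \<le> \<epsilon> * N"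
    and deg: "\<And>x. x \<in> W \<Longrightarrow> \<delta> * N ^ (r - 1) \<le> real (card {e \<in> G. x \<in> e})"
    and \<epsilon>: "\<epsilon> > 0" and \<mu>: "\<mu> \<ge> 0"
    and \<eta>: "real (l * t) * (\<epsilon> * N + 1) < \<eta> * N" and \<zeta>: "real codeg_factor + 1 \<le> \<zeta> * N"
    and gap: "\<epsilon> + \<eta> + \<zeta> + (real (l - 2 choose (r - 1)) * (1 / real l + \<epsilon>) ^ (r - 1) +
      (1 / real l - \<mu>) * (real (l - 2 choose (r - 2)) * (1 / real l + \<epsilon>) ^ (r - 2))) < \<delta>"
    and room: "real (l * t) * ((\<mu> + \<epsilon>) * N + 1) + real (8 * r) < (1 / real l - \<epsilon>) * N"
    and large: "avoid_bound \<le> card W"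
  shows "card (\<chi> ` rsets r W) \<le> turan_number r (card W) l + 1"
proof -
  let ?I = "{1..l}"
  have fU: "finite (U i)" if "i \<in> ?I" for i using U(1)[OF that] W finite_subset by blast
  have mono: "real (l * t) * (\<epsilon> * N + 1) \<le> real (l * t) * ((\<mu> + \<epsilon>) * N + 1)" "\<epsilon> * N \<le> (\<mu> + \<epsilon>) * N"
    using \<mu> by (auto intro!: mult_left_mono mult_right_mono simp del: of_nat_mult)
  have cU: "core U U (\<epsilon> * N)"
    unfolding core_def
  proof (intro conjI ballI impI)
    show "0 \<le> \<epsilon> * N" using \<epsilon> by simp
    fix i assume i: "i \<in> ?I"
    show "U i \<subseteq> U i" "U i \<subseteq> W" using U(1)[OF i] by auto
    show "real (l * t) * (\<epsilon> * N + 1) + real (8 * r) < real (card (U i))"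
        using room mono(1) U(5)[OF i] by linarith
    fix j x assume "j \<in> ?I" "i \<noteq> j" "x \<in> U i"
    then show "real (card {y \<in> U j. \<not> adj x y}) \<le> \<epsilon> * N" using U(6)[OF i] by blast
  qed
  have ex: "\<exists>i\<in>?I. \<forall>j\<in>?I. j \<noteq> i \<longrightarrow> (1 / real l - \<mu>) * N \<le> real (card {y \<in> U j. adj x y})" if "x \<in> W"
      for x
    by (rule nearly_complete_to_other_parts[OF U(1-4) cU that deg[OF that] \<epsilon> \<eta> \<zeta> gap large])
  \<comment> \<open>The first conjunct makes the choice \<open>p\<close> agree with the given part
    on every \<open>U i\<close>, so that \<open>U i \<subseteq> V i\<close>.\<close>
  have "\<exists>i\<in>?I. (x \<in> U i \<or> x \<notin> (\<Union>i\<in>?I. U i)) \<and> (\<forall>j\<in>?I. j \<noteq> i \<longrightarrow> real (card {y \<in> U j. \<not> adj x y}) \<le>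
      (\<mu> + \<epsilon>) * N)" if x: "x \<in> W" for x
  proof (cases "x \<in> (\<Union>i\<in>?I. U i)")
    case True
    then obtain i where i: "i \<in> ?I" "x \<in> U i" by blast
    have "real (card {y \<in> U j. \<not> adj x y}) \<le> (\<mu> + \<epsilon>) * N" if "j \<in> ?I" "j \<noteq> i" for j
      using U(6)[OF i(1) that(1) that(2)[symmetric] i(2)] mono(2) by (rule order_trans)
    then show ?thesis using i by blast
  next
    case False
    obtain i where i: "i \<in> ?I" "\<forall>j\<in>?I. j \<noteq> i \<longrightarrow> (1 / real l - \<mu>) * N \<le>
        real (card {y \<in> U j. adj x y})"
      using ex[OF x] by blast
    have "real (card {y \<in> U j. \<not> adj x y}) \<le> (\<mu> + \<epsilon>) * N" if j: "j \<in> ?I" "j \<noteq> i" for j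
    proof -
      have "card {y \<in> U j. adj x y} + card {y \<in> U j. \<not> adj x y} = card (U j)"
        using fU[OF j(1)]
            by (subst card_Un_disjoint[symmetric]) (auto intro: arg_cong[where f = card])
      then have "real (card {y \<in> U j. adj x y}) + real (card {y \<in> U j. \<not> adj x y}) =
          real (card (U j))" by linarith
      then have "real (card {y \<in> U j. \<not> adj x y}) \<le> (1 / real l + \<epsilon>) * N - (1 / real l - \<mu>) * N"
        using bspec[OF i(2) j(1)] j(2) U(4)[OF j(1)] by linarith
      then show ?thesis by (simp add: algebra_simps)
    qed
    then show ?thesis using i(1) False by blast
  qed
  then obtain p where p: "\<And>x. x \<in> W \<Longrightarrow> p x \<in> ?I \<and> (x \<in> U (p x) \<or> x \<notin> (\<Union>i\<in>?I. U i)) \<and>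
      (\<forall>j\<in>?I. j \<noteq> p x \<longrightarrow> real (card {y \<in> U j. \<not> adj x y}) \<le> (\<mu> + \<epsilon>) * N)" by metis
  define V where "V i = {x \<in> W. p x = i}" for i
  have UV: "U i \<subseteq> V i" if i: "i \<in> ?I" for i
  proof
    fix x assume x: "x \<in> U i"
    then have xW: "x \<in> W" using U(1)[OF i] by blast
    have "x \<in> U (p x)" "p x \<in> ?I" using p[OF xW] x i by blast+
    then have "p x = i" using U(2) i x unfolding disjoint_family_on_def by blast
    then show "x \<in> V i" using xW by (simp add: V_def)
  qed
  have cV: "core U V ((\<mu> + \<epsilon>) * N)"
    unfolding core_def
  proof (intro conjI ballI impI)
    show "0 \<le> (\<mu> + \<epsilon>) * N" using \<epsilon> \<mu> by simp
    fix i assume i: "i \<in> ?I"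
    show "U i \<subseteq> V i" using UV[OF i] .
    show "V i \<subseteq> W" by (auto simp: V_def)
    show "real (l * t) * ((\<mu> + \<epsilon>) * N + 1) + real (8 * r) < real (card (U i))" using room U(5)[OF i]
        by linarith
    fix j x assume "j \<in> ?I" "i \<noteq> j" "x \<in> V i"
    then show "real (card {y \<in> U j. \<not> adj x y}) \<le> (\<mu> + \<epsilon>) * N" using p[of x] by (auto simp: V_def)
  qed
  have Vd: "disjoint_family_on V ?I" by (auto simp: disjoint_family_on_def V_def)
  have Vu: "(\<Union>i\<in>?I. V i) = W" using p by (auto simp: V_def)
  let ?T = "transversals ?I V r"
  have "\<exists>i\<in>?I. \<exists>u\<in>e \<inter> V i. \<exists>v\<in>e \<inter> V i. u \<noteq> v" if e: "e \<in> rsets r W - ?T" for e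
  proof -
    have "finite e" using e W by (auto simp: rsets_def dest: finite_subset)
    moreover obtain i where "i \<in> ?I" "\<not> card (e \<inter> V i) \<le> 1"
      using e unfolding transversals_def Vu by blast
    ultimately show ?thesis by (metis One_nat_def card_le_Suc0_iff_eq finite_Int)
  qed
  note nt = this
  have same: "\<chi> a = \<chi> b" if a: "a \<in> rsets r W - ?T" and b: "b \<in> rsets r W - ?T" for a b
  proof -
    obtain j u v where a': "j \<in> ?I" "u \<in> a" "v \<in> a" "u \<noteq> v" "u \<in> V j" "v \<in> V j" using nt[OF a]
        by blast
    obtain k u' v' where b': "k \<in> ?I" "u' \<in> b" "v' \<in> b" "u' \<noteq> v'" "u' \<in> V k" "v' \<in> V k"
        using nt[OF b] by blast
    have ab: "a \<in> rsets r W" "b \<in> rsets r W" using a b by auto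
    show ?thesis by (rule non_transversal_same_color[OF cV ab(1) a' ab(2) b'])
  qed
  have fr: "finite (rsets r W)" using W by simp
  have TW: "?T \<subseteq> rsets r W" unfolding transversals_def Vu by blast
  have one_color: "card (\<chi> ` (rsets r W - ?T)) \<le> 1"
  proof -
    have "\<forall>a\<in>\<chi> ` (rsets r W - ?T). \<forall>b\<in>\<chi> ` (rsets r W - ?T). a = b"
    proof (intro ballI)
      fix c d assume "c \<in> \<chi> ` (rsets r W - ?T)" "d \<in> \<chi> ` (rsets r W - ?T)"
      then obtain a b where "c = \<chi> a" "a \<in> rsets r W - ?T" "d = \<chi> b" "b \<in> rsets r W - ?T"
        by (elim imageE)
      then show "c = d" using same[of a b] by metis
    qed
    moreover have "finite (\<chi> ` (rsets r W - ?T))" using fr by blast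
    ultimately show ?thesis unfolding One_nat_def by (simp only: card_le_Suc0_iff_eq)
  qed
  have un: "\<chi> ` rsets r W = \<chi> ` ?T \<union> \<chi> ` (rsets r W - ?T)" using TW by blast
  have "card (\<chi> ` rsets r W) \<le> card (\<chi> ` ?T) + card (\<chi> ` (rsets r W - ?T))"
    unfolding un by (rule card_Un_le)
  also have "\<dots> \<le> card ?T + 1"
    using card_image_le[OF finite_subset[OF TW fr], of \<chi>] one_color by linarith
  also have "card ?T \<le> turan_number r (card (\<Union>i\<in>?I. V i)) l"
    using r W by (intro card_transversals_le_turan_number Vd) (auto simp: V_def)
  finally show ?thesis unfolding Vu by simp
qed

end

section \<open>Choice of constants\<close>

text \<open>Both sides are the product of \<open>(l - 1 - i) / l\<close> over \<open>i < k\<close>.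
  For \<open>k = r - 1\<close> the left side counts cliques in a neighbourhood of relative size
  \<open>1 - 1 / l\<close> with \<open>l - 1\<close> equal parts, the right side edges at a vertex
  of the Turan \<open>r\<close>-graph: the degree threshold corresponds exactly to codegree-graph
  degree \<open>(1 - 1 / l) * n\<close>.\<close>

lemma turan_density_prod_choose:
  fixes l k :: nat
  assumes "2 \<le> l"
  shows "turan_density_prod (1 / real (l - 1)) k * (1 - 1 / real l) ^ k =
         fact k * (real (l - 1 choose k) / real l ^ k)"
proof -
  define m where "m = real (l - 1)"
  have m: "m > 0" "real l = m + 1" using assms by (auto simp: m_def)
  have "turan_density_prod (1 / m) k * (1 - 1 / real l) ^ k =
      (\<Prod>i<k. (1 - real i * (1 / m)) * (1 - 1 / real l))"
    by (simp add: turan_density_prod_def prod.distrib)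
  also have "\<dots> = (\<Prod>i<k. (m - real i) / real l)"
  proof (intro prod.cong refl)
    fix i
    have 1: "1 - real i * (1 / m) = (m - real i) / m" using m(1) by (simp add: diff_divide_distrib)
    have 2: "1 - 1 / real l = m / real l" using m by (simp add: field_simps)
    show "(1 - real i * (1 / m)) * (1 - 1 / real l) = (m - real i) / real l"
      unfolding 1 2 using m(1) by simp
  qed
  also have "\<dots> = (\<Prod>i<k. m - real i) / real l ^ k" by (simp add: prod_dividef)
  also have "(\<Prod>i<k. m - real i) = fact k * (m gchoose k)"
    by (simp add: gbinomial_mult_fact atLeast0LessThan)
  also have "m gchoose k = real (l - 1 choose k)" by (simp add: m_def binomial_gbinomial)
  finally show ?thesis by (simp add: m_def)
qed

text \<open>Replaces explicit smallness estimates: a gap that is positive in the limit at zero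
  survives for some small parameter.\<close>

lemma ex_right_of_zero_positive:
  fixes h :: "real \<Rightarrow> real"
  assumes "(h \<longlongrightarrow> c) (at_right 0)" "0 < c" "0 < b"
  obtains s where "0 < s" "s < b" "0 < h s"
proof -
  have "\<forall>\<^sub>F s in at_right 0. 0 < h s" using order_tendstoD(1)[OF assms(1,2)] .
  moreover have "\<forall>\<^sub>F s in at_right 0. s \<in> {0<..<b}" by (rule eventually_at_right_real[OF assms(3)])
  ultimately have "\<forall>\<^sub>F s in at_right 0. 0 < h s \<and> s \<in> {0<..<b}" by eventually_elim simp
  then obtain s where "0 < h s \<and> s \<in> {0<..<b}"
    using eventually_happens'[OF trivial_limit_at_right_real] by blast
  then show ?thesis using that by auto
qed

text \<open>The argument \<open>n - 1\<close> is the number of vertices before the last one is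
  added, as in \<open>turan_number_Suc\<close>; the generous \<open>2 / n\<close> in the proof
  absorbs the rounding.\<close>

lemma eventually_div_power_ge:
  fixes l k :: nat
  assumes "0 < l" "s > 0"
  shows "\<forall>\<^sub>F n in sequentially. (real M / real l ^ k - s) * real n ^ k \<le>
      real (M * ((n - 1) div l) ^ k)"
proof -
  have "(\<lambda>n. real M * (1 / real l - 2 / real n) ^ k) \<longlonglongrightarrow> real M * (1 / real l - 0) ^ k"
    by (intro tendsto_intros lim_const_over_n)
  then have "(\<lambda>n. real M * (1 / real l - 2 / real n) ^ k) \<longlonglongrightarrow> real M / real l ^ k"
    by (simp add: power_one_over)
  then have "\<forall>\<^sub>F n in sequentially. real M / real l ^ k - s <
      real M * (1 / real l - 2 / real n) ^ k"
    by (rule order_tendstoD(1)) (use assms in simp)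
  moreover have "\<forall>\<^sub>F n in sequentially. 2 * l < n" by (rule eventually_gt_at_top)
  ultimately show ?thesis
  proof eventually_elim
    case (elim n)
    have n: "real n > 0" using elim by simp
    have l: "real l > 0" using assms by simp
    have nl: "2 / real n \<le> 1 / real l" using elim n l by (simp add: field_simps flip: of_nat_mult)
    have "n - 1 < l * Suc ((n - 1) div l)" using assms by (simp add: dividend_less_times_div)
    then have "n \<le> l * Suc ((n - 1) div l)" by linarith
    then have "real n \<le> real l * (real ((n - 1) div l) + 1)"
      by (metis of_nat_le_iff of_nat_mult of_nat_Suc add.commute)
    then have "real n / real l - 2 \<le> real ((n - 1) div l)" using l by (simp add: field_simps)
    then have "(1 / real l - 2 / real n) * real n \<le> real ((n - 1) div l)"
      using n by (simp add: left_diff_distrib)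
    then have "((1 / real l - 2 / real n) * real n) ^ k \<le> real ((n - 1) div l) ^ k"
      using nl n by (intro power_mono mult_nonneg_nonneg) auto
    then have "real M * ((1 / real l - 2 / real n) ^ k * real n ^ k) \<le>
        real M * real ((n - 1) div l) ^ k"
      unfolding power_mult_distrib by (intro mult_left_mono) auto
    moreover have "(real M / real l ^ k - s) * real n ^ k \<le> (real M * (1 / real l - 2 / real n) ^ k)
        * real n ^ k"
      using elim(1) by (intro mult_right_mono) auto
    ultimately show ?case by simp
  qed
qed

text \<open>The constants are fixed in the order \<open>\<mu>\<close>, \<open>\<epsilon>'\<close>,
  \<open>\<epsilon>\<close>, \<open>\<theta>\<close>, then the blow-up densities and
  \<open>T\<close>; each depends only on earlier ones and on \<open>r\<close>, \<open>l\<close>,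
  \<open>t\<close>. Hence one bound on \<open>n\<close> serves all colourings and all vertex sets at
  once.\<close>

lemma eventually_few_colors:
  fixes r l t :: nat
  assumes r: "4 \<le> r" "r \<le> l" and t: "4 \<le> t"
  shows "\<forall>\<^sub>F n in sequentially. \<forall>q \<chi> W G. rainbow_free r l t q \<chi> W G \<and> card W = n \<and>
    (\<forall>v\<in>W. (l - 1 choose (r - 1)) * ((n - 1) div l) ^ (r - 1) \<le> card {e \<in> G. v \<in> e}) \<longrightarrow>
    card (\<chi> ` rsets r W) \<le> turan_number r n l + 1"
proof -
  define C where "C = rainbow_free.codeg_factor r l t"
  define AB where "AB = rainbow_free.avoid_bound r l t"
  define \<delta>0 where "\<delta>0 = real (l - 1 choose (r - 1)) / real l ^ (r - 1)"
  define c1 where "c1 = real (l - 2 choose (r - 1))"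
  define c2 where "c2 = real (l - 2 choose (r - 2))"
  define L where "L = real (l * t)"
  have l: "real l \<ge> 4" "real l > 0" using r by auto
  have L: "L \<ge> 16" 
  proof -
    have "4 * 4 \<le> l * t" using r t by (intro mult_mono) auto
    then show ?thesis unfolding L_def by linarith
  qed
  \<comment> \<open>Chosen so that \<open>2 * L * \<mu> = 1 / (4 * l)\<close>, a quarter of the size
    of a part: with \<open>\<epsilon>' < \<mu>\<close>, the greedy embedding then fits into the
    parts.\<close>
  define \<mu> where "\<mu> = 1 / (8 * real l * L)"
  have \<mu>: "\<mu> > 0" using l L by (simp add: \<mu>_def)
  have \<mu>L: "L * \<mu> = 1 / (8 * real l)" using l L by (simp add: \<mu>_def)
  have L4: "L \<ge> 4 * real l"
  proof -
    have "l * 4 \<le> l * t" using t by (intro mult_left_mono) auto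
    then show ?thesis unfolding L_def by linarith
  qed
  have c2: "c2 > 0" using r by (simp add: c2_def zero_less_binomial_iff)
  have pas: "real (l - 1 choose (r - 1)) = c1 + c2"
  proof -
    have "l - 1 = Suc (l - 2)" "r - 1 = Suc (r - 2)" using r by auto
    then show ?thesis unfolding c1_def c2_def by (metis add.commute binomial_Suc_Suc of_nat_add)
  qed
  \<comment> \<open>The slack in the gap condition of \<open>card_colors_le\<close> when
    \<open>\<epsilon>\<close> and \<open>\<zeta>\<close> are \<open>s\<close>, \<open>\<eta>\<close>
    is \<open>(L + 1) * s\<close> and \<open>\<delta>\<close> is \<open>\<delta>0 - s\<close>. By
    Pascal's rule its limit at zero is \<open>\<mu> * c2 * (1 / l) ^ (r - 2)\<close>, the loss
    caused by one neighbourhood that is too small.\<close>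
  define h where "h s = \<delta>0 - s - (s + (L + 1) * s + s + (c1 * (1 / real l + s) ^ (r - 1) +
      (1 / real l - \<mu>) * (c2 * (1 / real l + s) ^ (r - 2))))" for s
  have ht: "(h \<longlongrightarrow> \<delta>0 - 0 - (0 + (L + 1) * 0 + 0 + (c1 * (1 / real l + 0) ^ (r - 1) +
      (1 / real l - \<mu>) * (c2 * (1 / real l + 0) ^ (r - 2))))) (at_right 0)"
    unfolding h_def by (intro tendsto_intros)
  have h0: "\<delta>0 - 0 - (0 + (L + 1) * 0 + 0 + (c1 * (1 / real l + 0) ^ (r - 1) +
      (1 / real l - \<mu>) * (c2 * (1 / real l + 0) ^ (r - 2)))) = \<mu> * c2 * (1 / real l) ^ (r - 2)"
  proof -
    have r1: "r - 1 = Suc (r - 2)" using r by simp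
    have "\<delta>0 = (c1 + c2) * (1 / real l) ^ (r - 1)" unfolding \<delta>0_def pas
        by (simp add: power_one_over)
    also have "\<dots> = c1 * (1 / real l) ^ (r - 1) + c2 * (1 / real l * (1 / real l) ^ (r - 2))"
      by (simp only: r1 power_Suc distrib_right)
    finally have "\<delta>0 = c1 * (1 / real l) ^ (r - 1) + c2 * (1 / real l * (1 / real l) ^ (r - 2))" .
    moreover have "a + c * (w * z) - (a + (w - m) * (c * z)) = m * c * z" for a c w z m :: real
      by (simp add: algebra_simps)
    ultimately show ?thesis by (simp only: add_0_right add_0_left diff_zero mult_zero_right)
  qed
  have hpos: "\<mu> * c2 * (1 / real l) ^ (r - 2) > 0" using \<mu> c2 l by simp
  obtain \<epsilon>' where \<epsilon>': "0 < \<epsilon>'" "\<epsilon>' < \<mu>" "0 < h \<epsilon>'"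
    by (rule ex_right_of_zero_positive[OF ht[unfolded h0] hpos \<mu>])
  \<comment> \<open>Compensates the factor \<open>5 * l + 6\<close> lost in
    \<open>ex_independent_parts\<close>.\<close>
  define \<epsilon> where "\<epsilon> = \<epsilon>' / (5 * real l + 6)"
  have \<epsilon>: "\<epsilon> > 0" "(5 * real l + 6) * \<epsilon> = \<epsilon>'" "\<epsilon> \<le> \<epsilon>'"
    using \<epsilon>' l by (auto simp: \<epsilon>_def field_simps)
  have \<mu>small: "\<mu> \<le> 1 / (4 * (real l)\<^sup>2)"
    unfolding \<mu>_def power2_eq_square using l L4 by (intro divide_left_mono) auto
  have small: "1 / (4 * (real l)\<^sup>2) \<le> 1 / 64"
  proof -
    have "4 * 4 \<le> real l * real l" using l by (intro mult_mono) auto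
    then show ?thesis using l by (simp add: field_simps power2_eq_square)
  qed
  have \<epsilon>b: "\<epsilon> \<le> 1 / (4 * (real l)\<^sup>2)" using \<epsilon>(3) \<epsilon>'(2) \<mu>small by linarith
  define x where "x = 1 - 1 / real l - \<epsilon>"
  have x: "0 < x" "x < 1 - 1 / real l"
  proof -
    have "1 / real l \<le> 1 / 4" using l by (simp add: field_simps)
    then show "0 < x" using \<epsilon>b small unfolding x_def by linarith
    show "x < 1 - 1 / real l" using \<epsilon>(1) by (simp add: x_def)
  qed
  \<comment> \<open>The slack in the gap condition of \<open>typical_degree\<close>, positive at
    zero because \<open>x < 1 - 1 / l\<close>. The density \<open>\<beta>\<close> must lie strictly
    below \<open>1 / (l - 1)\<close>: only then is the last factor of
    \<open>turan_density_prod \<beta> l\<close> positive, so that \<open>l\<close>-cliques have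
    positive density.\<close>
  define k where "k s = fact (r - 1) * (\<delta>0 - s - s) - turan_density_prod (1 / real (l - 1) - s) (r -
      1) * x ^ (r - 1)" for s
  have l1: "real (l - 1) > 0" using r by simp
  have kt: "(k \<longlongrightarrow> fact (r - 1) * (\<delta>0 - 0 - 0) - turan_density_prod (1 / real (l - 1) - 0) (r - 1) * x
      ^ (r - 1)) (at_right 0)"
    unfolding k_def turan_density_prod_def by (intro tendsto_intros)
  have Pp: "turan_density_prod (1 / real (l - 1)) (r - 1) > 0"
    unfolding turan_density_prod_def
  proof (intro prod_pos ballI)
    fix i assume "i \<in> {..<r - 1}"
    then have "real i < real (l - 1)" using r by auto
    then show "0 < 1 - real i * (1 / real (l - 1))" by (simp add: field_simps)
  qed
  have "turan_density_prod (1 / real (l - 1)) (r - 1) * x ^ (r - 1) <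
      turan_density_prod (1 / real (l - 1)) (r - 1) * (1 - 1 / real l) ^ (r - 1)"
    using Pp x r by (intro mult_strict_left_mono power_strict_mono) auto
  also have "\<dots> = fact (r - 1) * \<delta>0"
    unfolding \<delta>0_def using r by (intro turan_density_prod_choose) auto
  finally have kpos: "0 < fact (r - 1) * (\<delta>0 - 0 - 0) - turan_density_prod (1 / real (l - 1) - 0) (r
      - 1) * x ^ (r - 1)"
    by simp
  obtain \<theta> where \<theta>: "0 < \<theta>" "\<theta> < 1 / real (l - 1)" "0 < k \<theta>"
    by (rule ex_right_of_zero_positive[OF kt kpos, of "1 / real (l - 1)"]) (use l1 in auto)
  define \<beta> where "\<beta> = 1 / real (l - 1) - \<theta>"
  have \<beta>: "0 \<le> \<beta>" "real (l - 1) * \<beta> < 1" using \<theta> l1 by (auto simp: \<beta>_def right_diff_distrib)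
  have gap1: "turan_density_prod \<beta> (r - 1) * x ^ (r - 1) < fact (r - 1) * (\<delta>0 - \<theta> - \<theta>)"
    using \<theta>(3) by (simp add: k_def \<beta>_def)
  define ca where "ca = turan_density_prod \<beta> l * x ^ l / fact l"
  have "turan_density_prod \<beta> l > 0"
    unfolding turan_density_prod_def
  proof (intro prod_pos ballI)
    fix i assume "i \<in> {..<l}"
    then have "real i \<le> real (l - 1)" using r by auto
    then have "real i * \<beta> \<le> real (l - 1) * \<beta>" using \<beta>(1) by (rule mult_right_mono)
    then show "0 < 1 - real i * \<beta>" using \<beta>(2) by linarith
  qed
  then have ca: "ca > 0" using x by (simp add: ca_def)
  define cb where "cb = (1 / (2 * real l)) ^ l / fact l"
  have cb: "cb > 0" using l by (simp add: cb_def)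
  \<comment> \<open>Makes \<open>l * t\<close> at most an \<open>\<epsilon>\<close>-fraction of a
    side, and less than half a side.\<close>
  define T where "T = nat \<lceil>L / \<epsilon>\<rceil> + 2 * (l * t) + 1"
  have T: "real (l * t) \<le> \<epsilon> * real T" "2 * (l * t) < T" "T > 0"
  proof -
    have "L / \<epsilon> \<le> real T" unfolding T_def by linarith
    then show "real (l * t) \<le> \<epsilon> * real T" using \<epsilon>(1) by (simp add: L_def field_simps)
  qed (auto simp: T_def)
  define big where "big = real AB + real (r * C) / \<theta> * 4 * real l + real (r * C) / \<theta> / \<epsilon> + (L +
      1) / \<epsilon>' +
    (real C + 1) / \<epsilon>' + (L + real (8 * r)) * 4 * real l + 1"
  have ev: "\<forall>\<^sub>F n in sequentially. big \<le> real n"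
    using filterlim_real_sequentially by (simp add: filterlim_at_top)
  have l0: "0 < l" using r by simp
  show ?thesis
    using ev eventually_blowup_at[OF ca, of l "l * t + 1"] eventually_blowup_at[OF cb, of l T]
      eventually_div_power_ge[OF l0 \<theta>(1), of "l - 1 choose (r - 1)" "r - 1"]
      eventually_div_power_ge[OF l0 \<epsilon>'(1), of "l - 1 choose (r - 1)" "r - 1"]
  proof eventually_elim
    case (elim n)
    show ?case
    proof (intro allI impI, elim conjE)
      fix q \<chi> W G
      assume rf: "rainbow_free r l t q \<chi> W G" and nW: "card W = n"
        and md: "\<forall>v\<in>W. (l - 1 choose (r - 1)) * ((n - 1) div l) ^ (r - 1) \<le> card {e \<in> G. v \<in> e}"
      interpret rainbow_free r l t q \<chi> W G by (rule rf)
      have C: "codeg_factor = C" "avoid_bound = AB" by (simp_all add: C_def AB_def)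
      have nn: "0 \<le> real (r * C) / \<theta> * 4 * real l" "0 \<le> real (r * C) / \<theta> / \<epsilon>" "0 \<le> (L + 1) / \<epsilon>'"
        "0 \<le> (real C + 1) / \<epsilon>'" "0 \<le> (L + real (8 * r)) * 4 * real l" "0 \<le> real AB"
        using \<theta>(1) \<epsilon>(1) \<epsilon>'(1) L l by auto
      have N: "N = real n" using nW by simp
      have b: "real AB \<le> N" "real (r * C) / \<theta> * 4 * real l \<le> N" "real (r * C) / \<theta> / \<epsilon> \<le> N"
        "(L + 1) / \<epsilon>' \<le> N" "(real C + 1) / \<epsilon>' \<le> N" "(L + real (8 * r)) * 4 * real l < N" "N > 0"
        using elim(1) nn unfolding big_def N by linarith+
      have large: "avoid_bound \<le> card W" using b(1) by (simp add: C)
      have W0: "card W > 0" using b(7) by simp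
      have deg: "(\<delta>0 - \<theta>) * N ^ (r - 1) \<le> real (card {e \<in> G. v \<in> e})"
        "(\<delta>0 - \<epsilon>') * N ^ (r - 1) \<le> real (card {e \<in> G. v \<in> e})" if "v \<in> W" for v
      proof -
        have "real ((l - 1 choose (r - 1)) * ((n - 1) div l) ^ (r - 1)) \<le>
            real (card {e \<in> G. v \<in> e})"
          using md that by (simp only: of_nat_le_iff)
        then show "(\<delta>0 - \<theta>) * N ^ (r - 1) \<le> real (card {e \<in> G. v \<in> e})"
          "(\<delta>0 - \<epsilon>') * N ^ (r - 1) \<le> real (card {e \<in> G. v \<in> e})"
          using elim(4,5) unfolding \<delta>0_def N by linarith+
      qed
      let ?B = "bad_verts \<theta>"
      have BW: "?B \<subseteq> W" by (auto simp: bad_verts_def)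
      have cB: "real (card ?B) \<le> real (r * C) / \<theta>" using card_bad_verts[OF \<theta>(1) W0] by (simp add: C)
      have B1: "real (card ?B) \<le> N / (4 * real l)"
      proof -
        have "real (card ?B) * (4 * real l) \<le> real (r * C) / \<theta> * (4 * real l)"
          using cB by (rule mult_right_mono) simp
        also have "\<dots> \<le> N" using b(2) by (simp only: mult.assoc)
        finally show ?thesis using l(2) by (subst pos_le_divide_eq) auto
      qed
      have B2: "real (card ?B) \<le> \<epsilon> * N"
      proof -
        have "real (r * C) / \<theta> \<le> \<epsilon> * N" using b(3)[unfolded pos_divide_le_eq[OF \<epsilon>(1)]]
            by (simp only: mult.commute)
        then show ?thesis using cB by linarith
      qed
      have bl: "blowup_at l (l * t + 1) ca (card W)" "blowup_at l T cb (card W)" using elim(2,3) nW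
          by simp_all
      have dg: "(1 - 1 / real l - \<epsilon>) * N \<le> real (card {w \<in> W. adj u w})" if u: "u \<in> W - ?B" for u
        using typical_degree[OF u deg(1) \<beta> x(1) gap1 _ bl(1) large] u unfolding ca_def x_def
            by (simp add: less_imp_le)
      obtain A where A: "\<And>i. i \<in> {1..l} \<Longrightarrow> A i \<subseteq> W - ?B \<and> card (A i) = T"
        "\<And>i j a b. i \<in> {1..l} \<Longrightarrow> j \<in> {1..l} \<Longrightarrow> i \<noteq> j \<Longrightarrow> a \<in> A i \<Longrightarrow> b \<in> A j \<Longrightarrow> adj a b"
        by (rule ex_large_blowup[OF BW B1 dg less_imp_le[OF \<epsilon>(1)] \<epsilon>b T(3) _ bl(2)]) (auto simp:
            cb_def)
      obtain U where U: "\<And>i. i \<in> {1..l} \<Longrightarrow> U i \<subseteq> W" "disjoint_family_on U {1..l}"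
        "real (card (W - (\<Union>i\<in>{1..l}. U i))) \<le> \<epsilon>' * N"
        "\<And>i. i \<in> {1..l} \<Longrightarrow> real (card (U i)) \<le> (1 / real l + \<epsilon>') * N"
        "\<And>i. i \<in> {1..l} \<Longrightarrow> (1 / real l - \<epsilon>') * N \<le> real (card (U i))"
        "\<And>i j u. i \<in> {1..l} \<Longrightarrow> j \<in> {1..l} \<Longrightarrow> i \<noteq> j \<Longrightarrow> u \<in> U i \<Longrightarrow> real (card {y \<in> U j. \<not> adj u y}) \<le>
            \<epsilon>' * N"
        by (rule ex_independent_parts[where A = A and \<epsilon> = \<epsilon> and B = ?B, unfolded \<epsilon>(2)])
           (((rule BW B2 \<epsilon>(1) T(1) T(2) large) | (erule dg A(1)) | (rule A(2); assumption))+, rule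
               that)
      have LN: "L + 1 \<le> \<epsilon>' * N" "real C + 1 \<le> \<epsilon>' * N"
        using b(4,5)[unfolded pos_divide_le_eq[OF \<epsilon>'(1)]] by (simp_all only: mult.commute)
      have e1: "real (l * t) * (\<epsilon>' * N + 1) < ((L + 1) * \<epsilon>') * N"
        using LN(1) unfolding L_def[symmetric] by (simp add: algebra_simps)
      have e2: "real (l * t) * ((\<mu> + \<epsilon>') * N + 1) + real (8 * r) < (1 / real l - \<epsilon>') * N"
      proof -
        have "L * ((\<mu> + \<epsilon>') * N) \<le> L * ((\<mu> + \<mu>) * N)"
          using \<epsilon>'(2) L by (intro mult_left_mono mult_right_mono) auto
        also have "\<dots> = 2 * (L * \<mu>) * N" by (simp add: algebra_simps)
        also have "\<dots> = N / (4 * real l)" unfolding \<mu>L by simp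
        finally have 1: "L * ((\<mu> + \<epsilon>') * N) \<le> N / (4 * real l)" .
        have "(L + real (8 * r)) * (4 * real l) < N" using b(6) by (simp only: mult.assoc)
        then have 2: "L + real (8 * r) < N / (4 * real l)" using l(2)
            by (subst pos_less_divide_eq) auto
        have "\<epsilon>' \<le> 1 / (2 * real l)"
        proof -
          have "1 / (4 * (real l)\<^sup>2) \<le> 1 / (2 * real l)"
            unfolding power2_eq_square using l by (intro divide_left_mono) auto
          then show ?thesis using \<epsilon>'(2) \<mu>small by linarith
        qed
        then have "\<epsilon>' * N \<le> 1 / (2 * real l) * N" by (rule mult_right_mono) simp
        then have 3: "\<epsilon>' * N \<le> N / (2 * real l)" by simp
        have 4: "N / real l = N / (4 * real l) + N / (4 * real l) + N / (2 * real l)"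
          using l by (simp add: field_simps)
        have "L * ((\<mu> + \<epsilon>') * N + 1) + real (8 * r) = L * ((\<mu> + \<epsilon>') * N) + (L + real (8 * r))"
          by (simp add: algebra_simps)
        also have "\<dots> < N / real l - \<epsilon>' * N" using 1 2 3 4 by linarith
        also have "\<dots> = (1 / real l - \<epsilon>') * N" by (simp add: left_diff_distrib)
        finally show ?thesis by (simp only: L_def)
      qed
      have gap2: "\<epsilon>' + (L + 1) * \<epsilon>' + \<epsilon>' + (real (l - 2 choose (r - 1)) * (1 / real l +
          \<epsilon>') ^ (r - 1) +
          (1 / real l - \<mu>) * (real (l - 2 choose (r - 2)) * (1 / real l + \<epsilon>') ^ (r - 2))) < \<delta>0 - \<epsilon>'"
        using \<epsilon>'(3) unfolding h_def c1_def c2_def by linarith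
      have "card (\<chi> ` rsets r W) \<le> turan_number r (card W) l + 1"
        by (rule card_colors_le[where U = U and \<epsilon> = \<epsilon>' and \<mu> = \<mu> and \<eta> = "(L + 1) * \<epsilon>'" and \<zeta> = \<epsilon>'
            and \<delta> = "\<delta>0 - \<epsilon>'"])
           (fact U deg(2) \<epsilon>'(1) less_imp_le[OF \<mu>] e1 LN(2)[folded C(1)] gap2 e2 large)+
      then show "card (\<chi> ` rsets r W) \<le> turan_number r n l + 1" using nW by simp
    qed
  qed
qed

section \<open>The theorem\<close>

abbreviation second_edges :: "(nat \<times> nat) set set" where
  "second_edges \<equiv> {{(1, 2), (1, 3)}, {(1, 3), (1, 4)}, {(2, 1), (2, 2)}}"

abbreviation multipartite_plus :: "nat \<Rightarrow> nat \<Rightarrow> (nat \<times> nat) set \<Rightarrow> (nat \<times> nat) set set" where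
  "multipartite_plus l t q \<equiv> complete_multipartite l t \<union> {first_edge, q}"

text \<open>While some vertex supports fewer private colours than a vertex of the Turan graph, deleting it
  increases the surplus of colours over the Turan number. Since the surplus is at most \<open>2 ^ M\<close> on
  \<open>M\<close> vertices, the process stops on a large set, where \<open>eventually_few_colors\<close> applies.\<close>

lemma eventually_rainbow_copy:
  fixes r l t :: nat
  assumes r: "4 \<le> r" "r \<le> l" and t: "4 \<le> t"
  shows "\<forall>\<^sub>F n in sequentially. \<forall>q\<in>second_edges. \<forall>\<chi>. turan_number r n l + 2 \<le>
      card (\<chi> ` rsets r {1..n}) \<longrightarrow>
    (\<exists>H \<subseteq> rsets r {1..n}. is_copy H (expansion r (multipartite_plus l t q)) \<and> rainbow \<chi> H)"
proof -
  obtain M0 where M0: "\<And>n. M0 \<le> n \<Longrightarrow> \<forall>q \<chi> W G. rainbow_free r l t q \<chi> W G \<and> card W = n \<and>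
    (\<forall>v\<in>W. (l - 1 choose (r - 1)) * ((n - 1) div l) ^ (r - 1) \<le> card {e \<in> G. v \<in> e}) \<longrightarrow>
    card (\<chi> ` rsets r W) \<le> turan_number r n l + 1"
    using eventually_few_colors[OF assms] unfolding eventually_sequentially by blast
  \<comment> \<open>Every set from which a vertex is deleted has more than \<open>M\<close>
    vertices, so \<open>eventually_few_colors\<close> is available throughout.\<close>
  define M where "M = M0 + 1"
  have "\<exists>H \<subseteq> rsets r {1..n}. is_copy H (expansion r (multipartite_plus l t q)) \<and> rainbow \<chi> H"
    if n: "M + 2 ^ M + 1 \<le> n" and q: "q \<in> second_edges"
        and many: "turan_number r n l + 2 \<le> card (\<chi> ` rsets r {1..n})"
    for n q \<chi>
  proof (rule ccontr)
    assume free: "\<not> ?thesis"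
    have "\<exists>W \<subseteq> {1..n}. card W = n - j \<and> turan_number r (n - j) l + 2 + j \<le> card (\<chi> ` rsets r W)"
        if "j \<le> n - M" for j
      using that
    proof (induction j)
      case 0
      then show ?case using many by (intro exI[of _ "{1..n}"]) auto
    next
      case (Suc j)
      then obtain W where W: "W \<subseteq> {1..n}" "card W = n - j" "turan_number r (n - j) l + 2 + j \<le>
          card (\<chi> ` rsets r W)"
        by auto
      have fW: "finite W" using W(1) finite_subset by blast
      define m where "m = n - Suc j"
      have m: "n - j = Suc m" "M0 \<le> Suc m" using Suc.prems n by (auto simp: m_def M_def)
      obtain G where G: "G \<subseteq> rsets r W" "inj_on \<chi> G" "\<chi> ` rsets r W = \<chi> ` G"
        using subset_image_inj[of "\<chi> ` rsets r W" \<chi> "rsets r W"] by blast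
      have rf: "rainbow_free r l t q \<chi> W G"
      proof
        show "\<not> (\<exists>H \<subseteq> rsets r W. is_copy H (expansion r (multipartite_plus l t q)) \<and> rainbow \<chi> H)"
          using free rsets_mono[OF W(1), of r] by blast
      qed (use r t q fW G in auto)
      have "\<not> (\<forall>v\<in>W. (l - 1 choose (r - 1)) * ((Suc m - 1) div l) ^ (r - 1) \<le> card {e \<in> G. v \<in> e})"
      proof
        assume "\<forall>v\<in>W. (l - 1 choose (r - 1)) * ((Suc m - 1) div l) ^ (r - 1) \<le> card {e \<in> G. v \<in> e}"
        then have "card (\<chi> ` rsets r W) \<le> turan_number r (Suc m) l + 1"
          by (intro M0[OF m(2), THEN spec, THEN spec, THEN spec, THEN spec, THEN mp, of q \<chi> W G]
              conjI rf)
             (simp_all only: W(2) m(1))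
        then show False using W(3) m(1) by simp
      qed
      then obtain v where v: "v \<in> W"
          "card {e \<in> G. v \<in> e} < (l - 1 choose (r - 1)) * (m div l) ^ (r - 1)"
        by (auto simp: not_le)
      have fG: "finite G" using G(1) fW by (simp add: finite_subset)
      have "card G = card {e \<in> G. v \<in> e} + card {e \<in> G. v \<notin> e}"
        using fG by (subst card_Un_disjoint[symmetric]) (auto intro: arg_cong[where f = card])
      moreover have "card (\<chi> ` rsets r W) = card G" using G(2,3) by (simp add: card_image)
      \<comment> \<open>Edges of \<open>G\<close> off \<open>v\<close> keep their distinct colours
        in \<open>W - {v}\<close>, so deleting \<open>v\<close> costs at most its degree in
        \<open>G\<close>, which is less than the drop in the Turan number.\<close>
      moreover have "card {e \<in> G. v \<notin> e} \<le> card (\<chi> ` rsets r (W - {v}))"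
      proof -
        have "card {e \<in> G. v \<notin> e} = card (\<chi> ` {e \<in> G. v \<notin> e})"
          using G(2) by (intro card_image[symmetric]) (auto simp: inj_on_def)
        also have "\<dots> \<le> card (\<chi> ` rsets r (W - {v}))"
          using G(1) fW by (intro card_mono image_mono) (auto simp: rsets_def)
        finally show ?thesis .
      qed
      moreover have "turan_number r m l + (l - 1 choose (r - 1)) * (m div l) ^ (r - 1) \<le>
          turan_number r (Suc m) l"
        using turan_number_Suc[of l "r - 1" m] r by simp
      ultimately have "turan_number r m l + 2 + Suc j \<le> card (\<chi> ` rsets r (W - {v}))"
        using W(3) v(2) m(1) by simp
      moreover have "card (W - {v}) = m" using v W(2) m(1) fW by simp
      ultimately show ?case using W(1) unfolding m_def by (intro exI[of _ "W - {v}"]) auto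
    qed
    from this[of "n - M"] obtain W where W: "W \<subseteq> {1..n}" "card W = M"
      "turan_number r M l + 2 + (n - M) \<le> card (\<chi> ` rsets r W)"
      using n by auto
    have fW: "finite W" using W(1) finite_subset by blast
    have "card (\<chi> ` rsets r W) \<le> card (rsets r W)" using fW by (intro card_image_le) simp
    also have "\<dots> \<le> card (Pow W)" using fW by (intro card_mono) (auto simp: rsets_def)
    also have "\<dots> = 2 ^ M" using fW W(2) by (simp add: card_Pow)
    finally show False using W(3) n by simp
  qed
  then show ?thesis unfolding eventually_sequentially by blast
qed

section \<open>Lower bound: the Turan colouring\<close>

definition near_transversal :: "nat \<Rightarrow> nat \<Rightarrow> nat \<Rightarrow> nat \<Rightarrow> nat \<Rightarrow> (nat \<times> nat) set" where
  "near_transversal l j a b s = {(j, a), (j, b)} \<union> (\<lambda>i. (i, s)) ` ({1..l} - {j})"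

text \<open>The set spans a complete graph on \<open>l + 1\<close> vertices in \<open>F\<close>: two
  vertices of part \<open>j\<close> joined by an extra edge, and one vertex of every other part.
  With \<open>l\<close> colours two of them agree. The level \<open>s\<close> serves to keep two
  such sets apart.\<close>

lemma near_transversal_monochromatic_pair:
  fixes c :: "nat \<times> nat \<Rightarrow> nat"
  assumes j: "j \<in> {1..l}" and ab: "a \<noteq> b" "a \<in> {1..t}" "b \<in> {1..t}" "s \<in> {1..t}"
    and F: "complete_multipartite l t \<subseteq> F" "{(j, a), (j, b)} \<in> F" and c: "\<And>v. c v < l"
  obtains x y where "x \<in> near_transversal l j a b s" "y \<in> near_transversal l j a b s" "x \<noteq> y"
      "c x = c y" "{x, y} \<in> F"
proof -
  let ?S = "near_transversal l j a b s"
  have fin: "finite ?S" by (simp add: near_transversal_def)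
  have "card ((\<lambda>i. (i, s)) ` ({1..l} - {j})) = l - 1"
    using j by (subst card_image) (auto simp: inj_on_def)
  then have "card ?S = 2 + (l - 1)"
    unfolding near_transversal_def using ab(1) by (subst card_Un_disjoint) auto
  then have "card {..<l} < card ?S" using j by simp
  moreover have "c ` ?S \<subseteq> {..<l}" using c by auto
  ultimately have "\<not> inj_on c ?S" using card_inj_on_le[of c ?S "{..<l}"] by auto
  then obtain x y where xy: "x \<in> ?S" "y \<in> ?S" "x \<noteq> y" "c x = c y" by (auto simp: inj_on_def)
  have el: "x = (j, a) \<or> x = (j, b) \<or> (\<exists>i\<in>{1..l} - {j}. x = (i, s))" if "x \<in> ?S" for x
    using that by (auto simp: near_transversal_def)
  have cm: "{(i, a'), (i', b')} \<in> F" if "i \<in> {1..l}" "i' \<in> {1..l}" "i \<noteq> i'" "a' \<in> {1..t}"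
      "b' \<in> {1..t}" for i i' a' b'
    using F(1) that unfolding complete_multipartite_def by blast
  have "{x, y} \<in> F"
    using el[OF xy(1)] el[OF xy(2)]
  proof (elim disjE bexE)
    fix i i' assume "i \<in> {1..l} - {j}" "x = (i, s)" "i' \<in> {1..l} - {j}" "y = (i', s)"
    then show ?thesis using cm[of i i' s s] xy(3) ab by auto
  qed (use xy(3) j ab F(2) cm in \<open>auto simp: insert_commute\<close>)
  then show ?thesis using xy by (intro that)
qed

text \<open>There are two copies of the complete graph on \<open>l + 1\<close> vertices with at most one common vertex,
    and
  each of them contains a monochromatic edge.\<close>

lemma two_monochromatic_edges:
  fixes c :: "nat \<times> nat \<Rightarrow> nat"
  assumes l: "2 \<le> l" and t: "4 \<le> t" and q: "q \<in> second_edges" and c: "\<And>v. c v < l"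
  obtains x y x' y' where "{x, y} \<in> multipartite_plus l t q" "{x', y'} \<in> multipartite_plus l t q"
    "x \<noteq> y" "x' \<noteq> y'" "c x = c y" "c x' = c y'" "{x, y} \<noteq> {x', y'}"
proof -
  note result = that
  have sub: "complete_multipartite l t \<subseteq> multipartite_plus l t q" by blast
  have fe: "{(1, 1), (1, 2)} \<in> multipartite_plus l t q" by blast
  have one: "1 \<in> {1..l}" "(1 :: nat) \<noteq> 2" "1 \<in> {1..t}" "2 \<in> {1..t}" using l t by auto
  have gen: thesis
    if s: "s \<in> {1..t}" "j \<in> {1..l}" "a \<noteq> b" "a \<in> {1..t}" "b \<in> {1..t}" "s' \<in> {1..t}"
        "q = {(j, a), (j, b)}"
      "near_transversal l 1 1 2 s \<inter> near_transversal l j a b s' \<subseteq> {z}" for s j a b s' z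
  proof -
    obtain x y where xy: "x \<in> near_transversal l 1 1 2 s" "y \<in> near_transversal l 1 1 2 s" "x \<noteq> y"
        "c x = c y"
      "{x, y} \<in> multipartite_plus l t q"
      by (rule near_transversal_monochromatic_pair[OF one s(1) sub fe c])
    have qe: "{(j, a), (j, b)} \<in> multipartite_plus l t q" using s(7) by blast
    obtain x' y' where xy': "x' \<in> near_transversal l j a b s'" "y' \<in> near_transversal l j a b s'"
        "x' \<noteq> y'" "c x' = c y'"
      "{x', y'} \<in> multipartite_plus l t q"
      by (rule near_transversal_monochromatic_pair[OF s(2-6) sub qe c])
    have "{x, y} \<noteq> {x', y'}"
    proof
      assume "{x, y} = {x', y'}"
      moreover have "{x', y'} \<subseteq> near_transversal l j a b s'" using xy'(1,2) by blast
      ultimately have "x \<in> near_transversal l j a b s'" "y \<in> near_transversal l j a b s'" by blast+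
      then have "x = z" "y = z" using xy(1,2) s(8) by blast+
      then show False using xy(3) by simp
    qed
    from result[OF xy(5) xy'(5) xy(3) xy'(3) xy(4) xy'(4) this] show thesis .
  qed
  from q consider "q = {(1, 2), (1, 3)}" | "q = {(1, 3), (1, 4)}" | "q = {(2, 1), (2, 2)}" by blast
  then show thesis
  proof cases
    case 1
    have "near_transversal l 1 1 2 1 \<inter> near_transversal l 1 2 3 2 \<subseteq> {(1, 2)}"
      by (auto simp: near_transversal_def)
    then show ?thesis using gen[of 1 1 2 3 2 "(1, 2)"] l t 1 by simp
  next
    case 2
    have "near_transversal l 1 1 2 1 \<inter> near_transversal l 1 3 4 2 \<subseteq> {(1, 2)}"
      by (auto simp: near_transversal_def)
    then show ?thesis using gen[of 1 1 3 4 2 "(1, 2)"] l t 2 by simp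
  next
    case 3
    \<comment> \<open>Levels \<open>3\<close> and \<open>4\<close> keep the two sets disjoint, since
      levels \<open>1\<close> and \<open>2\<close> of both parts are occupied by ends of extra
      edges. The vertex \<open>(1, 2)\<close> is a mere placeholder when the sets are
      disjoint.\<close>
    have "near_transversal l 1 1 2 3 \<inter> near_transversal l 2 1 2 4 \<subseteq> {(1, 2)}"
      by (auto simp: near_transversal_def)
    then show ?thesis using gen[of 3 2 1 2 4 "(1, 2)"] l t 3 by simp
  qed
qed

text \<open>Colouring the vertices of \<open>F\<close> by the residues of their images modulo
  \<open>l\<close> makes two edges of \<open>F\<close> monochromatic. The corresponding edges of
  \<open>H\<close> have two vertices in one part, so they lie outside the Turan
  \<open>r\<close>-graph and share the colour \<open>m\<close>.\<close>

lemma turan_coloring_no_rainbow_copy: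
  assumes l: "2 \<le> l" and t: "4 \<le> t" and q: "q \<in> second_edges"
    and \<chi>: "\<And>e. e \<in> complete_rgraph r n - turan_rgraph r n l \<Longrightarrow> \<chi> e = m"
    and H: "H \<subseteq> complete_rgraph r n" "is_copy H (expansion r (multipartite_plus l t q))"
  shows "\<not> rainbow \<chi> H"
proof
  assume rb: "rainbow \<chi> H"
  let ?F = "multipartite_plus l t q"
  let ?X = "\<lambda>e. Inl ` e \<union> (\<lambda>i. Inr (e, i)) ` {..<r - 2}"
  obtain \<phi> where \<phi>: "bij_betw \<phi> (\<Union>(expansion r ?F)) (\<Union>H)" "H = (\<lambda>e. \<phi> ` e) ` expansion r ?F"
    using H(2) unfolding is_copy_def by blast
  have inj: "inj_on \<phi> (\<Union>(expansion r ?F))" using \<phi>(1) by (simp add: bij_betw_def)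
  define c where "c v = \<phi> (Inl v) mod l" for v
  have cl: "c v < l" for v using l by (simp add: c_def)
  have X: "?X e \<in> expansion r ?F" "\<phi> ` ?X e \<in> H" if "e \<in> ?F" for e
  proof -
    show "?X e \<in> expansion r ?F" unfolding expansion_def using that by (rule imageI)
    then show "\<phi> ` ?X e \<in> H" unfolding \<phi>(2) by (rule imageI)
  qed
  have mono: "\<chi> (\<phi> ` ?X {x, y}) = m" if e: "{x, y} \<in> ?F" "x \<noteq> y" "c x = c y" for x y
  proof (rule \<chi>)
    have hH: "\<phi> ` ?X {x, y} \<in> complete_rgraph r n" using X(2)[OF e(1)] H(1) by blast
    have "Inl x \<in> \<Union>(expansion r ?F)" "Inl y \<in> \<Union>(expansion r ?F)" using X(1)[OF e(1)] by blast+
    then have ne: "\<phi> (Inl x) \<noteq> \<phi> (Inl y)" using inj e(2) by (auto dest: inj_onD)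
    have mem: "\<phi> (Inl x) \<in> \<phi> ` ?X {x, y}" "\<phi> (Inl y) \<in> \<phi> ` ?X {x, y}" by blast+
    have "\<phi> ` ?X {x, y} \<notin> turan_rgraph r n l"
    proof
      assume T: "\<phi> ` ?X {x, y} \<in> turan_rgraph r n l"
      let ?e = "\<phi> ` ?X {x, y}"
      have sub: "?e \<subseteq> {1..n}" using hH by (simp add: complete_rgraph_def)
      have "(\<Union>i\<in>{1..l}. residue_part n l i) = {1..n}"
        using balanced_residue_part[of l n] l by (simp add: balanced_partition_def)
      then obtain i where i: "i \<in> {1..l}" "\<phi> (Inl x) \<in> residue_part n l i" using sub mem(1) by blast
      have "\<phi> (Inl y) \<in> residue_part n l i"
        using i(2) e(3) sub mem(2) unfolding c_def residue_part_def by auto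
      then have "{\<phi> (Inl x), \<phi> (Inl y)} \<subseteq> ?e \<inter> residue_part n l i" using i(2) mem by blast
      moreover have "finite (?e \<inter> residue_part n l i)" by (simp add: residue_part_def)
      ultimately have "card {\<phi> (Inl x), \<phi> (Inl y)} \<le> card (?e \<inter> residue_part n l i)"
          by (rule card_mono[rotated])
      also have "\<dots> \<le> 1" using T i(1) unfolding turan_rgraph_def partite_rgraph_def by blast
      finally show False using ne by simp
    qed
    then show "\<phi> ` ?X {x, y} \<in> complete_rgraph r n - turan_rgraph r n l" using hH by blast
  qed
  obtain x y x' y' where xy: "{x, y} \<in> ?F" "{x', y'} \<in> ?F" "x \<noteq> y" "x' \<noteq> y'" "c x = c y"
      "c x' = c y'" "{x, y} \<noteq> {x', y'}"
    by (rule two_monochromatic_edges[OF l t q cl])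
  \<comment> \<open>The \<open>Inl\<close> part of an expanded edge recovers the edge of
    \<open>F\<close>, and \<open>\<phi>\<close> is injective.\<close>
  have "\<phi> ` ?X {x, y} \<noteq> \<phi> ` ?X {x', y'}"
  proof
    assume eq: "\<phi> ` ?X {x, y} = \<phi> ` ?X {x', y'}"
    have s: "?X {x, y} \<subseteq> \<Union>(expansion r ?F)" "?X {x', y'} \<subseteq> \<Union>(expansion r ?F)"
      using X(1)[OF xy(1)] X(1)[OF xy(2)] by blast+
    have "?X {x, y} = ?X {x', y'}" by (rule iffD1[OF inj_on_image_eq_iff[OF inj s(1) s(2)] eq])
    then have "Inl -` ?X {x, y} = Inl -` ?X {x', y'}" by (simp only:)
    moreover have inv: "Inl -` ?X e = e" for e by auto
    ultimately have "{x, y} = {x', y'}" by (simp only: inv)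
    then show False using xy(7) by contradiction
  qed
  moreover have "\<chi> (\<phi> ` ?X {x, y}) = \<chi> (\<phi> ` ?X {x', y'})"
    using mono[OF xy(1,3,5)] mono[OF xy(2,4,6)] by simp
  ultimately show False
    using rb[unfolded rainbow_def, THEN bspec, OF X(2)[OF xy(1)], THEN bspec, OF X(2)[OF xy(2)]]
        by (simp only: simp_thms)
qed

text \<open>Since \<open>ar\<close> is a least element, every smaller positive number of colours
  needs its own surjective colouring. Capping the Turan colouring at \<open>m\<close> merges only
  the top colours and keeps the edges outside the Turan \<open>r\<close>-graph in one
  colour.\<close>

lemma ex_coloring_no_rainbow_copy:
  assumes l: "2 \<le> l" "2 \<le> r" and t: "4 \<le> t" and q: "q \<in> second_edges" and n: "l + r + 1 \<le> n"
    and m: "1 \<le> m" "m \<le> turan_number r n l + 1"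
  shows "\<exists>\<chi>. \<chi> ` complete_rgraph r n = {1..m} \<and>
    \<not> (\<exists>H \<subseteq> complete_rgraph r n. is_copy H (expansion r (multipartite_plus l t q)) \<and> rainbow \<chi> H)"
proof -
  let ?T = "turan_rgraph r n l" and ?K = "complete_rgraph r n"
  define \<tau> where "\<tau> = turan_number r n l"
  have TK: "?T \<subseteq> ?K" by (auto simp: turan_rgraph_def partite_rgraph_def complete_rgraph_def)
  have fK: "finite ?K" by (simp add: complete_rgraph_eq_rsets)
  then have fT: "finite ?T" using TK finite_subset by blast
  obtain g where g: "bij_betw g ?T {1..\<tau>}"
  proof -
    have "card ?T = card {1..\<tau>}" by (simp add: \<tau>_def turan_number_def)
    then show ?thesis using finite_same_card_bij[OF fT finite_atLeastAtMost] that by blast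
  qed
  define \<chi>0 where "\<chi>0 e = (if e \<in> ?T then g e else \<tau> + 1)" for e
  define \<chi> where "\<chi> e = min m (\<chi>0 e)" for e
  \<comment> \<open>\<open>1\<close> and \<open>l + 1\<close> are congruent modulo \<open>l\<close>,
    so an \<open>r\<close>-set through both lies outside the Turan \<open>r\<close>-graph; such a
    set makes the extra colour \<open>\<tau> + 1\<close> occur.\<close>
  have sub: "{1, l + 1} \<subseteq> {1..n}" using n by auto
  have cr: "card {1, l + 1} \<le> r" using l by (simp add: card_insert_if)
  have cn: "card ({} :: nat set) + r \<le> card {1..n}" using n by simp
  obtain f where f: "f \<in> rsets r {1..n}" "{1, l + 1} \<subseteq> f" "f \<inter> {} \<subseteq> {1, l + 1}"
    by (rule extend_to_rset[OF finite_atLeastAtMost sub cr finite.emptyI cn])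
  have "f \<notin> ?T"
  proof
    assume "f \<in> ?T"
    then have "\<forall>i\<in>{1..l}. card (f \<inter> residue_part n l i) \<le> 1"
      unfolding turan_rgraph_def partite_rgraph_def by blast
    moreover have "1 \<in> {1..l}" using l by simp
    ultimately have c1: "card (f \<inter> residue_part n l 1) \<le> 1" by blast
    have "1 \<in> residue_part n l 1" "l + 1 \<in> residue_part n l 1"
      using n mod_add_self1[of l 1] by (auto simp: residue_part_def simp del: mod_add_self1)
    then have sub1: "{1, l + 1} \<subseteq> f \<inter> residue_part n l 1" using f(2) by blast
    have "finite (f \<inter> residue_part n l 1)" by (simp add: residue_part_def)
    then have "card {1, l + 1} \<le> 1" using card_mono[OF _ sub1] c1 by linarith
    then show False using l by simp
  qed
  then have fin: "f \<in> ?K" "\<chi>0 f = \<tau> + 1" using f(1) by (auto simp: complete_rgraph_eq_rsets \<chi>0_def)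
  have im0: "\<chi>0 ` ?K = {1..\<tau> + 1}"
  proof
    have "g e \<in> {1..\<tau>}" if "e \<in> ?T" for e using bij_betwE[OF g] that by blast
    then show "\<chi>0 ` ?K \<subseteq> {1..\<tau> + 1}" by (force simp: \<chi>0_def)
    have "g ` ?T \<subseteq> \<chi>0 ` ?K" using TK by (force simp: \<chi>0_def)
    then have "{1..\<tau>} \<subseteq> \<chi>0 ` ?K" using g by (simp add: bij_betw_def)
    moreover have "\<tau> + 1 \<in> \<chi>0 ` ?K" using fin by (metis imageI)
    moreover have "{1..\<tau> + 1} = insert (\<tau> + 1) {1..\<tau>}" by auto
    ultimately show "{1..\<tau> + 1} \<subseteq> \<chi>0 ` ?K" by (simp only: insert_subset)
  qed
  have "\<chi> ` ?K = min m ` {1..\<tau> + 1}" unfolding im0[symmetric] image_image \<chi>_def ..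
  also have "\<dots> = {1..m}"
  proof
    show "min m ` {1..\<tau> + 1} \<subseteq> {1..m}" using m by auto
    show "{1..m} \<subseteq> min m ` {1..\<tau> + 1}"
    proof
      fix k assume "k \<in> {1..m}"
      then have "k = min m k" "k \<in> {1..\<tau> + 1}" using m by (auto simp: \<tau>_def)
      then show "k \<in> min m ` {1..\<tau> + 1}" by (rule image_eqI)
    qed
  qed
  finally have im: "\<chi> ` ?K = {1..m}" .
  have "\<not> rainbow \<chi> H" if "H \<subseteq> ?K" "is_copy H (expansion r (multipartite_plus l t q))" for H
    by (rule turan_coloring_no_rainbow_copy[OF l(1) t q _ that, where m = "min m (\<tau> + 1)"])
       (simp add: \<chi>_def \<chi>0_def)
  then show ?thesis using im by blast
qed

theorem theorem1p5:
  fixes l r t :: nat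
  assumes "r \<ge> 4" and "l \<ge> r" and "t \<ge> 4"
  shows "\<forall>\<^sub>F n in sequentially. \<forall>F \<in> {K_alpha l t, K_beta l t, K_gamma l t}.
           ar r n (expansion r F) = turan_number r n l + 2"
  using eventually_rainbow_copy[OF assms] eventually_ge_at_top[of "l + r + 1"]
proof eventually_elim
  case (elim n)
  have main: "ar r n (expansion r (multipartite_plus l t q)) = turan_number r n l + 2"
      if q: "q \<in> second_edges" for q
    unfolding ar_def
  proof (rule Least_equality)
    show "1 \<le> turan_number r n l + 2 \<and> (\<forall>\<chi>. \<chi> ` complete_rgraph r n = {1..turan_number r n l + 2} \<longrightarrow>
        (\<exists>G \<subseteq> complete_rgraph r n. is_copy G (expansion r (multipartite_plus l t q)) \<and> rainbow \<chi>
            G))"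
    proof (intro conjI allI impI)
      fix \<chi> :: "nat set \<Rightarrow> nat"
      assume "\<chi> ` complete_rgraph r n = {1..turan_number r n l + 2}"
      then have "turan_number r n l + 2 \<le> card (\<chi> ` rsets r {1..n})"
          by (simp add: complete_rgraph_eq_rsets)
      then show "\<exists>G \<subseteq> complete_rgraph r n. is_copy G (expansion r (multipartite_plus l t q)) \<and>
          rainbow \<chi> G"
        using elim(1) q unfolding complete_rgraph_eq_rsets by blast
    qed simp
  next
    fix m assume m: "1 \<le> m \<and> (\<forall>\<chi>. \<chi> ` complete_rgraph r n = {1..m} \<longrightarrow>
        (\<exists>G \<subseteq> complete_rgraph r n. is_copy G (expansion r (multipartite_plus l t q)) \<and> rainbow \<chi>
            G))"
    show "turan_number r n l + 2 \<le> m"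
    proof (rule ccontr)
      assume "\<not> ?thesis"
      then have m': "m \<le> turan_number r n l + 1" by simp
      have l: "2 \<le> l" "2 \<le> r" using assms by auto
      from ex_coloring_no_rainbow_copy[OF l assms(3) q elim(2) conjunct1[OF m] m'] conjunct2[OF m]
      show False by blast
    qed
  qed
  show ?case
    using main[of "{(1, 2), (1, 3)}"] main[of "{(1, 3), (1, 4)}"] main[of "{(2, 1), (2, 2)}"]
    by (simp add: K_alpha_def K_beta_def K_gamma_def)
qed

end
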